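(* Let $n\geq 2$ be a natural number. There is a tower of covering spaces $$\ldots\to Z_n^{j+1}\to Z_n^{j}\to\ldots\to Z_n^{2}\to Z_n^{1}=Z_n\to V_n\simeq D_n\xrightarrow{\ p\ } C_n,$$ where $p$ is a covering map of degree $n$, all other arrows are covering maps of degree $n^{n-1}$, and $\simeq$ denotes homotopy equivalence.
   Context: Let $n\ge 2$. $C_n$ is the space of monic complex polynomials of degree $n$ with $n$ distinct roots; equivalently, the configuration space of $n$ distinct unordered points in $\mathbb{C}$. $D_n=\{(z_1,\ldots,z_n)\in\mathbb{C}^n: z_i\neq z_j\text{ if }i\neq j\}/S_{n-1}$, where $S_{n-1}$ permutes the last $n-1$ coordinates. The map $p:D_n\to C_n$ sends the class of $(z_1,\ldots,z_n)$ to the unordered configuration $\{z_1,\ldots,z_n\}$. $V_n=\{(v_1,\ldots,v_{n-1})\in(\mathbb{C}\setminus\{0\})^{n-1}: v_i\neq v_j\text{ if }i\neq j\}/S_{n-1}$. $Z_n\subset C_n$ is the set of polynomials $f\in C_n$ with constant term $0$ that have $n-1$ distinct (necessarily non-zero) critical values. The map $\theta_n:Z_n\to V_n$ sends $f$ to its unordered set of critical values $(v_1,\ldots,v_{n-1})$. $Z_n^1=Z_n$, and inductively $Z_n^{j+1}$ is the set of $f\in Z_n$ whose critical values $(v_1,\ldots,v_{n-1})$ satisfy $z\prod_{i=1}^{n-1}(z-v_i)\in Z_n^j$. The map $Z_n^1\to V_n$ in the tower is $\theta_n$, and the map $Z_n^{j+1}\to Z_n^j$ sends $f$ with critical values $(v_1,\ldots,v_{n-1})$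 to the polynomial $z\prod_{i=1}^{n-1}(z-v_i)$. All spaces of polynomials carry the topology given by the coefficients (equivalently, by the unordered tuple of roots). *)

theory Defs
  imports "HOL-Analysis.Analysis" "HOL-Computational_Algebra.Polynomial"
    "HOL-Combinatorics.Permutations"
begin

(* Covering maps between abstract topologies: the type-class based covering_space of HOL-Analysis
   does not apply to quotient spaces.  The definition is the same, see covering_map_euclidean. *)

definition covering_map :: "'a topology \<Rightarrow> 'b topology \<Rightarrow> ('a \<Rightarrow> 'b) \<Rightarrow> bool" where
  "covering_map X Y p \<longleftrightarrow>
     continuous_map X Y p \<and> p ` topspace X = topspace Y \<and>
     (\<forall>y \<in> topspace Y. \<exists>T. y \<in> T \<and> openin Y T \<and>
        (\<exists>\<V>. \<Union>\<V> = {x \<in> topspace X. p x \<in> T} \<and>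
             (\<forall>U \<in> \<V>. openin X U) \<and>
             pairwise disjnt \<V> \<and>
             (\<forall>U \<in> \<V>. homeomorphic_map (subtopology X U) (subtopology Y T) p)))"

definition covering_map_of_degree :: "nat \<Rightarrow> 'a topology \<Rightarrow> 'b topology \<Rightarrow> ('a \<Rightarrow> 'b) \<Rightarrow> bool" where
  "covering_map_of_degree d X Y p \<longleftrightarrow>
     covering_map X Y p \<and> (\<forall>y \<in> topspace Y. card {x \<in> topspace X. p x = y} = d)"

lemma covering_map_euclidean:
  fixes p :: "'a::topological_space \<Rightarrow> 'b::topological_space"
  shows "covering_map (top_of_set c) (top_of_set S) p \<longleftrightarrow> covering_space c p S"
proof -
  have *: "homeomorphic_map (subtopology (top_of_set c) U) (subtopology (top_of_set S) T) p
             \<longleftrightarrow> (\<exists>q. homeomorphism U T p q)"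
    if "openin (top_of_set c) U" "openin (top_of_set S) T" for U T
  proof -
    have "U \<subseteq> c" "T \<subseteq> S"
      using that openin_subset by fastforce+
    then have "subtopology (top_of_set c) U = top_of_set U" "subtopology (top_of_set S) T = top_of_set T"
      by (simp_all add: subtopology_subtopology Int_absorb1)
    moreover have "homeomorphic_maps (top_of_set U) (top_of_set T) p q \<longleftrightarrow> homeomorphism U T p q" for q
    proof
      assume "homeomorphic_maps (top_of_set U) (top_of_set T) p q"
      then have "continuous_on U p" "continuous_on T q" "p ` U \<subseteq> T" "q ` T \<subseteq> U"
        "\<forall>x\<in>U. q (p x) = x" "\<forall>y\<in>T. p (q y) = y"
        by (auto simp: homeomorphic_maps_def continuous_map_in_subtopology)
      then show "homeomorphism U T p q"
        by (intro homeomorphismI) auto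
    next
      assume "homeomorphism U T p q"
      then show "homeomorphic_maps (top_of_set U) (top_of_set T) p q"
        unfolding homeomorphic_maps_def homeomorphism_def
        by (auto simp: continuous_map_in_subtopology)
    qed
    ultimately show ?thesis
      by (simp add: homeomorphic_map_maps)
  qed
  have pre: "{x \<in> c. p x \<in> T} = c \<inter> p -` T" for T
    by auto
  have cont: "continuous_map (top_of_set c) (top_of_set S) p \<and> p ` c = S
                \<longleftrightarrow> continuous_on c p \<and> p ` c = S"
    by (auto simp: continuous_map_in_subtopology)
  have sheets: "(\<exists>\<V>. \<Union>\<V> = c \<inter> p -` T \<and> (\<forall>U\<in>\<V>. openin (top_of_set c) U) \<and> pairwise disjnt \<V> \<and>
                 (\<forall>U\<in>\<V>. homeomorphic_map (subtopology (top_of_set c) U) (subtopology (top_of_set S) T) p))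
            \<longleftrightarrow> (\<exists>\<V>. \<Union>\<V> = c \<inter> p -` T \<and> (\<forall>U\<in>\<V>. openin (top_of_set c) U) \<and> pairwise disjnt \<V> \<and>
                 (\<forall>U\<in>\<V>. \<exists>q. homeomorphism U T p q))"
    if "openin (top_of_set S) T" for T
  proof (rule ex_cong1)
    fix \<V>
    have "(\<forall>U\<in>\<V>. homeomorphic_map (subtopology (top_of_set c) U) (subtopology (top_of_set S) T) p)
            \<longleftrightarrow> (\<forall>U\<in>\<V>. \<exists>q. homeomorphism U T p q)"
      if "\<forall>U\<in>\<V>. openin (top_of_set c) U"
      by (rule ball_cong[OF refl], rule *) (use that \<open>openin (top_of_set S) T\<close> in blast)+
    then show "\<Union>\<V> = c \<inter> p -` T \<and> (\<forall>U\<in>\<V>. openin (top_of_set c) U) \<and> pairwise disjnt \<V> \<and>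
                 (\<forall>U\<in>\<V>. homeomorphic_map (subtopology (top_of_set c) U) (subtopology (top_of_set S) T) p)
            \<longleftrightarrow> \<Union>\<V> = c \<inter> p -` T \<and> (\<forall>U\<in>\<V>. openin (top_of_set c) U) \<and> pairwise disjnt \<V> \<and>
                 (\<forall>U\<in>\<V>. \<exists>q. homeomorphism U T p q)"
      by argo
  qed
  have "(\<exists>T. y \<in> T \<and> openin (top_of_set S) T \<and>
          (\<exists>\<V>. \<Union>\<V> = c \<inter> p -` T \<and> (\<forall>U\<in>\<V>. openin (top_of_set c) U) \<and> pairwise disjnt \<V> \<and>
            (\<forall>U\<in>\<V>. homeomorphic_map (subtopology (top_of_set c) U) (subtopology (top_of_set S) T) p)))
        \<longleftrightarrow> (\<exists>T. y \<in> T \<and> openin (top_of_set S) T \<and>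
          (\<exists>\<V>. \<Union>\<V> = c \<inter> p -` T \<and> (\<forall>U\<in>\<V>. openin (top_of_set c) U) \<and> pairwise disjnt \<V> \<and>
            (\<forall>U\<in>\<V>. \<exists>q. homeomorphism U T p q)))" for y
    by (intro ex_cong1 conj_cong refl sheets)
  then show ?thesis
    unfolding covering_map_def covering_space_def topspace_euclidean_subtopology pre
    using cont by (simp only: conj_assoc[symmetric])
qed

(* The quotient topology on q ` topspace X. *)

definition quotient_topology :: "'a topology \<Rightarrow> ('a \<Rightarrow> 'b) \<Rightarrow> 'b topology" where
  "quotient_topology X q =
     topology (\<lambda>U. U \<subseteq> q ` topspace X \<and> openin X {x \<in> topspace X. q x \<in> U})"

lemma openin_quotient_topology:
  "openin (quotient_topology X q) U \<longleftrightarrow>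
     U \<subseteq> q ` topspace X \<and> openin X {x \<in> topspace X. q x \<in> U}"
proof -
  have "istopology (\<lambda>U. U \<subseteq> q ` topspace X \<and> openin X {x \<in> topspace X. q x \<in> U})"
    unfolding istopology_def
  proof (intro conjI allI impI)
    fix S T
    assume S: "S \<subseteq> q ` topspace X \<and> openin X {x \<in> topspace X. q x \<in> S}"
      and T: "T \<subseteq> q ` topspace X \<and> openin X {x \<in> topspace X. q x \<in> T}"
    have "{x \<in> topspace X. q x \<in> S \<inter> T} = {x \<in> topspace X. q x \<in> S} \<inter> {x \<in> topspace X. q x \<in> T}"
      by auto
    then show "openin X {x \<in> topspace X. q x \<in> S \<inter> T}"
      using openin_Int[OF conjunct2[OF S] conjunct2[OF T]] by (simp only:)
    show "S \<inter> T \<subseteq> q ` topspace X" using S by auto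
  next
    fix \<K>
    assume K: "\<forall>K\<in>\<K>. K \<subseteq> q ` topspace X \<and> openin X {x \<in> topspace X. q x \<in> K}"
    have "{x \<in> topspace X. q x \<in> \<Union>\<K>} = (\<Union>K\<in>\<K>. {x \<in> topspace X. q x \<in> K})"
      by auto
    then show "openin X {x \<in> topspace X. q x \<in> \<Union>\<K>}"
      using K by (auto intro!: openin_Union)
    show "\<Union>\<K> \<subseteq> q ` topspace X" using K by auto
  qed
  then show ?thesis
    unfolding quotient_topology_def by (simp add: topology_inverse')
qed

lemma topspace_quotient_topology [simp]: "topspace (quotient_topology X q) = q ` topspace X"
proof
  have "openin (quotient_topology X q) (q ` topspace X)"
  proof -
    have "{x \<in> topspace X. q x \<in> q ` topspace X} = topspace X"
      by auto
    then show ?thesis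
      by (simp add: openin_quotient_topology)
  qed
  then show "q ` topspace X \<subseteq> topspace (quotient_topology X q)"
    by (rule openin_subset)
  show "topspace (quotient_topology X q) \<subseteq> q ` topspace X"
    using openin_topspace[of "quotient_topology X q"] unfolding openin_quotient_topology by (rule conjunct1)
qed

lemma quotient_map_quotient_topology: "quotient_map X (quotient_topology X q) q"
  by (simp add: quotient_map_def openin_quotient_topology)

definition ordered_configs :: "nat \<Rightarrow> complex set \<Rightarrow> (nat \<Rightarrow> complex) set" where
  "ordered_configs m A = {z \<in> {1..m} \<rightarrow>\<^sub>E A. inj_on z {1..m}}"

definition ordered_configs_top :: "nat \<Rightarrow> complex set \<Rightarrow> (nat \<Rightarrow> complex) topology" where
  "ordered_configs_top m A =
     subtopology (product_topology (\<lambda>_. euclidean) {1..m}) (ordered_configs m A)"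

definition perm_class :: "nat set \<Rightarrow> (nat \<Rightarrow> complex) \<Rightarrow> (nat \<Rightarrow> complex) set" where
  "perm_class J z = {z \<circ> \<sigma> | \<sigma>. \<sigma> permutes J}"

definition D_top :: "nat \<Rightarrow> (nat \<Rightarrow> complex) set topology" where
  "D_top n = quotient_topology (ordered_configs_top n UNIV) (perm_class {2..n})"

definition V_top :: "nat \<Rightarrow> (nat \<Rightarrow> complex) set topology" where
  "V_top n = quotient_topology (ordered_configs_top (n - 1) (- {0})) (perm_class {1..n-1})"

definition coeff_top :: "complex poly topology" where
  "coeff_top = pullback_topology UNIV coeff (product_topology (\<lambda>_. euclidean) UNIV)"

definition C_set :: "nat \<Rightarrow> complex poly set" where
  "C_set n = {f. lead_coeff f = 1 \<and> degree f = n \<and> card {z. poly f z = 0} = n}"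

(* The polynomial is independent of the representative z, see D_to_C_perm_class. *)

definition D_to_C :: "nat \<Rightarrow> (nat \<Rightarrow> complex) set \<Rightarrow> complex poly" where
  "D_to_C n c = the_elem ((\<lambda>z. \<Prod>i\<in>{1..n}. [:- z i, 1:]) ` c)"

lemma D_to_C_perm_class:
  assumes "J \<subseteq> {1..n}"
  shows "D_to_C n (perm_class J z) = (\<Prod>i\<in>{1..n}. [:- z i, 1:])"
proof -
  have "(\<Prod>i\<in>{1..n}. [:- (z \<circ> \<sigma>) i, 1:]) = (\<Prod>i\<in>{1..n}. [:- z i, 1:])" if "\<sigma> permutes J" for \<sigma>
    using prod.permute[OF permutes_subset[OF that assms], of "\<lambda>i. [:- z i, 1:]", symmetric]
    unfolding o_def .
  moreover have "z \<in> perm_class J z"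
    unfolding perm_class_def by (auto intro!: exI[of _ id] permutes_id)
  ultimately have "(\<lambda>z. \<Prod>i\<in>{1..n}. [:- z i, 1:]) ` perm_class J z = {\<Prod>i\<in>{1..n}. [:- z i, 1:]}"
    unfolding perm_class_def by fast
  then show ?thesis
    by (simp add: D_to_C_def)
qed

definition critical_values :: "complex poly \<Rightarrow> complex set" where
  "critical_values f = {poly f c | c. poly (pderiv f) c = 0}"

definition Z_set :: "nat \<Rightarrow> complex poly set" where
  "Z_set n = {f \<in> C_set n. poly f 0 = 0 \<and> card (critical_values f) = n - 1}"

(* A point of V_n is the set of all orderings of its n - 1 values, see theta_eq_perm_class. *)

definition theta :: "nat \<Rightarrow> complex poly \<Rightarrow> (nat \<Rightarrow> complex) set" where
  "theta n f = {v \<in> extensional {1..n-1}. bij_betw v {1..n-1} (critical_values f)}"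

lemma theta_eq_perm_class:
  assumes "v \<in> theta n f"
  shows "theta n f = perm_class {1..n-1} v"
proof
  have v: "v \<in> extensional {1..n-1}" "bij_betw v {1..n-1} (critical_values f)"
    using assms by (auto simp: theta_def)
  show "theta n f \<subseteq> perm_class {1..n-1} v"
  proof
    fix w assume "w \<in> theta n f"
    then have w: "w \<in> extensional {1..n-1}" "bij_betw w {1..n-1} (critical_values f)"
      by (auto simp: theta_def)
    define \<sigma> where "\<sigma> = (\<lambda>i. if i \<in> {1..n-1} then inv_into {1..n-1} v (w i) else i)"
    have "bij_betw (inv_into {1..n-1} v \<circ> w) {1..n-1} {1..n-1}"
      using w v bij_betw_inv_into bij_betw_trans by blast
    then have "bij_betw \<sigma> {1..n-1} {1..n-1}"
      by (rule bij_betw_cong[THEN iffD1, rotated]) (auto simp: \<sigma>_def)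
    then have "\<sigma> permutes {1..n-1}"
      by (rule bij_imp_permutes) (auto simp: \<sigma>_def)
    moreover have "w = v \<circ> \<sigma>"
    proof
      fix i show "w i = (v \<circ> \<sigma>) i"
      proof (cases "i \<in> {1..n-1}")
        case True
        then have "w i \<in> v ` {1..n-1}"
          using v w by (metis bij_betw_imp_surj_on imageI)
        then show ?thesis using True by (simp add: \<sigma>_def f_inv_into_f)
      next
        case False
        then have "w i = undefined" "v i = undefined" "\<sigma> i = i"
          using v(1) w(1) by (auto simp only: extensional_def \<sigma>_def if_False)
        then show ?thesis by simp
      qed
    qed
    ultimately show "w \<in> perm_class {1..n-1} v"
      by (auto simp: perm_class_def)
  qed
  show "perm_class {1..n-1} v \<subseteq> theta n f"
  proof
    fix w assume "w \<in> perm_class {1..n-1} v"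
    then obtain \<sigma> where \<sigma>: "\<sigma> permutes {1..n-1}" "w = v \<circ> \<sigma>"
      by (auto simp: perm_class_def)
    have "w \<in> extensional {1..n-1}"
      using v(1) \<sigma> unfolding extensional_def mem_Collect_eq o_apply
      by (metis permutes_not_in)
    moreover have "bij_betw w {1..n-1} (critical_values f)"
      using \<sigma> v(2) bij_betw_trans permutes_imp_bij by blast
    ultimately show "w \<in> theta n f"
      by (simp add: theta_def)
  qed
qed

definition crit_poly :: "complex poly \<Rightarrow> complex poly" where
  "crit_poly f = [:0, 1:] * (\<Prod>v\<in>critical_values f. [:- v, 1:])"

(* Indexed from 1; the value at 0 is irrelevant. *)

fun Z_tower :: "nat \<Rightarrow> nat \<Rightarrow> complex poly set" where
  "Z_tower n 0 = {}"
| "Z_tower n (Suc 0) = Z_set n"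
| "Z_tower n (Suc (Suc j)) = {f \<in> Z_set n. crit_poly f \<in> Z_tower n (Suc j)}"

definition C_top :: "nat \<Rightarrow> complex poly topology" where
  "C_top n = subtopology coeff_top (C_set n)"

definition Z_top :: "nat \<Rightarrow> complex poly topology" where
  "Z_top n = subtopology coeff_top (Z_set n)"

definition Z_tower_top :: "nat \<Rightarrow> nat \<Rightarrow> complex poly topology" where
  "Z_tower_top n j = subtopology coeff_top (Z_tower n j)"

end

theory Submission
  imports Defs "HOL-Complex_Analysis.Complex_Analysis" "HOL-Real_Asymp.Real_Asymp"
    "HOL-Computational_Algebra.Fundamental_Theorem_Algebra"
begin

text \<open>Write \<open>m = n - 1\<close>.  A monic polynomial \<open>f\<close> of degree \<open>n\<close> with \<open>f(0) = 0\<close> is determined by its critical points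
\<open>c\<^sub>1, ..., c\<^sub>m\<close>, being \<open>n\<close> times the primitive of \<open>\<Prod>(z - c\<^sub>i)\<close> that vanishes at \<open>0\<close>.  Its critical values
\<open>F\<^sub>j(c) = f(c\<^sub>j)\<close> are homogeneous polynomials of degree \<open>n\<close> in \<open>c\<close>, and \<open>F(c) = 0\<close> only for \<open>c = 0\<close>
(\<open>crit_values_map_eq_0\<close>), so that \<open>F\<close> is a proper self-map of \<open>\<complex>\<^sup>m\<close>.  If the values \<open>v\<^sub>j\<close> are distinct and
non-zero, then \<open>0, c\<^sub>1, ..., c\<^sub>m\<close> are distinct, and Lagrange interpolation at these points inverts the
differential of \<open>F\<close> at \<open>c\<close> (\<open>crit_values_map_strict_left_inverse\<close>).  Ordered critical values determine the
order of the critical points, so the fibre of \<open>\<theta>\<^sub>n\<close> over the class of \<open>v\<close> is the fibre of \<open>F\<close> over \<open>v\<close>.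

The fibre of \<open>F\<close> over such a \<open>v\<close> has \<open>n\<^sup>m\<close> points by Bezout's theorem.  The proof here only counts dimensions.
Let \<open>P\<^sub>N\<close> be the space of polynomials of degree at most \<open>N\<close> in \<open>m\<close> variables, of dimension
\<open>(N + m) choose m\<close>, and let the fibre have \<open>k\<close> points.  If \<open>g\<^sub>1, ..., g\<^sub>k\<close> are polynomials that
separate these points, then the products of the \<open>g\<^sub>i\<close> with the polynomials of degree \<open>T\<close> in \<open>F\<close> are
independent in \<open>P\<^bsub>nT + const\<^esub>\<close>, hence \<open>k \<le> n\<^sup>m\<close> as \<open>T\<close> grows (\<open>card_subset_fibre_le\<close>).  Conversely suppose
that \<open>h \<in> P\<^bsub>nT\<^esub>\<close> vanishes to order more than \<open>T + const\<close> at all points of the fibre.  For a polynomial \<open>g\<close>, sum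
\<open>h g\<close> over the fibres above a complex line through \<open>v\<close>.  Since the bad points form a
hypersurface \<open>\<Delta> = 0\<close>, the sum times \<open>\<Delta>\<close> is an entire function on this line; it grows
more slowly than it vanishes at \<open>v\<close>, so it is zero, and varying \<open>g\<close> and the line one gets \<open>h = 0\<close>
(\<open>vanishes_on_fibre_of_vanishing_order\<close>).  Hence the dimension of \<open>P\<^bsub>nT\<^esub>\<close> is at most
\<open>k ((T + const + m) choose m)\<close>, which gives \<open>k \<ge> n\<^sup>m\<close> (\<open>card_fibre\<close>).

For the topology, all spaces are compared with the space \<open>C0\<close> of those \<open>w\<close> in \<open>C\<^sub>n\<close> with
\<open>w(0) = 0\<close>.  Roots depend continuously on coefficients (\<open>local_roots\<close>), so
\<open>V\<^sub>n \<cong> C0\<close> by \<open>v \<mapsto> z \<Prod>(z - v\<^sub>i)\<close>, and \<open>D\<^sub>n \<cong> \<complex> \<times> C0\<close> by translating the marked point to \<open>0\<close>; this gives the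
homotopy equivalence.  Under the first homeomorphism \<open>\<theta>\<^sub>n\<close> becomes the map from \<open>Z\<^sub>n\<close> to \<open>C0\<close> that produces
the tower.  It is a covering of degree \<open>n\<^sup>m\<close> (\<open>covering_crit_poly\<close>), and the stages of the tower are its
restrictions to preimages of subsets of \<open>C0\<close>.\<close>

section \<open>Polynomial functions of several variables\<close>

definition exponents :: "'i set \<Rightarrow> nat \<Rightarrow> ('i \<Rightarrow> nat) set" where
  "exponents I N = {\<alpha> \<in> I \<rightarrow>\<^sub>E UNIV. sum \<alpha> I \<le> N}"

text \<open>The functions below live on all of \<open>'i \<Rightarrow> complex\<close> but only see the coordinates in the finite set \<open>I\<close>. In this way the
number of variables may depend on \<open>n\<close>, which it could not if it were the cardinality of a type.\<close>
definition monomial :: "'i set \<Rightarrow> ('i \<Rightarrow> nat) \<Rightarrow> ('i \<Rightarrow> complex) \<Rightarrow> complex" where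
  "monomial I \<alpha> x = (\<Prod>i\<in>I. x i ^ \<alpha> i)"

definition poly_fn :: "'i set \<Rightarrow> nat \<Rightarrow> (('i \<Rightarrow> complex) \<Rightarrow> complex) \<Rightarrow> bool" where
  "poly_fn I N h \<longleftrightarrow> (\<exists>a. \<forall>x. h x = (\<Sum>\<alpha>\<in>exponents I N. a \<alpha> * monomial I \<alpha> x))"

lemma exponents_subset_PiE:
  assumes "finite I"
  shows "exponents I N \<subseteq> I \<rightarrow>\<^sub>E {..N}"
proof
  fix \<alpha> assume a: "\<alpha> \<in> exponents I N"
  have "\<alpha> i \<le> N" if "i \<in> I" for i
    using member_le_sum[of i I \<alpha>] that assms a by (auto simp: exponents_def)
  then show "\<alpha> \<in> I \<rightarrow>\<^sub>E {..N}"
    using a by (auto simp: exponents_def PiE_iff)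
qed

lemma finite_exponents: "finite I \<Longrightarrow> finite (exponents I N)"
  by (rule finite_subset[OF exponents_subset_PiE]) (auto intro: finite_PiE)

text \<open>Splitting off the exponent of one variable gives the hockey-stick identity.\<close>
lemma card_exponents:
  assumes "finite I"
  shows "card (exponents I N) = (N + card I) choose (card I)"
  using assms
proof (induction I arbitrary: N)
  case empty
  have "exponents ({}::'a set) N = {\<lambda>_. undefined}" by (auto simp: exponents_def)
  then show ?case by simp
next
  case (insert i I)
  let ?f = "\<lambda>(j, \<beta>). \<beta>(i := j) :: 'a \<Rightarrow> nat"
  have upd: "sum (\<beta>(i := j)) I = sum \<beta> I" for \<beta> :: "'a \<Rightarrow> nat" and j
    by (rule sum.cong) (use insert.hyps in auto)
  have ext: "\<beta> i = undefined" if "\<beta> \<in> exponents I k" for \<beta> k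
    using that insert.hyps by (auto simp: exponents_def PiE_iff extensional_def)
  have inj: "inj_on ?f (SIGMA j:{..N}. exponents I (N - j))"
  proof (rule inj_onI, clarify)
    fix j \<beta> j' \<beta>'
    assume b: "\<beta> \<in> exponents I (N - j)" "\<beta>' \<in> exponents I (N - j')" and eq: "\<beta>(i := j) = \<beta>'(i := j')"
    have "j = j'" using fun_cong[OF eq, of i] by simp
    moreover have "\<beta> = \<beta>'"
    proof
      fix l show "\<beta> l = \<beta>' l" using fun_cong[OF eq, of l] ext[OF b(1)] ext[OF b(2)] by (cases "l = i") auto
    qed
    ultimately show "j = j' \<and> \<beta> = \<beta>'" by simp
  qed
  have img: "exponents (insert i I) N = ?f ` (SIGMA j:{..N}. exponents I (N - j))"
  proof (intro set_eqI iffI)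
    fix \<alpha> assume a: "\<alpha> \<in> exponents (insert i I) N"
    have "\<alpha> = ?f (\<alpha> i, restrict \<alpha> I)"
    proof
      fix l show "\<alpha> l = ?f (\<alpha> i, restrict \<alpha> I) l"
        using a by (auto simp: exponents_def PiE_iff extensional_def)
    qed
    moreover have "(\<alpha> i, restrict \<alpha> I) \<in> (SIGMA j:{..N}. exponents I (N - j))"
      using a insert.hyps by (auto simp: exponents_def)
    ultimately show "\<alpha> \<in> ?f ` (SIGMA j:{..N}. exponents I (N - j))" by (metis image_eqI)
  next
    fix \<alpha> assume "\<alpha> \<in> ?f ` (SIGMA j:{..N}. exponents I (N - j))"
    then obtain j \<beta> where j: "j \<le> N" "\<beta> \<in> exponents I (N - j)" "\<alpha> = \<beta>(i := j)" by auto
    then show "\<alpha> \<in> exponents (insert i I) N"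
      using insert.hyps upd[of \<beta> j] by (auto simp: exponents_def PiE_iff extensional_def simp del: fun_upd_apply)
        (auto)
  qed
  have "card (exponents (insert i I) N) = (\<Sum>j\<le>N. card (exponents I (N - j)))"
    unfolding img card_image[OF inj] using insert.hyps by (subst card_SigmaI) (auto simp: finite_exponents)
  also have "\<dots> = (\<Sum>j\<le>N. (N - j + card I) choose card I)"
    using insert.IH by simp
  also have "\<dots> = (\<Sum>j\<le>N. (card I + j) choose card I)"
    by (subst sum.nat_diff_reindex[symmetric, of _ "Suc N", unfolded lessThan_Suc_atMost])
       (auto intro!: sum.cong simp: add.commute)
  also have "\<dots> = Suc (card I + N) choose Suc (card I)"
    using choose_rising_sum(1)[of "card I" N] by (simp add: add.commute add.left_commute)
  finally show ?case using insert.hyps by (simp add: add.commute)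
qed

lemma poly_fn_mono:
  assumes "finite I" "poly_fn I N h" "N \<le> M"
  shows "poly_fn I M h"
proof -
  obtain a where a: "\<And>x. h x = (\<Sum>\<alpha>\<in>exponents I N. a \<alpha> * monomial I \<alpha> x)"
    using assms by (auto simp: poly_fn_def)
  have "exponents I N \<subseteq> exponents I M" using assms by (auto simp: exponents_def)
  then have "h x = (\<Sum>\<alpha>\<in>exponents I M. (if \<alpha> \<in> exponents I N then a \<alpha> else 0) * monomial I \<alpha> x)" for x
    unfolding a using assms
    by (intro sum.mono_neutral_cong_left finite_exponents) auto
  then show ?thesis unfolding poly_fn_def
    by (intro exI[of _ "\<lambda>\<alpha>. if \<alpha> \<in> exponents I N then a \<alpha> else 0"]) simp
qed

lemma poly_fn_monomial:
  assumes "finite I" "\<alpha> \<in> exponents I N"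
  shows "poly_fn I N (monomial I \<alpha>)"
  unfolding poly_fn_def
  by (rule exI[of _ "\<lambda>\<beta>. if \<beta> = \<alpha> then 1 else 0"])
     (use assms finite_exponents[of I N] in \<open>simp add: if_distrib[of "\<lambda>c. c * _"] cong: if_cong\<close>)

lemma poly_fn_sum:
  assumes "\<And>s. s \<in> S \<Longrightarrow> poly_fn I N (h s)"
  shows "poly_fn I N (\<lambda>x. \<Sum>s\<in>S. h s x)"
proof -
  have "\<exists>a. \<forall>s\<in>S. \<forall>x. h s x = (\<Sum>\<alpha>\<in>exponents I N. a s \<alpha> * monomial I \<alpha> x)"
    using assms unfolding poly_fn_def by (intro bchoice) auto
  then obtain a where a: "\<And>s x. s \<in> S \<Longrightarrow> h s x = (\<Sum>\<alpha>\<in>exponents I N. a s \<alpha> * monomial I \<alpha> x)" by blast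
  have "(\<Sum>s\<in>S. h s x) = (\<Sum>\<alpha>\<in>exponents I N. (\<Sum>s\<in>S. a s \<alpha>) * monomial I \<alpha> x)" for x
    by (simp add: a sum_distrib_right sum.swap[of _ S])
  then show ?thesis unfolding poly_fn_def by (intro exI[of _ "\<lambda>\<alpha>. \<Sum>s\<in>S. a s \<alpha>"]) simp
qed

text \<open>Products of monomials are monomials whose exponents add up, so the double sum is regrouped along the
sum of the exponents.\<close>
lemma poly_fn_mult:
  assumes "finite I" "poly_fn I N f" "poly_fn I M g"
  shows "poly_fn I (N + M) (\<lambda>x. f x * g x)"
proof -
  obtain a where a: "\<And>x. f x = (\<Sum>\<alpha>\<in>exponents I N. a \<alpha> * monomial I \<alpha> x)"
    using assms by (auto simp: poly_fn_def)
  obtain b where b: "\<And>x. g x = (\<Sum>\<alpha>\<in>exponents I M. b \<alpha> * monomial I \<alpha> x)"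
    using assms by (auto simp: poly_fn_def)
  define s where "s = (\<lambda>(\<alpha>, \<beta>). restrict (\<lambda>i. \<alpha> i + \<beta> i :: nat) I)"
  let ?P = "exponents I N \<times> exponents I M"
  have s: "s p \<in> exponents I (N + M)" if "p \<in> ?P" for p
    using that by (auto simp: s_def exponents_def sum.distrib)
  have mon: "monomial I (s p) x = monomial I (fst p) x * monomial I (snd p) x" for p x
    by (cases p) (simp add: s_def monomial_def power_add prod.distrib)
  have "f x * g x = (\<Sum>\<gamma>\<in>exponents I (N + M).
      (\<Sum>p\<in>{p\<in>?P. s p = \<gamma>}. a (fst p) * b (snd p)) * monomial I \<gamma> x)" for x
  proof -
    have "f x * g x = (\<Sum>p\<in>?P. a (fst p) * b (snd p) * monomial I (s p) x)"
      unfolding a b sum_product sum.cartesian_product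
      by (intro sum.cong) (auto simp: mon mult_ac)
    also have "\<dots> = (\<Sum>\<gamma>\<in>exponents I (N + M). \<Sum>p\<in>{p\<in>?P. s p = \<gamma>}. a (fst p) * b (snd p) * monomial I (s p) x)"
      by (rule sum.group[symmetric]) (use s assms in \<open>auto intro: finite_exponents\<close>)
    finally show ?thesis by (simp add: sum_distrib_right)
  qed
  then show ?thesis unfolding poly_fn_def
    by (intro exI[of _ "\<lambda>\<gamma>. \<Sum>p\<in>{p\<in>?P. s p = \<gamma>}. a (fst p) * b (snd p)"]) simp
qed

lemma poly_fn_const:
  assumes "finite I" shows "poly_fn I N (\<lambda>_. c)"
proof -
  have "poly_fn I 0 (\<lambda>_. c)"
  proof -
    have "exponents I 0 = {restrict (\<lambda>_. 0) I}"
      using assms by (auto simp: exponents_def PiE_iff restrict_def extensional_def)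
    then show ?thesis unfolding poly_fn_def by (intro exI[of _ "\<lambda>_. c"]) (simp add: monomial_def)
  qed
  then show ?thesis by (rule poly_fn_mono[OF assms]) simp
qed

lemma poly_fn_add:
  assumes "poly_fn I N f" "poly_fn I N g"
  shows "poly_fn I N (\<lambda>x. f x + g x)"
  using poly_fn_sum[of "{True, False}" I N "\<lambda>b. if b then f else g"] assms by (simp split: if_splits)

lemma poly_fn_cmult:
  assumes "finite I" "poly_fn I N f"
  shows "poly_fn I N (\<lambda>x. c * f x)"
  using poly_fn_mult[OF assms(1) poly_fn_const[OF assms(1)] assms(2), of 0 c] by simp

lemma poly_fn_diff:
  assumes "finite I" "poly_fn I N f" "poly_fn I N g"
  shows "poly_fn I N (\<lambda>x. f x - g x)"
  using poly_fn_add[OF assms(2) poly_fn_cmult[OF assms(1,3), of "-1"]] by simp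

lemma poly_fn_coord:
  assumes "finite I" "i \<in> I" shows "poly_fn I (Suc 0) (\<lambda>x. x i)"
proof -
  let ?e = "restrict (\<lambda>j. if j = i then 1 else 0 :: nat) I"
  have "?e \<in> exponents I (Suc 0)" using assms by (simp add: exponents_def)
  moreover have "monomial I ?e = (\<lambda>x. x i)"
    using assms by (auto simp: monomial_def fun_eq_iff if_distrib[of "\<lambda>k. _ ^ k"] cong: if_cong)
  ultimately show ?thesis using poly_fn_monomial[OF assms(1)] by metis
qed

lemma poly_fn_prod:
  assumes "finite I" "finite S" "\<And>s. s \<in> S \<Longrightarrow> poly_fn I (e s) (h s)"
  shows "poly_fn I (sum e S) (\<lambda>x. \<Prod>s\<in>S. h s x)"
  using assms(2,3)
proof (induction S)
  case (insert s S)
  then show ?case using poly_fn_mult[OF assms(1), of "e s" "h s"] by simp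
qed (simp add: poly_fn_const assms)

lemma poly_fn_power:
  assumes "finite I" "poly_fn I N f"
  shows "poly_fn I (k * N) (\<lambda>x. f x ^ k)"
  by (induction k) (use assms poly_fn_const poly_fn_mult in auto)

lemma poly_fn_compose:
  assumes I: "finite I" and J: "finite J" and F: "\<And>j. j \<in> J \<Longrightarrow> poly_fn I d (\<lambda>x. F x j)" and h: "poly_fn J N h"
  shows "poly_fn I (d * N) (\<lambda>x. h (F x))"
proof -
  obtain a where a: "\<And>x. h x = (\<Sum>\<alpha>\<in>exponents J N. a \<alpha> * monomial J \<alpha> x)"
    using h by (auto simp: poly_fn_def)
  have "poly_fn I (d * N) (\<lambda>x. monomial J \<alpha> (F x))" if "\<alpha> \<in> exponents J N" for \<alpha>
  proof -
    have "poly_fn I (\<Sum>j\<in>J. \<alpha> j * d) (\<lambda>x. monomial J \<alpha> (F x))"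
      unfolding monomial_def by (intro poly_fn_prod poly_fn_power I J F)
    then show ?thesis
      by (rule poly_fn_mono[OF I]) (use that in \<open>simp add: sum_distrib_right[symmetric] exponents_def mult.commute[of d]\<close>)
  qed
  then show ?thesis unfolding a by (intro poly_fn_sum poly_fn_cmult I)
qed

text \<open>Degrees are forgotten here: the rule serves for qualitative properties such as continuity or differentiability.\<close>
lemma poly_fn_induct [consumes 2, case_names const coord add mult]:
  assumes "finite I" "poly_fn I N h"
    and const: "\<And>c. P (\<lambda>_. c)"
    and coord: "\<And>i. i \<in> I \<Longrightarrow> P (\<lambda>x. x i)"
    and add: "\<And>f g. P f \<Longrightarrow> P g \<Longrightarrow> P (\<lambda>x. f x + g x)"
    and mult: "\<And>f g. P f \<Longrightarrow> P g \<Longrightarrow> P (\<lambda>x. f x * g x)"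
  shows "P h"
proof -
  obtain a where a: "h = (\<lambda>x. \<Sum>\<alpha>\<in>exponents I N. a \<alpha> * monomial I \<alpha> x)"
    using assms(2) unfolding poly_fn_def fun_eq_iff by blast
  have pow: "P (\<lambda>x. x i ^ k)" if "i \<in> I" for i k
    by (induction k) (use const mult coord[OF that] in auto)
  have prod: "P (\<lambda>x. \<Prod>i\<in>J. x i ^ \<alpha> i)" if "finite J" "J \<subseteq> I" for J \<alpha>
    using that by (induction J) (use const mult pow in auto)
  have sum: "P (\<lambda>x. \<Sum>\<alpha>\<in>S. a \<alpha> * monomial I \<alpha> x)" if "finite S" for S
    using that
    by (induction S) (use const add mult prod[OF assms(1)] in \<open>auto simp: monomial_def\<close>)
  show ?thesis unfolding a by (rule sum) (rule finite_exponents[OF assms(1)])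
qed

lemma poly_fn_cong:
  assumes "finite I" "poly_fn I N h" "\<And>i. i \<in> I \<Longrightarrow> x i = y i"
  shows "h x = h y"
  using assms(1,2) by (induction rule: poly_fn_induct) (use assms(3) in auto)

text \<open>Gaussian elimination of one unknown for each equation.  All dimension counts rest on this lemma.\<close>
lemma homogeneous_system_nontrivial_solution:
  fixes A :: "'a set" and B :: "'b set" and M :: "'b \<Rightarrow> 'a \<Rightarrow> 'c::field"
  assumes "finite B" "finite A" "card B < card A"
  shows "\<exists>a. (\<exists>\<alpha>\<in>A. a \<alpha> \<noteq> 0) \<and> (\<forall>\<beta>\<in>B. (\<Sum>\<alpha>\<in>A. M \<beta> \<alpha> * a \<alpha>) = 0)"
  using assms
proof (induction B arbitrary: A M)
  case empty
  then have "A \<noteq> {}" by auto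
  then show ?case by (intro exI[of _ "\<lambda>_. 1"]) auto
next
  case (insert b B)
  show ?case
  proof (cases "\<forall>\<alpha>\<in>A. M b \<alpha> = 0")
    case True
    obtain a where "\<exists>\<alpha>\<in>A. a \<alpha> \<noteq> 0" "\<forall>\<beta>\<in>B. (\<Sum>\<alpha>\<in>A. M \<beta> \<alpha> * a \<alpha>) = 0"
      using insert.IH[of A M] insert.prems insert.hyps by auto
    with True show ?thesis by (intro exI[of _ a]) auto
  next
    case False
    then obtain \<alpha>0 where p: "\<alpha>0 \<in> A" "M b \<alpha>0 \<noteq> 0" by blast
    let ?A = "A - {\<alpha>0}"
    have "card B < card ?A" using insert.prems insert.hyps p by auto
    then obtain a where a: "\<exists>\<alpha>\<in>?A. a \<alpha> \<noteq> 0"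
      "\<And>\<beta>. \<beta> \<in> B \<Longrightarrow> (\<Sum>\<alpha>\<in>?A. (M \<beta> \<alpha> - M \<beta> \<alpha>0 * M b \<alpha> / M b \<alpha>0) * a \<alpha>) = 0"
      using insert.IH[of ?A "\<lambda>\<beta> \<alpha>. M \<beta> \<alpha> - M \<beta> \<alpha>0 * M b \<alpha> / M b \<alpha>0"] insert.prems by auto
    define c where "c = - (\<Sum>\<alpha>\<in>?A. M b \<alpha> * a \<alpha>) / M b \<alpha>0"
    have split: "(\<Sum>\<alpha>\<in>A. M \<beta> \<alpha> * (a(\<alpha>0 := c)) \<alpha>) = M \<beta> \<alpha>0 * c + (\<Sum>\<alpha>\<in>?A. M \<beta> \<alpha> * a \<alpha>)" for \<beta>
      using p insert.prems by (subst sum.remove[of A \<alpha>0]) auto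
    have "(\<Sum>\<alpha>\<in>A. M \<beta> \<alpha> * (a(\<alpha>0 := c)) \<alpha>) = 0" if "\<beta> \<in> insert b B" for \<beta>
    proof (cases "\<beta> = b")
      case True
      then show ?thesis unfolding split using p by (simp add: c_def)
    next
      case False
      then have "0 = (\<Sum>\<alpha>\<in>?A. M \<beta> \<alpha> * a \<alpha> - M \<beta> \<alpha>0 / M b \<alpha>0 * (M b \<alpha> * a \<alpha>))"
        using a(2)[of \<beta>] that by (simp add: algebra_simps)
      also have "\<dots> = (\<Sum>\<alpha>\<in>?A. M \<beta> \<alpha> * a \<alpha>) + M \<beta> \<alpha>0 * c"
        by (simp add: sum_subtractf c_def sum_distrib_left sum_divide_distrib)
      finally show ?thesis unfolding split by (simp add: add.commute)
    qed
    moreover have "\<exists>\<alpha>\<in>A. (a(\<alpha>0 := c)) \<alpha> \<noteq> 0" using a(1) by auto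
    ultimately show ?thesis by blast
  qed
qed

lemma sum_PiE_insert:
  assumes "finite I" "i \<notin> I" "finite S"
  shows "(\<Sum>\<alpha>\<in>insert i I \<rightarrow>\<^sub>E S. g \<alpha>) = (\<Sum>j\<in>S. \<Sum>\<beta>\<in>I \<rightarrow>\<^sub>E S. g (\<beta>(i := j)))"
proof -
  have "(\<Sum>\<alpha>\<in>insert i I \<rightarrow>\<^sub>E S. g \<alpha>) = (\<Sum>(j,\<beta>)\<in>S \<times> (I \<rightarrow>\<^sub>E S). g (\<beta>(i := j)))"
    unfolding PiE_insert_eq
    by (subst sum.reindex) (use inj_combinator[OF assms(2)] in \<open>auto simp: case_prod_unfold comp_def\<close>)
  then show ?thesis by (simp add: sum.cartesian_product)
qed

text \<open>Freezing all variables but one leaves a polynomial in that variable with infinitely many zeros, so its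
coefficients, which are polynomials in the frozen variables, vanish.\<close>
lemma box_monomials_independent:
  assumes "finite I" "r > 0"
    and "\<And>x. (\<And>i. i \<in> I \<Longrightarrow> norm (x i - p i) < r) \<Longrightarrow> (\<Sum>\<alpha>\<in>I \<rightarrow>\<^sub>E {..N}. a \<alpha> * monomial I \<alpha> x) = 0"
    and "\<alpha> \<in> I \<rightarrow>\<^sub>E {..N}"
  shows "a \<alpha> = 0"
  using assms(1,3,4)
proof (induction I arbitrary: a \<alpha>)
  case empty
  then show ?case by (auto simp: monomial_def)
next
  case (insert i I)
  have upd: "monomial (insert i I) (\<beta>(i := j)) x = x i ^ j * monomial I \<beta> x" for \<beta> j x
  proof -
    have "(\<Prod>k\<in>I. x k ^ (\<beta>(i := j)) k) = monomial I \<beta> x"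
      unfolding monomial_def by (rule prod.cong) (use insert.hyps in auto)
    then show ?thesis using insert.hyps by (simp add: monomial_def)
  qed
  have "(\<Sum>\<beta>\<in>I \<rightarrow>\<^sub>E {..N}. a (\<beta>(i := j)) * monomial I \<beta> x) = 0"
    if x: "\<And>k. k \<in> I \<Longrightarrow> norm (x k - p k) < r" and j: "j \<le> N" for x j
  proof -
    define b where "b j = (\<Sum>\<beta>\<in>I \<rightarrow>\<^sub>E {..N}. a (\<beta>(i := j)) * monomial I \<beta> x)" for j
    define q where "q = (\<Sum>j\<le>N. monom (b j) j)"
    have q: "poly q t = 0" if "norm (t - p i) < r" for t
    proof -
      have mon: "monomial I \<beta> (x(i := t)) = monomial I \<beta> x" for \<beta>
        unfolding monomial_def by (rule prod.cong) (use insert.hyps in auto)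
      have "poly q t = (\<Sum>j\<le>N. b j * t ^ j)" by (simp add: q_def poly_sum poly_monom)
      also have "\<dots> = (\<Sum>j\<le>N. \<Sum>\<beta>\<in>I \<rightarrow>\<^sub>E {..N}. a (\<beta>(i := j)) * monomial (insert i I) (\<beta>(i := j)) (x(i := t)))"
        unfolding upd mon b_def sum_distrib_right
        by (intro sum.cong) (simp_all add: mult_ac)
      also have "\<dots> = (\<Sum>\<alpha>\<in>insert i I \<rightarrow>\<^sub>E {..N}. a \<alpha> * monomial (insert i I) \<alpha> (x(i := t)))"
        by (rule sum_PiE_insert[OF insert.hyps(1,2) finite_atMost, symmetric])
      also have "\<dots> = 0" by (rule insert.prems(1)) (use x that insert.hyps in auto)
      finally show ?thesis .
    qed
    have "q = 0"
    proof (rule ccontr)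
      assume "q \<noteq> 0"
      then have "finite {t. poly q t = 0}" by (rule poly_roots_finite)
      moreover have "ball (p i) r \<subseteq> {t. poly q t = 0}" using q by (auto simp: dist_norm norm_minus_commute)
      moreover have "infinite (ball (p i) r)"
        using assms(2) uncountable_ball[of r "p i"] countable_finite by blast
      ultimately show False using finite_subset by blast
    qed
    moreover have "coeff q j = b j"
      using j by (simp add: q_def coeff_sum if_distrib cong: if_cong)
    ultimately show ?thesis by (simp add: b_def)
  qed
  moreover obtain j \<beta> where \<alpha>: "\<alpha> = \<beta>(i := j)" and "j \<le> N" "\<beta> \<in> I \<rightarrow>\<^sub>E {..N}"
    using insert.prems(2) unfolding PiE_insert_eq by auto
  ultimately show ?case unfolding \<alpha> by (intro insert.IH[of "\<lambda>\<beta>. a (\<beta>(i := j))" \<beta>]) blast+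
qed

lemma monomials_independent:
  assumes "finite I" "r > 0"
    and z: "\<And>x. (\<And>i. i \<in> I \<Longrightarrow> norm (x i - p i) < r) \<Longrightarrow> (\<Sum>\<alpha>\<in>exponents I N. a \<alpha> * monomial I \<alpha> x) = 0"
    and "\<alpha> \<in> exponents I N"
  shows "a \<alpha> = 0"
proof -
  have "(\<Sum>\<alpha>\<in>I \<rightarrow>\<^sub>E {..N}. (if \<alpha> \<in> exponents I N then a \<alpha> else 0) * monomial I \<alpha> x)
      = (\<Sum>\<alpha>\<in>exponents I N. a \<alpha> * monomial I \<alpha> x)" for x
    by (rule sum.mono_neutral_cong_right) (use exponents_subset_PiE assms in \<open>auto intro!: finite_PiE\<close>)
  then show ?thesis
    using box_monomials_independent[where r=r and p=p and N=N and a="\<lambda>\<alpha>. if \<alpha> \<in> exponents I N then a \<alpha> else 0", of I \<alpha>]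
      assms exponents_subset_PiE[of I N] by auto
qed

text \<open>The binomial coefficient \<open>(N + m) choose m\<close> is a polynomial of degree \<open>m\<close> in \<open>N\<close>; only its leading term survives in the ratio
of two dimensions, and additive shifts of the degree do not matter.\<close>
lemma choose_ratio_tendsto:
  "(\<lambda>T. real ((d * T + e + m) choose m) / real ((T + e' + m) choose m)) \<longlonglongrightarrow> real d ^ m"
proof -
  have ch: "real ((N + m) choose m) = (\<Prod>i\<in>{1..m}. real N + real i) / fact m" for N :: nat
  proof (induction m)
    case (Suc m)
    have "Suc m * ((N + Suc m) choose Suc m) = (N + Suc m) * ((N + m) choose m)"
      using Suc_times_binomial_eq[of "N + m" m] by (simp add: mult_ac)
    then have "real (Suc m) * real ((N + Suc m) choose Suc m) = real (N + Suc m) * real ((N + m) choose m)"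
      by (metis of_nat_mult)
    then have "real ((N + Suc m) choose Suc m) = (real N + real (Suc m)) * ((\<Prod>i\<in>{1..m}. real N + real i) / fact m) / real (Suc m)"
      unfolding Suc[symmetric] by (simp add: eq_divide_eq mult.commute del: binomial_Suc_Suc)
    then show ?case by (simp add: mult.commute del: binomial_Suc_Suc)
  qed simp
  have pos: "(\<Prod>i\<in>{1..m}. real N + real i) > 0" for N :: nat by (rule prod_pos) auto
  have "(\<lambda>T. \<Prod>i\<in>{1..m}. (real (d * T + e) + real i) / (real (T + e') + real i)) \<longlonglongrightarrow> (\<Prod>i\<in>{1..m}. real d)"
  proof (rule tendsto_prod)
    fix i
    have "(\<lambda>T. (real d * real T + (real e + real i)) / (real T + (real e' + real i))) \<longlonglongrightarrow> real d"
      by real_asymp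
    then show "(\<lambda>T. (real (d * T + e) + real i) / (real (T + e') + real i)) \<longlonglongrightarrow> real d"
      by (simp add: add.assoc)
  qed
  then show ?thesis unfolding ch by (simp add: prod_dividef)
qed

section \<open>Coordinatewise norms and the inverse function theorem\<close>

definition nrm :: "'i set \<Rightarrow> ('i \<Rightarrow> complex) \<Rightarrow> real" where
  "nrm I x = (\<Sum>i\<in>I. norm (x i))"

text \<open>The \<open>\<ell>\<^sup>1\<close> distance on the coordinates in \<open>I\<close>.  Points that agree on \<open>I\<close> have distance \<open>0\<close>, so this is only a pseudometric.\<close>
definition vdist :: "'i set \<Rightarrow> ('i \<Rightarrow> complex) \<Rightarrow> ('i \<Rightarrow> complex) \<Rightarrow> real" where
  "vdist I x y = (\<Sum>i\<in>I. norm (x i - y i))"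

lemma nrm_nonneg [simp]: "0 \<le> nrm I x" by (simp add: nrm_def sum_nonneg)
lemma vdist_nonneg [simp]: "0 \<le> vdist I x y" by (simp add: vdist_def sum_nonneg)
lemma vdist_self [simp]: "vdist I x x = 0" by (simp add: vdist_def)
lemma vdist_commute: "vdist I x y = vdist I y x" by (simp add: vdist_def norm_minus_commute)

lemma vdist_triangle: "vdist I x z \<le> vdist I x y + vdist I y z"
  unfolding vdist_def sum.distrib[symmetric]
  by (rule sum_mono) (metis norm_diff_triangle_ineq diff_add_cancel norm_triangle_ineq add_diff_eq)

lemma norm_le_vdist: "finite I \<Longrightarrow> i \<in> I \<Longrightarrow> norm (x i - y i) \<le> vdist I x y"
  unfolding vdist_def by (rule member_le_sum) auto

lemma norm_le_nrm: "finite I \<Longrightarrow> i \<in> I \<Longrightarrow> norm (x i) \<le> nrm I x"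
  unfolding nrm_def by (rule member_le_sum) auto

lemma vdist_cong: "(\<And>i. i \<in> I \<Longrightarrow> x i = x' i) \<Longrightarrow> (\<And>i. i \<in> I \<Longrightarrow> y i = y' i) \<Longrightarrow> vdist I x y = vdist I x' y'"
  unfolding vdist_def by (rule sum.cong) auto

lemma vdist_eq_0: "finite I \<Longrightarrow> vdist I x y = 0 \<longleftrightarrow> (\<forall>i\<in>I. x i = y i)"
  by (auto simp: vdist_def sum_nonneg_eq_0_iff)

lemma nrm_le_vdist: "nrm I x \<le> nrm I y + vdist I x y"
  unfolding vdist_def nrm_def sum.distrib[symmetric]
  by (rule sum_mono) (metis add_diff_cancel_left' diff_add_cancel norm_triangle_sub)

lemma norm_matrix_row_sum_le:
  assumes "finite I"
  shows "(\<Sum>j\<in>I. norm (\<Sum>i\<in>I. B j i * (u i - v i))) \<le> (\<Sum>j\<in>I. \<Sum>i\<in>I. norm (B j i :: complex)) * vdist I u v"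
proof -
  have "norm (\<Sum>i\<in>I. B j i * (u i - v i)) \<le> (\<Sum>i\<in>I. norm (B j i)) * vdist I u v" for j
  proof -
    have "norm (\<Sum>i\<in>I. B j i * (u i - v i)) \<le> (\<Sum>i\<in>I. norm (B j i) * vdist I u v)"
      by (rule sum_norm_le) (use norm_le_vdist[OF assms] in \<open>auto simp: norm_mult intro!: mult_left_mono\<close>)
    then show ?thesis by (simp add: sum_distrib_right)
  qed
  then show ?thesis unfolding sum_distrib_right[of _ I] by (intro sum_mono)
qed

text \<open>The matrix \<open>B\<close> plays the role of the inverse of the differential of \<open>F\<close> at \<open>p\<close>, and the third hypothesis is strict differentiability
multiplied by \<open>B\<close>.  It bounds distances near \<open>p\<close> by distances of the values of \<open>F\<close>, and makes the Newton map \<open>x \<mapsto> x - B (F x - y)\<close> a contraction with factor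
\<open>1/2\<close>, whose fixed point solves \<open>F x = y\<close> because \<open>B\<close> is injective.\<close>
lemma inverse_function:
  fixes F :: "('i \<Rightarrow> complex) \<Rightarrow> 'i \<Rightarrow> complex"
  assumes I: "finite I"
    and inj: "\<forall>u. (\<forall>j\<in>I. (\<Sum>i\<in>I. B j i * u i) = 0) \<longrightarrow> (\<forall>i\<in>I. u i = 0)"
    and strict: "\<forall>\<epsilon>>0. \<exists>r>0. \<forall>x x'. vdist I x p < r \<longrightarrow> vdist I x' p < r \<longrightarrow>
       (\<forall>j\<in>I. norm ((x' j - x j) - (\<Sum>i\<in>I. B j i * (F x' i - F x i))) \<le> \<epsilon> * vdist I x' x)"
  obtains r L where "r > 0" "L > 0"
    "\<And>x x'. vdist I x p < r \<Longrightarrow> vdist I x' p < r \<Longrightarrow> vdist I x' x \<le> L * vdist I (F x') (F x)"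
    "\<And>r'. 0 < r' \<Longrightarrow> r' \<le> r \<Longrightarrow> \<exists>\<delta>>0. \<forall>y. vdist I y (F p) < \<delta> \<longrightarrow>
       (\<exists>x\<in>I \<rightarrow>\<^sub>E UNIV. vdist I x p < r' \<and> (\<forall>i\<in>I. F x i = y i))"
proof -
  \<comment> \<open>Chosen so that the errors of all coordinates add up to at most half of the distance.\<close>
  define \<epsilon> where "\<epsilon> = 1 / (2 * (real (card I) + 1))"
  have \<epsilon>: "\<epsilon> > 0" "real (card I) * \<epsilon> \<le> 1/2" by (auto simp: \<epsilon>_def field_simps)
  obtain r where r: "r > 0" and close: "\<And>x x' j. vdist I x p < r \<Longrightarrow> vdist I x' p < r \<Longrightarrow> j \<in> I \<Longrightarrow>
       norm ((x' j - x j) - (\<Sum>i\<in>I. B j i * (F x' i - F x i))) \<le> \<epsilon> * vdist I x' x"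
    using strict[rule_format, OF \<epsilon>(1)] by blast
  have close_sum: "(\<Sum>j\<in>I. norm ((x' j - x j) - (\<Sum>i\<in>I. B j i * (F x' i - F x i)))) \<le> vdist I x' x / 2"
    if "vdist I x p < r" "vdist I x' p < r" for x x'
  proof -
    have "(\<Sum>j\<in>I. norm ((x' j - x j) - (\<Sum>i\<in>I. B j i * (F x' i - F x i)))) \<le> real (card I) * (\<epsilon> * vdist I x' x)"
      by (rule sum_bounded_above) (rule close[OF that])
    also have "\<dots> \<le> 1/2 * vdist I x' x"
      unfolding mult.assoc[symmetric] by (rule mult_right_mono[OF \<epsilon>(2)]) simp
    finally show ?thesis by simp
  qed
  define b where "b = (\<Sum>j\<in>I. \<Sum>i\<in>I. norm (B j i)) + 1"
  have b: "b > 0" unfolding b_def by (intro add_nonneg_pos sum_nonneg) auto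
  have B: "(\<Sum>j\<in>I. norm (\<Sum>i\<in>I. B j i * (u i - v i))) \<le> b * vdist I u v" for u v
    using norm_matrix_row_sum_le[OF I, of B u v] vdist_nonneg[of I u v] unfolding b_def distrib_right by linarith
  have lip: "vdist I x' x \<le> 2 * b * vdist I (F x') (F x)" if "vdist I x p < r" "vdist I x' p < r" for x x'
  proof -
    have "vdist I x' x \<le> (\<Sum>j\<in>I. norm ((x' j - x j) - (\<Sum>i\<in>I. B j i * (F x' i - F x i)))
        + norm (\<Sum>i\<in>I. B j i * (F x' i - F x i)))"
      unfolding vdist_def by (rule sum_mono) (metis diff_add_cancel norm_triangle_ineq)
    also have "\<dots> \<le> vdist I x' x / 2 + b * vdist I (F x') (F x)"
      unfolding sum.distrib by (intro add_mono close_sum[OF that] B)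
    finally show ?thesis by simp
  qed
  have "\<exists>\<delta>>0. \<forall>y. vdist I y (F p) < \<delta> \<longrightarrow> (\<exists>x\<in>I \<rightarrow>\<^sub>E UNIV. vdist I x p < r' \<and> (\<forall>i\<in>I. F x i = y i))"
    if r': "r' > 0" "r' \<le> r" for r'
  proof (intro exI[of _ "r' / (4 * b)"] conjI allI impI)
    show "r' / (4 * b) > 0" using r' b by simp
    fix y assume y: "vdist I y (F p) < r' / (4 * b)"
    define G where "G x = (\<lambda>j. x j - (\<Sum>i\<in>I. B j i * (F x i - y i)))" for x
    have contr: "vdist I (G x') (G x) \<le> vdist I x' x / 2" if "vdist I x p < r" "vdist I x' p < r" for x x'
    proof -
      have "G x' j - G x j = (x' j - x j) - (\<Sum>i\<in>I. B j i * (F x' i - F x i))" for j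
        by (simp add: G_def algebra_simps sum_subtractf)
      then show ?thesis unfolding vdist_def[of I "G x'"] using close_sum[OF that] by simp
    qed
    define a where "a = r' / 4"
    have start: "vdist I (G p) p \<le> a"
    proof -
      have "vdist I (G p) p = (\<Sum>j\<in>I. norm (\<Sum>i\<in>I. B j i * (F p i - y i)))"
        by (simp add: vdist_def G_def)
      also have "\<dots> \<le> b * vdist I (F p) y" by (rule B)
      also have "\<dots> \<le> b * (r' / (4 * b))" using y b by (intro mult_left_mono) (auto simp: vdist_commute)
      finally show ?thesis using b by (simp add: a_def)
    qed
    define X where "X k = (G ^^ k) p" for k
    have XS: "X (Suc k) = G (X k)" for k by (simp add: X_def)
    have X: "vdist I (X k) p \<le> 2 * a * (1 - (1/2)^k) \<and> vdist I (X (Suc k)) (X k) \<le> a * (1/2)^k" for k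
    proof (induction k)
      case 0 show ?case using start by (simp add: X_def)
    next
      case (Suc k)
      have *: "vdist I (X (Suc k)) p \<le> 2 * a * (1 - (1/2)^Suc k)"
        using vdist_triangle[of I "X (Suc k)" p "X k"] Suc by (simp add: algebra_simps)
      have a0: "a > 0" using r' by (simp add: a_def)
      have "2 * a * (1 - (1/2)^j) < r" for j :: nat
      proof -
        have "2 * a * (1 - (1/2)^j) \<le> 2 * a * 1" using a0 by (intro mult_left_mono) auto
        also have "\<dots> < r" using r' by (simp add: a_def)
        finally show ?thesis .
      qed
      then have "vdist I (X (Suc k)) p < r" "vdist I (X k) p < r"
        using * Suc by (meson le_less_trans)+
      then have "vdist I (X (Suc (Suc k))) (X (Suc k)) \<le> vdist I (X (Suc k)) (X k) / 2"
        using contr XS by metis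
      with Suc * show ?case by simp
    qed
    have X_r: "vdist I (X k) p \<le> r' / 2" for k
    proof -
      have "2 * a * (1 - (1/2)^k) \<le> 2 * a * 1" using r' by (intro mult_left_mono) (auto simp: a_def)
      then show ?thesis using X[of k] by (simp add: a_def)
    qed
    have "convergent (\<lambda>k. X k j)" if "j \<in> I" for j
    proof -
      have "summable (\<lambda>k. X (Suc k) j - X k j)"
      proof (rule summable_comparison_test')
        show "summable (\<lambda>k. a * (1/2)^k)" by (intro summable_mult summable_geometric) simp
        show "norm (X (Suc k) j - X k j) \<le> a * (1/2)^k" for k
          using norm_le_vdist[OF I that, of "X (Suc k)" "X k"] X[of k] by simp
      qed
      then have "convergent (\<lambda>k. (\<Sum>l<k. X (Suc l) j - X l j) + X 0 j)"
        by (intro convergent_add convergent_const) (simp add: summable_iff_convergent)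
      then show ?thesis using sum_lessThan_telescope[of "\<lambda>l. X l j"] by simp
    qed
    then obtain x0 where x0: "\<And>j. j \<in> I \<Longrightarrow> (\<lambda>k. X k j) \<longlonglongrightarrow> x0 j"
      unfolding convergent_def by metis
    define x where "x = restrict x0 I"
    have x: "(\<lambda>k. X k j) \<longlonglongrightarrow> x j" if "j \<in> I" for j using x0[OF that] that by (simp add: x_def)
    have lim: "(\<lambda>k. vdist I (X k) x) \<longlonglongrightarrow> 0"
      unfolding vdist_def by (rule tendsto_null_sum) (intro tendsto_norm_zero LIM_zero x)
    have "(\<lambda>k. vdist I (X k) p) \<longlonglongrightarrow> vdist I x p"
      unfolding vdist_def by (intro tendsto_intros x)
    then have xp: "vdist I x p \<le> r' / 2" by (rule LIMSEQ_le_const2) (use X_r in auto)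
    have "(\<lambda>k. vdist I (X k) x / 2 + vdist I (X (Suc k)) x) \<longlonglongrightarrow> 0 / 2 + 0"
      by (intro tendsto_intros lim LIMSEQ_Suc[OF lim]) simp
    moreover have "vdist I (G x) x \<le> vdist I (X k) x / 2 + vdist I (X (Suc k)) x" for k
    proof -
      have "vdist I x p < r" "vdist I (X k) p < r" using xp X_r[of k] r' by auto
      then have "vdist I (G x) (X (Suc k)) \<le> vdist I (X k) x / 2"
        using contr[of "X k" x] XS[of k] by (simp add: vdist_commute)
      then show ?thesis using vdist_triangle[of I "G x" x "X (Suc k)"] by simp
    qed
    ultimately have "vdist I (G x) x \<le> 0" by (intro LIMSEQ_le_const) auto
    then have "\<forall>j\<in>I. G x j = x j" using vdist_eq_0[OF I] by (metis antisym vdist_nonneg)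
    then have "\<forall>i\<in>I. F x i - y i = 0" by (intro ballI inj[rule_format, of "\<lambda>i. F x i - y i"]) (simp_all add: G_def)
    then show "\<exists>x\<in>I \<rightarrow>\<^sub>E UNIV. vdist I x p < r' \<and> (\<forall>i\<in>I. F x i = y i)"
      using xp r' by (intro bexI[of _ x]) (auto simp: x_def)
  qed
  with r lip b show ?thesis by (intro that[of r "2 * b"]) auto
qed

lemma compact_PiE_cball:
  fixes I :: "'i set"
  shows "compact (I \<rightarrow>\<^sub>E cball (0::complex) R)"
proof -
  have "I \<rightarrow>\<^sub>E cball (0::complex) R = (\<Pi>\<^sub>E i\<in>UNIV. if i \<in> I then cball 0 R else {undefined})"
    by (auto simp: PiE_iff extensional_def split: if_splits)
  moreover have "compactin (product_topology (\<lambda>_. euclidean) UNIV) (\<Pi>\<^sub>E i\<in>UNIV. if i \<in> I then cball (0::complex) R else {undefined})"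
    by (subst compactin_PiE) auto
  ultimately show ?thesis
    by (simp add: euclidean_product_topology)
qed

lemma continuous_on_vdist:
  assumes "\<And>i. i \<in> I \<Longrightarrow> continuous_on S (\<lambda>x. f x i)"
  shows "continuous_on S (\<lambda>x. vdist I (f x) y)" "continuous_on S (\<lambda>x. nrm I (f x))"
  unfolding vdist_def nrm_def by (intro continuous_intros assms; simp)+

section \<open>Estimates for polynomial functions\<close>

text \<open>Boundedness and the Lipschitz property are proved together because the product rule for the latter uses the former.\<close>
lemma poly_fn_bounded_lipschitz:
  assumes "finite I" "poly_fn I N h"
  shows "\<exists>K\<ge>0. \<forall>x x'. nrm I x \<le> R \<longrightarrow> nrm I x' \<le> R \<longrightarrow> norm (h x) \<le> K \<and> norm (h x - h x') \<le> K * vdist I x x'"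
  using assms
proof (induction rule: poly_fn_induct)
  case (const c)
  then show ?case by (intro exI[of _ "norm c"]) auto
next
  case (coord i)
  have "norm (x i) \<le> \<bar>R\<bar> + 1 \<and> norm (x i - x' i) \<le> (\<bar>R\<bar> + 1) * vdist I x x'" if "nrm I x \<le> R" for x x'
  proof -
    have "norm (x i) \<le> R" using norm_le_nrm[OF assms(1) coord, of x] that by simp
    moreover have "vdist I x x' \<le> (\<bar>R\<bar> + 1) * vdist I x x'"
      using mult_right_mono[of 1 "\<bar>R\<bar> + 1" "vdist I x x'"] by simp
    ultimately show ?thesis using norm_le_vdist[OF assms(1) coord, of x x'] by linarith
  qed
  then show ?case by (intro exI[of _ "\<bar>R\<bar> + 1"]) auto
next
  case (add f g)
  then obtain K L where K: "K \<ge> 0" "\<And>x x'. nrm I x \<le> R \<Longrightarrow> nrm I x' \<le> R \<Longrightarrow> norm (f x) \<le> K \<and> norm (f x - f x') \<le> K * vdist I x x'"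
    and L: "L \<ge> 0" "\<And>x x'. nrm I x \<le> R \<Longrightarrow> nrm I x' \<le> R \<Longrightarrow> norm (g x) \<le> L \<and> norm (g x - g x') \<le> L * vdist I x x'"
    by blast
  have "norm (f x + g x) \<le> K + L \<and> norm (f x + g x - (f x' + g x')) \<le> (K + L) * vdist I x x'"
    if "nrm I x \<le> R" "nrm I x' \<le> R" for x x'
  proof
    show "norm (f x + g x) \<le> K + L" using K(2)[OF that] L(2)[OF that] by (meson add_mono norm_triangle_le)
    have "norm (f x + g x - (f x' + g x')) \<le> norm (f x - f x') + norm (g x - g x')"
      by (metis add_diff_add norm_triangle_ineq)
    then show "norm (f x + g x - (f x' + g x')) \<le> (K + L) * vdist I x x'"
      using K(2)[OF that] L(2)[OF that] by (simp add: distrib_right)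
  qed
  then show ?case using K L by (intro exI[of _ "K + L"]) auto
next
  case (mult f g)
  then obtain K L where K: "K \<ge> 0" "\<And>x x'. nrm I x \<le> R \<Longrightarrow> nrm I x' \<le> R \<Longrightarrow> norm (f x) \<le> K \<and> norm (f x - f x') \<le> K * vdist I x x'"
    and L: "L \<ge> 0" "\<And>x x'. nrm I x \<le> R \<Longrightarrow> nrm I x' \<le> R \<Longrightarrow> norm (g x) \<le> L \<and> norm (g x - g x') \<le> L * vdist I x x'"
    by blast
  have "norm (f x * g x) \<le> 2 * (K * L) \<and> norm (f x * g x - f x' * g x') \<le> 2 * (K * L) * vdist I x x'"
    if "nrm I x \<le> R" "nrm I x' \<le> R" for x x'
  proof
    have "norm (f x * g x) \<le> K * L"
      unfolding norm_mult using K(2)[OF that] L(2)[OF that] K(1) by (intro mult_mono) auto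
    then show "norm (f x * g x) \<le> 2 * (K * L)" using K(1) L(1) mult_nonneg_nonneg[of K L] by linarith
    have "f x * g x - f x' * g x' = f x * (g x - g x') + (f x - f x') * g x'" by (simp add: algebra_simps)
    then have "norm (f x * g x - f x' * g x') \<le> norm (f x) * norm (g x - g x') + norm (f x - f x') * norm (g x')"
      by (metis norm_mult norm_triangle_ineq)
    also have "\<dots> \<le> K * (L * vdist I x x') + (K * vdist I x x') * L"
      using K(2)[OF that] L(2)[OF that] L(2)[OF that(2,1)] K(1) L(1) by (intro add_mono mult_mono) auto
    finally show "norm (f x * g x - f x' * g x') \<le> 2 * (K * L) * vdist I x x'" by (simp add: algebra_simps)
  qed
  then show ?case using K L by (intro exI[of _ "2 * (K * L)"]) auto
qed

lemma poly_fn_continuous: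
  assumes "finite I" "poly_fn I N h" "\<epsilon> > 0"
  shows "\<exists>\<eta>>0. \<forall>x. vdist I x p < \<eta> \<longrightarrow> norm (h x - h p) < \<epsilon>"
proof -
  obtain K where K: "K \<ge> 0" "\<And>x x'. nrm I x \<le> nrm I p + 1 \<Longrightarrow> nrm I x' \<le> nrm I p + 1 \<Longrightarrow> norm (h x - h x') \<le> K * vdist I x x'"
    using poly_fn_bounded_lipschitz[OF assms(1,2), of "nrm I p + 1"] by blast
  let ?\<eta> = "min 1 (\<epsilon> / (K + 1))"
  have "norm (h x - h p) < \<epsilon>" if "vdist I x p < ?\<eta>" for x
  proof -
    have "norm (h x - h p) \<le> K * vdist I x p"
      using nrm_le_vdist[of I x p] that by (intro K) auto
    also have "\<dots> \<le> (K + 1) * vdist I x p" by (rule mult_right_mono) auto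
    also have "\<dots> < (K + 1) * (\<epsilon> / (K + 1))" using that K(1) by (intro mult_strict_left_mono) auto
    finally show ?thesis using K(1) by simp
  qed
  moreover have "?\<eta> > 0" using assms(3) K(1) by auto
  ultimately show ?thesis by blast
qed

lemma norm_monomial_le:
  assumes "finite I" "nrm I x \<le> R"
  shows "norm (monomial I \<alpha> x) \<le> R ^ sum \<alpha> I"
proof -
  have "norm (monomial I \<alpha> x) \<le> (\<Prod>i\<in>I. R ^ \<alpha> i)"
    unfolding monomial_def prod_norm[symmetric] norm_power
    using norm_le_nrm[OF assms(1), of _ x] assms(2) by (intro prod_mono) (auto intro!: power_mono intro: order_trans)
  then show ?thesis by (simp add: power_sum)
qed

lemma poly_fn_growth:
  assumes "finite I" "poly_fn I N h"
  shows "\<exists>K\<ge>0. \<forall>x. norm (h x) \<le> K * (1 + nrm I x) ^ N"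
proof -
  obtain a where a: "\<And>x. h x = (\<Sum>\<alpha>\<in>exponents I N. a \<alpha> * monomial I \<alpha> x)"
    using assms by (auto simp: poly_fn_def)
  have "norm (h x) \<le> (\<Sum>\<alpha>\<in>exponents I N. norm (a \<alpha>)) * (1 + nrm I x) ^ N" for x
  proof -
    have "norm (monomial I \<alpha> x) \<le> (1 + nrm I x) ^ N" if "\<alpha> \<in> exponents I N" for \<alpha>
    proof -
      have "norm (monomial I \<alpha> x) \<le> (1 + nrm I x) ^ sum \<alpha> I" by (rule norm_monomial_le) (use assms in auto)
      also have "\<dots> \<le> (1 + nrm I x) ^ N" using that by (intro power_increasing) (auto simp: exponents_def)
      finally show ?thesis .
    qed
    then have "norm (h x) \<le> (\<Sum>\<alpha>\<in>exponents I N. norm (a \<alpha>) * (1 + nrm I x) ^ N)"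
      unfolding a by (intro sum_norm_le) (auto simp: norm_mult intro: mult_left_mono)
    then show ?thesis by (simp add: sum_distrib_right)
  qed
  then show ?thesis by (intro exI[of _ "\<Sum>\<alpha>\<in>exponents I N. norm (a \<alpha>)"]) (auto intro: sum_nonneg)
qed

lemma poly_fn_continuous_on:
  assumes "finite I" "poly_fn I N h"
  shows "continuous_on S h"
  using assms
proof (induction rule: poly_fn_induct)
  case (coord i)
  show ?case by (rule continuous_on_subset[OF continuous_on_product_coordinates]) auto
qed (auto intro: continuous_intros)

lemma poly_fn_field_differentiable:
  assumes "finite I" "poly_fn I N h" "\<And>i. i \<in> I \<Longrightarrow> (\<lambda>t. x t i) field_differentiable at t0"
  shows "(\<lambda>t. h (x t)) field_differentiable at t0"
  using assms(1,2)
  by (induction rule: poly_fn_induct) (use assms(3) in \<open>auto intro: field_differentiable_add field_differentiable_mult\<close>)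

lemma poly_fn_along_line:
  assumes "finite I" "poly_fn I N h"
  shows "\<exists>q. \<forall>t. h (\<lambda>i. v i + t * w i) = poly q t"
  using assms
proof (induction rule: poly_fn_induct)
  case (const c) show ?case by (intro exI[of _ "[:c:]"]) simp
next
  case (coord i) show ?case by (intro exI[of _ "[:v i, w i:]"]) simp
next
  case (add f g) then show ?case by (metis poly_add)
next
  case (mult f g) then show ?case by (metis poly_mult)
qed

text \<open>Only the existence of the coefficients of the expansion at \<open>p\<close> is needed: vanishing to high order at \<open>p\<close> is then a system of linear
equations in the coefficients of a polynomial function.\<close>
lemma taylor_coefficients:
  assumes "finite I"
  shows "\<exists>e. \<forall>\<alpha>\<in>exponents I N. \<forall>u. monomial I \<alpha> (\<lambda>i. p i + u i) = (\<Sum>\<beta>\<in>exponents I N. e \<alpha> \<beta> * monomial I \<beta> u)"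
proof (rule bchoice, rule ballI)
  fix \<alpha> assume \<alpha>: "\<alpha> \<in> exponents I N"
  have "poly_fn I (1 * N) (\<lambda>u. monomial I \<alpha> (\<lambda>i. p i + u i))"
    by (rule poly_fn_compose[OF assms assms])
       (use \<alpha> assms poly_fn_coord in \<open>auto intro!: poly_fn_add poly_fn_const poly_fn_monomial\<close>)
  then show "\<exists>e. \<forall>u. monomial I \<alpha> (\<lambda>i. p i + u i) = (\<Sum>\<beta>\<in>exponents I N. e \<beta> * monomial I \<beta> u)"
    by (simp add: poly_fn_def)
qed

lemma vanishing_order_bound:
  assumes "finite I"
    and e: "\<And>u. h (\<lambda>i. p i + u i) = (\<Sum>\<beta>\<in>exponents I N. b \<beta> * monomial I \<beta> u)"
    and b: "\<And>\<beta>. \<beta> \<in> exponents I Q \<Longrightarrow> \<beta> \<in> exponents I N \<Longrightarrow> b \<beta> = 0"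
  shows "\<exists>K\<ge>0. \<forall>x. vdist I x p \<le> 1 \<longrightarrow> norm (h x) \<le> K * vdist I x p ^ Suc Q"
proof (intro exI[of _ "\<Sum>\<beta>\<in>exponents I N. norm (b \<beta>)"] conjI allI impI)
  show "0 \<le> (\<Sum>\<beta>\<in>exponents I N. norm (b \<beta>))" by (simp add: sum_nonneg)
  fix x assume x: "vdist I x p \<le> 1"
  define u where "u i = x i - p i" for i
  have nu: "nrm I u = vdist I x p" by (simp add: nrm_def vdist_def u_def)
  have "norm (b \<beta> * monomial I \<beta> u) \<le> norm (b \<beta>) * vdist I x p ^ Suc Q" if "\<beta> \<in> exponents I N" for \<beta>
  proof (cases "\<beta> \<in> exponents I Q")
    case True
    then show ?thesis using b that by simp
  next
    case False
    then have "Suc Q \<le> sum \<beta> I" using that by (auto simp: exponents_def)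
    then have "vdist I x p ^ sum \<beta> I \<le> vdist I x p ^ Suc Q" using x by (intro power_decreasing) auto
    then show ?thesis unfolding norm_mult
      using norm_monomial_le[OF assms(1), of u "vdist I x p" \<beta>] nu by (intro mult_left_mono) auto
  qed
  then have "norm (\<Sum>\<beta>\<in>exponents I N. b \<beta> * monomial I \<beta> u) \<le> (\<Sum>\<beta>\<in>exponents I N. norm (b \<beta>) * vdist I x p ^ Suc Q)"
    by (rule sum_norm_le)
  moreover have "h x = (\<Sum>\<beta>\<in>exponents I N. b \<beta> * monomial I \<beta> u)"
    using e[of u] by (simp add: u_def)
  ultimately show "norm (h x) \<le> (\<Sum>\<beta>\<in>exponents I N. norm (b \<beta>)) * vdist I x p ^ Suc Q"
    by (simp add: sum_distrib_right)
qed

text \<open>A product of linear forms, one for each point other than \<open>c\<close>, in a coordinate that distinguishes this point from \<open>c\<close>.\<close>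
lemma separating_poly_fn:
  assumes "finite I" "finite C" "C \<subseteq> I \<rightarrow>\<^sub>E UNIV" "c \<in> C"
  shows "\<exists>g. poly_fn I (card C) g \<and> g c = 1 \<and> (\<forall>c'\<in>C - {c}. g c' = 0)"
proof -
  have "\<forall>c'\<in>C - {c}. \<exists>i\<in>I. c i \<noteq> c' i"
    using assms by (metis DiffE PiE_ext insertI1 subsetD)
  then obtain i where i: "\<And>c'. c' \<in> C - {c} \<Longrightarrow> i c' \<in> I \<and> c (i c') \<noteq> c' (i c')" by metis
  define g where "g x = (\<Prod>c'\<in>C - {c}. inverse (c (i c') - c' (i c')) * (x (i c') - c' (i c')))" for x
  have "poly_fn I (\<Sum>c'\<in>C - {c}. Suc 0) g"
    unfolding g_def using i assms
    by (intro poly_fn_prod poly_fn_cmult poly_fn_diff poly_fn_const poly_fn_coord) auto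
  then have "poly_fn I (card C) g"
    by (rule poly_fn_mono[OF assms(1)]) (use assms in \<open>simp add: card_mono\<close>)
  moreover have "g c = 1" unfolding g_def using i by (intro prod.neutral) auto
  moreover have "g c' = 0" if "c' \<in> C - {c}" for c'
    unfolding g_def by (rule prod_zero) (use assms that in auto)
  ultimately show ?thesis by blast
qed

text \<open>Liouville's theorem makes \<open>G\<close> a polynomial of degree at most \<open>Q\<close>, and by Cauchy's inequality on small circles all its Taylor
coefficients up to order \<open>Q\<close> vanish.\<close>
lemma entire_eq_0_of_growth_and_vanishing:
  assumes hol: "G holomorphic_on UNIV"
    and growth: "\<And>t. norm (G t) \<le> K * (1 + norm t) ^ Q"
    and vanish: "eventually (\<lambda>t. norm (G t) \<le> K' * norm t ^ Suc Q) (nhds 0)"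
  shows "G t = 0"
proof -
  have K: "K \<ge> 0" using order_trans[OF norm_ge_zero growth[of 0]] by simp
  have poly: "G \<xi> = (\<Sum>k\<le>Q. (deriv ^^ k) G 0 / fact k * \<xi> ^ k)" for \<xi>
  proof (rule Liouville_polynomial[OF hol, of 1 "K * 2 ^ Q"])
    fix z :: complex assume z: "1 \<le> norm z"
    have "K * (1 + norm z) ^ Q \<le> K * (2 * norm z) ^ Q"
      using z K by (intro mult_left_mono power_mono) auto
    then show "norm (G z) \<le> K * 2 ^ Q * norm z ^ Q"
      using growth[of z] by (simp add: power_mult_distrib mult_ac)
  qed
  have "(deriv ^^ k) G 0 = 0" if k: "k \<le> Q" for k
  proof -
    obtain e where e: "e > 0" "\<And>t. norm t < e \<Longrightarrow> norm (G t) \<le> K' * norm t ^ Suc Q"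
      using vanish unfolding eventually_nhds_metric by auto
    have "norm ((deriv ^^ k) G 0) \<le> fact k * K' * r ^ (Suc Q - k)" if r: "0 < r" "r < e" for r
    proof -
      have "norm ((deriv ^^ k) G 0) \<le> fact k * (K' * r ^ Suc Q) / r ^ k"
      proof (rule Cauchy_inequality)
        show "norm (G x) \<le> K' * r ^ Suc Q" if "norm (0 - x) = r" for x
          using e(2)[of x] r that by simp
      qed (use r in \<open>auto intro: holomorphic_on_subset[OF hol] holomorphic_on_imp_continuous_on\<close>)
      also have "\<dots> = fact k * K' * r ^ (Suc Q - k)"
        using r k by (simp add: power_diff)
      finally show ?thesis .
    qed
    then have "\<forall>\<^sub>F r in at_right 0. norm ((deriv ^^ k) G 0) \<le> fact k * K' * r ^ (Suc Q - k)"
      unfolding eventually_at_right_field using e(1) by (intro exI[of _ e]) auto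
    moreover have "((\<lambda>r. fact k * K' * r ^ (Suc Q - k)) \<longlongrightarrow> fact k * K' * 0 ^ (Suc Q - k)) (at_right 0)"
      by (intro tendsto_intros)
    ultimately have "norm ((deriv ^^ k) G 0) \<le> fact k * K' * 0 ^ (Suc Q - k)"
      by (intro tendsto_lowerbound) auto
    then show ?thesis using k by (simp add: power_0_left)
  qed
  then show ?thesis using poly[of t] by simp
qed

section \<open>Finite polynomial maps: local sections of the fibres\<close>

text \<open>A proper polynomial self-map \<open>F\<close> of affine space, of degree \<open>d\<close> in each component, whose differential is invertible at all points
that lie outside of the preimage of the hypersurface \<open>\<Delta> = 0\<close>.  Properness is stated in the quantitative form that holds for
homogeneous components of degree \<open>d\<close> without a common zero except \<open>0\<close>; regularity is stated as in the inverse function theorem above.\<close>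
locale finite_polynomial_map =
  fixes I :: "'i set" and d :: nat and F :: "('i \<Rightarrow> complex) \<Rightarrow> 'i \<Rightarrow> complex"
    and \<Delta> :: "('i \<Rightarrow> complex) \<Rightarrow> complex" and \<delta> :: nat
  assumes finite_I: "finite I" and d_pos: "d > 0"
    and poly_F: "\<And>j. j \<in> I \<Longrightarrow> poly_fn I d (\<lambda>x. F x j)"
    and poly_disc: "poly_fn I \<delta> \<Delta>"
    and proper: "\<exists>K. \<forall>x. nrm I x ^ d \<le> K * nrm I (F x)"
    and nonempty: "\<exists>x. \<Delta> (F x) \<noteq> 0"
    and regular: "\<And>p. \<Delta> (F p) \<noteq> 0 \<Longrightarrow>
      \<exists>B. (\<forall>u. (\<forall>j\<in>I. (\<Sum>i\<in>I. B j i * u i) = 0) \<longrightarrow> (\<forall>i\<in>I. u i = 0)) \<and>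
        (\<forall>\<epsilon>>0. \<exists>r>0. \<forall>x x'. vdist I x p < r \<longrightarrow> vdist I x' p < r \<longrightarrow>
          (\<forall>j\<in>I. norm ((x' j - x j) - (\<Sum>i\<in>I. B j i * (F x' i - F x i))) \<le> \<epsilon> * vdist I x' x))"
begin

text \<open>The restriction to \<open>I \<rightarrow>\<^sub>E UNIV\<close> selects one representative for the coordinates in \<open>I\<close>; otherwise no fibre would be finite.\<close>
definition fibre :: "('i \<Rightarrow> complex) \<Rightarrow> ('i \<Rightarrow> complex) set" where
  "fibre y = {x \<in> I \<rightarrow>\<^sub>E UNIV. \<forall>j\<in>I. F x j = y j}"

lemma F_cong: "(\<And>i. i \<in> I \<Longrightarrow> x i = x' i) \<Longrightarrow> j \<in> I \<Longrightarrow> F x j = F x' j"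
  using poly_fn_cong[OF finite_I poly_F] by blast

lemma disc_cong: "(\<And>i. i \<in> I \<Longrightarrow> y i = y' i) \<Longrightarrow> \<Delta> y = \<Delta> y'"
  using poly_fn_cong[OF finite_I poly_disc] by blast

lemma fibreD: "x \<in> fibre y \<Longrightarrow> x \<in> I \<rightarrow>\<^sub>E UNIV" "x \<in> fibre y \<Longrightarrow> j \<in> I \<Longrightarrow> F x j = y j"
  by (auto simp: fibre_def)

lemma disc_F_fibre: "x \<in> fibre y \<Longrightarrow> \<Delta> (F x) = \<Delta> y"
  by (rule disc_cong) (rule fibreD)

lemma vdist_F_fibre: "x \<in> fibre y \<Longrightarrow> vdist I z (F x) = vdist I z y"
  by (rule vdist_cong) (auto simp: fibreD)

lemma fibre_eqI: "x \<in> I \<rightarrow>\<^sub>E UNIV \<Longrightarrow> x' \<in> I \<rightarrow>\<^sub>E UNIV \<Longrightarrow> vdist I x x' \<le> 0 \<Longrightarrow> x = x'"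
  using vdist_eq_0[OF finite_I, of x x'] by (metis PiE_ext antisym vdist_nonneg)

lemma local_inverse:
  assumes "c \<in> fibre v" "\<Delta> v \<noteq> 0"
  obtains r L where "r > 0" "L > 0"
    "\<And>x x'. vdist I x c < r \<Longrightarrow> vdist I x' c < r \<Longrightarrow> vdist I x' x \<le> L * vdist I (F x') (F x)"
    "\<And>r'. 0 < r' \<Longrightarrow> r' \<le> r \<Longrightarrow> \<exists>\<delta>>0. \<forall>y. vdist I y v < \<delta> \<longrightarrow> (\<exists>x\<in>fibre y. vdist I x c < r')"
proof -
  have "\<Delta> (F c) \<noteq> 0" using assms disc_F_fibre by simp
  from regular[OF this] obtain B where B1: "\<forall>u. (\<forall>j\<in>I. (\<Sum>i\<in>I. B j i * u i) = 0) \<longrightarrow> (\<forall>i\<in>I. u i = 0)"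
    and B2: "\<forall>\<epsilon>>0. \<exists>r>0. \<forall>x x'. vdist I x c < r \<longrightarrow> vdist I x' c < r \<longrightarrow>
          (\<forall>j\<in>I. norm ((x' j - x j) - (\<Sum>i\<in>I. B j i * (F x' i - F x i))) \<le> \<epsilon> * vdist I x' x)"
    by (elim exE conjE)
  show ?thesis
  proof (rule inverse_function[OF finite_I B1 B2])
    fix r L :: real
    assume rL: "r > 0" "L > 0"
      "\<And>x x'. vdist I x c < r \<Longrightarrow> vdist I x' c < r \<Longrightarrow> vdist I x' x \<le> L * vdist I (F x') (F x)"
      "\<And>r'. 0 < r' \<Longrightarrow> r' \<le> r \<Longrightarrow> \<exists>\<delta>>0. \<forall>y. vdist I y (F c) < \<delta> \<longrightarrow> (\<exists>x\<in>I \<rightarrow>\<^sub>E UNIV. vdist I x c < r' \<and> (\<forall>i\<in>I. F x i = y i))"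
    have "\<exists>\<delta>>0. \<forall>y. vdist I y v < \<delta> \<longrightarrow> (\<exists>x\<in>fibre y. vdist I x c < r')" if r': "0 < r'" "r' \<le> r" for r'
    proof -
      obtain \<theta> where \<theta>: "\<theta> > 0" "\<And>y. vdist I y (F c) < \<theta> \<Longrightarrow> \<exists>x\<in>I \<rightarrow>\<^sub>E UNIV. vdist I x c < r' \<and> (\<forall>i\<in>I. F x i = y i)"
        using rL(4)[OF r'] by (elim exE conjE) simp
      have "\<exists>x\<in>fibre y. vdist I x c < r'" if "vdist I y v < \<theta>" for y
        using \<theta>(2)[of y] that vdist_F_fibre[OF assms(1)] by (auto simp: fibre_def)
      then show ?thesis using \<theta>(1) by blast
    qed
    with rL(1-3) show ?thesis by (rule that)
  qed
qed

text \<open>Around any finite part \<open>C\<close> of a fibre the local inverses can be put on a common ball, with disjoint ranges.  It is not assumed that \<open>C\<close> is the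
whole fibre, since this lemma is used to prove that fibres are finite.\<close>
lemma branches:
  assumes C: "finite C" "C \<subseteq> fibre v" and v: "\<Delta> v \<noteq> 0"
  obtains r L \<eta> \<sigma> where "r > 0" "L > 0" "\<eta> > 0"
    "\<And>c y. c \<in> C \<Longrightarrow> vdist I y v < \<eta> \<Longrightarrow> \<sigma> c y \<in> fibre y"
    "\<And>c y x. c \<in> C \<Longrightarrow> vdist I y v < \<eta> \<Longrightarrow> x \<in> fibre y \<Longrightarrow> vdist I x c < r \<Longrightarrow> x = \<sigma> c y"
    "\<And>c y y'. c \<in> C \<Longrightarrow> vdist I y v < \<eta> \<Longrightarrow> vdist I y' v < \<eta> \<Longrightarrow> vdist I (\<sigma> c y) (\<sigma> c y') \<le> L * vdist I y y'"
    "\<And>c. c \<in> C \<Longrightarrow> \<sigma> c v = c"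
    "\<And>y. vdist I y v < \<eta> \<Longrightarrow> inj_on (\<lambda>c. \<sigma> c y) C"
proof -
  define Q where "Q c p \<longleftrightarrow> fst p > 0 \<and> snd p > 0 \<and>
      (\<forall>x x'. vdist I x c < fst p \<longrightarrow> vdist I x' c < fst p \<longrightarrow> vdist I x' x \<le> snd p * vdist I (F x') (F x)) \<and>
      (\<forall>r'>0. r' \<le> fst p \<longrightarrow> (\<exists>\<delta>>0. \<forall>y. vdist I y v < \<delta> \<longrightarrow> (\<exists>x\<in>fibre y. vdist I x c < r')))"
    for c and p :: "real \<times> real"
  have "\<exists>p. Q c p" if "c \<in> C" for c
  proof -
    have "c \<in> fibre v" using that C(2) by blast
    show ?thesis
    proof (rule local_inverse[OF \<open>c \<in> fibre v\<close> v])
      fix r L :: real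
      assume "r > 0" "L > 0"
        "\<And>x x'. vdist I x c < r \<Longrightarrow> vdist I x' c < r \<Longrightarrow> vdist I x' x \<le> L * vdist I (F x') (F x)"
        "\<And>r'. 0 < r' \<Longrightarrow> r' \<le> r \<Longrightarrow> \<exists>\<delta>>0. \<forall>y. vdist I y v < \<delta> \<longrightarrow> (\<exists>x\<in>fibre y. vdist I x c < r')"
      then show ?thesis by (intro exI[of _ "(r, L)"]) (simp add: Q_def)
    qed
  qed
  then obtain p where p: "\<And>c. c \<in> C \<Longrightarrow> Q c (p c)" by metis
  define r where "r c = fst (p c)" for c
  define L where "L c = snd (p c)" for c
  have r_pos: "r c > 0" and L_pos: "L c > 0"
    and lip0: "\<And>x x'. vdist I x c < r c \<Longrightarrow> vdist I x' c < r c \<Longrightarrow> vdist I x' x \<le> L c * vdist I (F x') (F x)"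
    and sur0: "\<And>r'. r' > 0 \<Longrightarrow> r' \<le> r c \<Longrightarrow> \<exists>\<delta>>0. \<forall>y. vdist I y v < \<delta> \<longrightarrow> (\<exists>x\<in>fibre y. vdist I x c < r')"
    if "c \<in> C" for c
    using p[OF that] by (simp_all add: r_def L_def Q_def)
  have "\<forall>\<^sub>F s in at_right 0. \<forall>c\<in>C. s \<le> r c"
  proof -
    have "\<forall>\<^sub>F s in at_right 0. s \<le> r c" if "c \<in> C" for c
      unfolding eventually_at_right_field using r_pos[OF that] by (intro exI[of _ "r c"]) auto
    then show ?thesis using C(1) by (simp add: eventually_ball_finite_distrib)
  qed
  moreover have "\<forall>\<^sub>F s in at_right 0. \<forall>c\<in>C. \<forall>c'\<in>C. c \<noteq> c' \<longrightarrow> 2 * s \<le> vdist I c c'"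
  proof -
    have "\<forall>\<^sub>F s in at_right 0. c \<noteq> c' \<longrightarrow> 2 * s \<le> vdist I c c'" if "c \<in> C" "c' \<in> C" for c c'
    proof (cases "c = c'")
      case False
      then have "vdist I c c' > 0" using fibre_eqI[of c c'] fibreD(1) C(2) that by (meson not_le subsetD)
      then show ?thesis unfolding eventually_at_right_field by (intro exI[of _ "vdist I c c' / 2"]) auto
    qed auto
    then show ?thesis using C(1) by (auto simp: eventually_ball_finite_distrib)
  qed
  moreover have "\<forall>\<^sub>F s::real in at_right 0. s > 0" by (rule eventually_at_right_less)
  ultimately have "\<forall>\<^sub>F s in at_right 0. (\<forall>c\<in>C. s \<le> r c) \<and> (\<forall>c\<in>C. \<forall>c'\<in>C. c \<noteq> c' \<longrightarrow> 2 * s \<le> vdist I c c') \<and> s > 0"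
    by (intro eventually_conj)
  then have "\<exists>s. (\<forall>c\<in>C. s \<le> r c) \<and> (\<forall>c\<in>C. \<forall>c'\<in>C. c \<noteq> c' \<longrightarrow> 2 * s \<le> vdist I c c') \<and> s > 0"
    by (rule eventually_happens'[OF trivial_limit_at_right_real])
  then obtain s where "s > 0" and s2: "\<forall>c\<in>C. s \<le> r c"
    and s3: "\<forall>c\<in>C. \<forall>c'\<in>C. c \<noteq> c' \<longrightarrow> 2 * s \<le> vdist I c c'" by (elim exE conjE)
  note s = \<open>s > 0\<close> s2[rule_format] s3[rule_format]
  have "\<forall>c\<in>C. \<exists>\<eta>>0. \<forall>y. vdist I y v < \<eta> \<longrightarrow> (\<exists>x\<in>fibre y. vdist I x c < s)"
    using sur0 s(1,2) by blast
  from bchoice[OF this] obtain \<eta> where \<eta>: "\<And>c. c \<in> C \<Longrightarrow> \<eta> c > 0" "\<And>c y. c \<in> C \<Longrightarrow> vdist I y v < \<eta> c \<Longrightarrow> \<exists>x\<in>fibre y. vdist I x c < s"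
    by blast
  define \<eta>0 where "\<eta>0 = Min (insert 1 (\<eta> ` C))"
  have \<eta>0: "\<eta>0 > 0" "\<And>c. c \<in> C \<Longrightarrow> \<eta>0 \<le> \<eta> c" using \<eta>(1) C(1) by (auto simp: \<eta>0_def)
  define L0 where "L0 = Max (insert 1 (L ` C))"
  have L0: "L0 > 0" "\<And>c. c \<in> C \<Longrightarrow> L c \<le> L0" using C(1) by (auto simp: L0_def Max_gr_iff)
  have lip: "vdist I x' x \<le> L0 * vdist I (F x') (F x)" if "c \<in> C" "vdist I x c < s" "vdist I x' c < s" for c x x'
  proof -
    have "vdist I x' x \<le> L c * vdist I (F x') (F x)" using lip0[OF that(1)] s(2)[OF that(1)] that(2,3) by (meson less_le_trans)
    also have "\<dots> \<le> L0 * vdist I (F x') (F x)" using L0 that by (intro mult_right_mono) auto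
    finally show ?thesis .
  qed
  have Ffib: "vdist I (F x) (F x') = vdist I y y'" if "x \<in> fibre y" "x' \<in> fibre y'" for x x' y y'
    by (rule vdist_cong) (use that in \<open>auto simp: fibreD\<close>)
  define \<sigma> where "\<sigma> c y = (SOME x. x \<in> fibre y \<and> vdist I x c < s)" for c y
  have \<sigma>: "\<sigma> c y \<in> fibre y \<and> vdist I (\<sigma> c y) c < s" if "c \<in> C" "vdist I y v < \<eta>0" for c y
  proof -
    have "\<exists>x. x \<in> fibre y \<and> vdist I x c < s" using \<eta>(2)[OF that(1), of y] \<eta>0(2)[OF that(1)] that(2) by auto
    then show ?thesis unfolding \<sigma>_def by (rule someI_ex)
  qed
  have uniq: "x = \<sigma> c y" if "c \<in> C" "vdist I y v < \<eta>0" "x \<in> fibre y" "vdist I x c < s" for c x y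
  proof -
    have "vdist I x (\<sigma> c y) \<le> L0 * vdist I (F x) (F (\<sigma> c y))" using lip \<sigma> that by blast
    also have "\<dots> = 0" using Ffib[OF that(3), of "\<sigma> c y" y] \<sigma>[OF that(1,2)] by simp
    finally show ?thesis using fibre_eqI fibreD \<sigma> that by metis
  qed
  have lip\<sigma>: "vdist I (\<sigma> c y) (\<sigma> c y') \<le> L0 * vdist I y y'" if "c \<in> C" "vdist I y v < \<eta>0" "vdist I y' v < \<eta>0" for c y y'
    using lip[OF that(1), of "\<sigma> c y'" "\<sigma> c y"] \<sigma>[OF that(1,2)] \<sigma>[OF that(1,3)] Ffib by metis
  have "\<sigma> c v = c" if "c \<in> C" for c
    using uniq[OF that, of v c] C(2) that \<eta>0 s(1) by auto
  moreover have "inj_on (\<lambda>c. \<sigma> c y) C" if "vdist I y v < \<eta>0" for y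
  proof (rule inj_onI, rule ccontr)
    fix c c' assume c: "c \<in> C" "c' \<in> C" "\<sigma> c y = \<sigma> c' y" "c \<noteq> c'"
    have "vdist I c c' \<le> vdist I c (\<sigma> c y) + vdist I (\<sigma> c y) c'" by (rule vdist_triangle)
    also have "\<dots> < s + s" using \<sigma>[OF c(1) that] \<sigma>[OF c(2) that] c(3) by (intro add_strict_mono) (auto simp: vdist_commute)
    finally show False using s(3)[OF c(1,2,4)] by simp
  qed
  ultimately show ?thesis by (intro that[OF s(1) L0(1) \<eta>0(1)]) (use \<sigma> uniq lip\<sigma> in blast)+
qed

text \<open>Let \<open>g c\<close> be \<open>1\<close> at \<open>c\<close> and \<open>0\<close> at the other points of \<open>C\<close>.  If the number of products of \<open>g c\<close> with monomials of degree
at most \<open>T\<close> in \<open>F\<close> exceeded the dimension of the space in which they lie, then some relation \<open>\<Sum> A c (F x) * g c x = 0\<close>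
would hold.  On the fibre over a \<open>y\<close> near \<open>v\<close> the matrix of values of the \<open>g c\<close> is close to the identity, so all \<open>A c\<close> vanish near \<open>v\<close>, hence
identically.\<close>
lemma card_subset_fibre_le:
  assumes C: "finite C" "C \<subseteq> fibre v" and v: "\<Delta> v \<noteq> 0"
  shows "card C \<le> d ^ card I"
proof (rule ccontr)
  assume "\<not> card C \<le> d ^ card I"
  then have "real (d ^ card I) < real (card C)" unfolding of_nat_less_iff by simp
  then have big: "real d ^ card I < real (card C)" unfolding of_nat_power .
  define k where "k = card C"
  have "\<forall>\<^sub>F T in sequentially. real ((d * T + k + card I) choose card I) / real ((T + 0 + card I) choose card I) < real k"
    using choose_ratio_tendsto[of d k "card I" 0] big unfolding k_def by (intro order_tendstoD(2))
  then obtain T where "real ((d * T + k + card I) choose card I) / real ((T + card I) choose card I) < real k"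
    by (auto simp: eventually_sequentially)
  moreover have "real ((T + card I) choose card I) > 0" by simp
  ultimately have "real (card (exponents I (d * T + k))) < real (k * card (exponents I T))"
    by (simp add: card_exponents finite_I divide_less_eq del: of_nat_add)
  then have card: "card (exponents I (d * T + k)) < card (C \<times> exponents I T)"
    by (simp add: card_cartesian_product k_def del: of_nat_mult)
  have CE: "C \<subseteq> I \<rightarrow>\<^sub>E UNIV" using C(2) fibreD by blast
  have "\<forall>c\<in>C. \<exists>g. poly_fn I k g \<and> g c = 1 \<and> (\<forall>c'\<in>C - {c}. g c' = 0)"
    using separating_poly_fn[OF finite_I C(1) CE] by (simp add: k_def)
  from bchoice[OF this] obtain g where "\<forall>c\<in>C. poly_fn I k (g c) \<and> g c c = 1 \<and> (\<forall>c'\<in>C - {c}. g c c' = 0)"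
    by (elim exE)
  then have g: "\<And>c. c \<in> C \<Longrightarrow> poly_fn I k (g c)" "\<And>c c'. c \<in> C \<Longrightarrow> c' \<in> C \<Longrightarrow> g c c' = (if c' = c then 1 else 0)"
    by auto
  have "\<forall>p\<in>C \<times> exponents I T. \<exists>a. \<forall>x. monomial I (snd p) (F x) * g (fst p) x = (\<Sum>\<beta>\<in>exponents I (d * T + k). a \<beta> * monomial I \<beta> x)"
  proof
    fix p assume "p \<in> C \<times> exponents I T"
    then have "poly_fn I (d * T + k) (\<lambda>x. monomial I (snd p) (F x) * g (fst p) x)"
      by (intro poly_fn_mult finite_I poly_fn_compose[OF finite_I finite_I poly_F] poly_fn_monomial g) auto
    then show "\<exists>a. \<forall>x. monomial I (snd p) (F x) * g (fst p) x = (\<Sum>\<beta>\<in>exponents I (d * T + k). a \<beta> * monomial I \<beta> x)"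
      by (simp add: poly_fn_def)
  qed
  from bchoice[OF this] obtain M where M: "\<And>p x. p \<in> C \<times> exponents I T \<Longrightarrow>
      monomial I (snd p) (F x) * g (fst p) x = (\<Sum>\<beta>\<in>exponents I (d * T + k). M p \<beta> * monomial I \<beta> x)"
    by blast
  obtain a where a: "\<exists>p\<in>C \<times> exponents I T. a p \<noteq> 0"
      "\<And>\<beta>. \<beta> \<in> exponents I (d * T + k) \<Longrightarrow> (\<Sum>p\<in>C \<times> exponents I T. M p \<beta> * a p) = 0"
    using homogeneous_system_nontrivial_solution[of "exponents I (d * T + k)" "C \<times> exponents I T" "\<lambda>\<beta> p. M p \<beta>"]
      card C(1) finite_I by (auto simp: finite_exponents)
  define A where "A c y = (\<Sum>\<alpha>\<in>exponents I T. a (c, \<alpha>) * monomial I \<alpha> y)" for c y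
  have rel: "(\<Sum>c\<in>C. A c (F x) * g c x) = 0" for x
  proof -
    have "(\<Sum>c\<in>C. A c (F x) * g c x) = (\<Sum>p\<in>C \<times> exponents I T. a p * (monomial I (snd p) (F x) * g (fst p) x))"
      by (simp add: A_def sum_distrib_right sum.cartesian_product mult.assoc case_prod_unfold)
    also have "\<dots> = (\<Sum>p\<in>C \<times> exponents I T. \<Sum>\<beta>\<in>exponents I (d * T + k). M p \<beta> * a p * monomial I \<beta> x)"
    proof (rule sum.cong)
      fix p assume p: "p \<in> C \<times> exponents I T"
      show "a p * (monomial I (snd p) (F x) * g (fst p) x) = (\<Sum>\<beta>\<in>exponents I (d * T + k). M p \<beta> * a p * monomial I \<beta> x)"
        unfolding M[OF p] sum_distrib_left by (rule sum.cong) (simp_all only: mult_ac)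
    qed (rule refl)
    also have "\<dots> = (\<Sum>\<beta>\<in>exponents I (d * T + k). (\<Sum>p\<in>C \<times> exponents I T. M p \<beta> * a p) * monomial I \<beta> x)"
      by (subst sum.swap) (simp add: sum_distrib_right)
    also have "\<dots> = 0" by (simp add: a)
    finally show ?thesis .
  qed
  obtain r L \<eta> \<sigma> where \<sigma>0: "r > 0" "L > 0" "\<eta> > 0"
    "\<And>c y. c \<in> C \<Longrightarrow> vdist I y v < \<eta> \<Longrightarrow> \<sigma> c y \<in> fibre y"
    "\<And>c y x. c \<in> C \<Longrightarrow> vdist I y v < \<eta> \<Longrightarrow> x \<in> fibre y \<Longrightarrow> vdist I x c < r \<Longrightarrow> x = \<sigma> c y"
    "\<And>c y y'. c \<in> C \<Longrightarrow> vdist I y v < \<eta> \<Longrightarrow> vdist I y' v < \<eta> \<Longrightarrow> vdist I (\<sigma> c y) (\<sigma> c y') \<le> L * vdist I y y'"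
    "\<And>c. c \<in> C \<Longrightarrow> \<sigma> c v = c"
    "\<And>y. vdist I y v < \<eta> \<Longrightarrow> inj_on (\<lambda>c. \<sigma> c y) C"
    by (fact branches[OF C v])
  note \<sigma> = \<sigma>0(3,2,4,6,7)
  define \<epsilon> where "\<epsilon> = 1 / (2 * (real k + 1))"
  have \<epsilon>: "\<epsilon> > 0" "real k * \<epsilon> \<le> 1/2" by (auto simp: \<epsilon>_def field_simps)
  have "\<forall>q\<in>C \<times> C. \<exists>\<theta>. \<theta> > 0 \<and> (\<forall>x. vdist I x (snd q) < \<theta> \<longrightarrow> norm (g (fst q) x - g (fst q) (snd q)) < \<epsilon>)"
    using poly_fn_continuous[OF finite_I g(1) \<epsilon>(1)] by auto
  from bchoice[OF this] obtain \<theta> where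
    "\<forall>q\<in>C \<times> C. \<theta> q > 0 \<and> (\<forall>x. vdist I x (snd q) < \<theta> q \<longrightarrow> norm (g (fst q) x - g (fst q) (snd q)) < \<epsilon>)"
    by (elim exE)
  then have \<theta>: "\<And>q. q \<in> C \<times> C \<Longrightarrow> \<theta> q > 0"
    "\<And>q x. q \<in> C \<times> C \<Longrightarrow> vdist I x (snd q) < \<theta> q \<Longrightarrow> norm (g (fst q) x - g (fst q) (snd q)) < \<epsilon>"
    by auto
  define \<theta>0 where "\<theta>0 = Min (insert 1 (\<theta> ` (C \<times> C)))"
  have \<theta>0: "\<theta>0 > 0" "\<And>q. q \<in> C \<times> C \<Longrightarrow> \<theta>0 \<le> \<theta> q" using \<theta>(1) C(1) by (auto simp: \<theta>0_def)
  define \<rho> where "\<rho> = min \<eta> (\<theta>0 / L)"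
  have \<rho>: "\<rho> > 0" using \<sigma>(1,2) \<theta>0 by (simp add: \<rho>_def)
  have zero: "A c y = 0" if c: "c \<in> C" and y: "vdist I y v < \<rho>" for c y
  proof -
    have y\<eta>: "vdist I y v < \<eta>" using y by (simp add: \<rho>_def)
    \<comment> \<open>Diagonal dominance: look at the relation on the branch that belongs to a largest coefficient.\<close>
    define m where "m = Max ((\<lambda>c. norm (A c y)) ` C)"
    have "m \<in> (\<lambda>c. norm (A c y)) ` C" unfolding m_def using C(1) c by (intro Max_in) auto
    then obtain c0 where c0: "c0 \<in> C" "m = norm (A c0 y)" by auto
    have m: "norm (A c y) \<le> m" if "c \<in> C" for c unfolding m_def using C(1) that by auto
    let ?x = "\<sigma> c0 y"
    have near: "norm (g c ?x - g c c0) < \<epsilon>" if "c \<in> C" for c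
    proof -
      have "vdist I ?x c0 \<le> L * vdist I y v"
        using \<sigma>(4)[OF c0(1) y\<eta>, of v] \<sigma>(5)[OF c0(1)] \<sigma>(1) by simp
      also have "\<dots> < L * (\<theta>0 / L)" using y \<sigma>(2) by (intro mult_strict_left_mono) (auto simp: \<rho>_def)
      also have "\<dots> = \<theta>0" using \<sigma>(2) by simp
      finally show ?thesis using \<theta>(2)[of "(c, c0)" ?x] \<theta>0(2)[of "(c, c0)"] that c0(1) by simp
    qed
    have Fx: "A c (F ?x) = A c y" for c
      unfolding A_def monomial_def using \<sigma>(3)[OF c0(1) y\<eta>] by (auto simp: fibreD intro!: sum.cong prod.cong)
    have "(\<Sum>c\<in>C. A c y * (g c ?x - g c c0)) = (\<Sum>c\<in>C. A c (F ?x) * g c ?x) - (\<Sum>c\<in>C. A c y * g c c0)"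
      by (simp add: Fx right_diff_distrib sum_subtractf)
    also have "\<dots> = - A c0 y"
      using rel[of ?x] c0(1) C(1) by (simp add: g if_distrib cong: if_cong)
    finally have "m = norm (\<Sum>c\<in>C. A c y * (g c ?x - g c c0))" using c0(2) by simp
    also have "\<dots> \<le> (\<Sum>c\<in>C. m * \<epsilon>)"
    proof (rule sum_norm_le)
      fix c assume "c \<in> C"
      then show "norm (A c y * (g c ?x - g c c0)) \<le> m * \<epsilon>"
        unfolding norm_mult using m near c0(2) by (intro mult_mono less_imp_le[OF near]) auto
    qed
    also have "\<dots> = (real k * \<epsilon>) * m" by (simp add: k_def)
    also have "\<dots> \<le> 1/2 * m" using \<epsilon>(2) c0(2) by (intro mult_right_mono) auto
    finally have "m \<le> 0" by simp
    then have "norm (A c y) \<le> 0" by (rule order_trans[OF m[OF c]])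
    then show ?thesis by simp
  qed
  have "a (c, \<alpha>) = 0" if c: "c \<in> C" and \<alpha>: "\<alpha> \<in> exponents I T" for c \<alpha>
  proof (rule monomials_independent[OF finite_I _ _ \<alpha>, of "\<rho> / (real (card I) + 1)" v "\<lambda>\<alpha>. a (c, \<alpha>)"])
    show "\<rho> / (real (card I) + 1) > 0" using \<rho> by simp
    fix x assume x: "\<And>i. i \<in> I \<Longrightarrow> norm (x i - v i) < \<rho> / (real (card I) + 1)"
    have "vdist I x v \<le> real (card I) * (\<rho> / (real (card I) + 1))"
      unfolding vdist_def by (rule sum_bounded_above) (use x in \<open>auto intro: less_imp_le\<close>)
    also have "\<dots> < \<rho>" using \<rho> by (simp add: field_simps)
    finally show "(\<Sum>\<alpha>\<in>exponents I T. a (c, \<alpha>) * monomial I \<alpha> x) = 0"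
      using zero[OF c] by (simp add: A_def)
  qed
  then show False using a(1) by auto
qed

lemma finite_fibre:
  assumes v: "\<Delta> v \<noteq> 0" shows "finite (fibre v)"
  by (rule finite_if_finite_subsets_card_bdd[THEN conjunct1]) (rule card_subset_fibre_le[OF _ _ v])

lemma card_fibre_le: "\<Delta> v \<noteq> 0 \<Longrightarrow> card (fibre v) \<le> d ^ card I"
  using card_subset_fibre_le[OF finite_fibre] by blast

lemma proper_bound:
  obtains K where "K > 0" "\<And>x y. x \<in> fibre y \<Longrightarrow> nrm I x ^ d \<le> K * nrm I y"
proof -
  obtain K where K: "\<And>x. nrm I x ^ d \<le> K * nrm I (F x)" using proper by blast
  have "nrm I x ^ d \<le> (\<bar>K\<bar> + 1) * nrm I y" if "x \<in> fibre y" for x y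
  proof -
    have "nrm I (F x) = nrm I y" unfolding nrm_def by (rule sum.cong) (use that fibreD in auto)
    then have "nrm I x ^ d \<le> K * nrm I y" using K[of x] by simp
    also have "\<dots> \<le> (\<bar>K\<bar> + 1) * nrm I y" by (intro mult_right_mono) auto
    finally show ?thesis .
  qed
  then show ?thesis using that[of "\<bar>K\<bar> + 1"] by auto
qed

lemma continuous_on_F:
  assumes "j \<in> I" shows "continuous_on S (\<lambda>x. F x j)"
  using poly_fn_continuous_on[OF finite_I poly_F[OF assms]] .

text \<open>Compactness: a sequence of points of nearby fibres that stays away from the fibre over \<open>v\<close> would have a limit in this fibre.\<close>
lemma fibre_near:
  assumes v: "\<Delta> v \<noteq> 0" and r: "r > 0"
  shows "\<exists>\<eta>>0. \<forall>y. vdist I y v < \<eta> \<longrightarrow> (\<forall>x\<in>fibre y. \<exists>c\<in>fibre v. vdist I x c < r)"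
proof -
  obtain K where K: "K > 0" "\<And>x y. x \<in> fibre y \<Longrightarrow> nrm I x ^ d \<le> K * nrm I y" by (rule proper_bound) blast
  define R where "R = 1 + K * (nrm I v + 1)"
  have R: "R \<ge> 1" using K(1) by (simp add: R_def)
  have bound: "nrm I x \<le> R" if "x \<in> fibre y" "vdist I y v < 1" for x y
  proof (rule ccontr)
    assume "\<not> nrm I x \<le> R"
    then have "R < nrm I x" by simp
    also have "\<dots> \<le> nrm I x ^ d" using \<open>R < nrm I x\<close> R d_pos by (intro self_le_power) auto
    also have "\<dots> \<le> K * nrm I y" by (rule K(2)[OF that(1)])
    also have "\<dots> \<le> K * (nrm I v + 1)" using nrm_le_vdist[of I y v] that K(1) by (intro mult_left_mono) auto
    finally show False by (simp add: R_def)
  qed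
  define S where "S = (I \<rightarrow>\<^sub>E cball 0 R) \<inter> (\<Inter>c\<in>fibre v. {x. r \<le> vdist I x c})"
  have "closed {x. r \<le> vdist I x c}" for c
    by (intro closed_Collect_le continuous_on_const continuous_on_vdist
        continuous_on_subset[OF continuous_on_product_coordinates]) auto
  then have S: "compact S" unfolding S_def
    by (intro compact_Int_closed compact_PiE_cball closed_INT) auto
  have cont: "continuous_on S (\<lambda>x. vdist I (F x) v)" by (intro continuous_on_vdist continuous_on_F)
  have "\<exists>\<mu>>0. \<forall>x\<in>S. \<mu> \<le> vdist I (F x) v"
  proof (cases "S = {}")
    case False
    then obtain x0 where x0: "x0 \<in> S" "\<And>x. x \<in> S \<Longrightarrow> vdist I (F x0) v \<le> vdist I (F x) v"
      using continuous_attains_inf[OF S _ cont] by blast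
    have "vdist I (F x0) v \<noteq> 0"
    proof
      assume "vdist I (F x0) v = 0"
      then have "x0 \<in> fibre v" using x0(1) by (auto simp: fibre_def S_def vdist_eq_0[OF finite_I])
      then show False using x0(1) r by (auto simp: S_def)
    qed
    then show ?thesis using x0(2) vdist_nonneg[of I "F x0" v] by (metis less_eq_real_def)
  qed (auto intro: exI[of _ 1])
  then obtain \<mu> where \<mu>: "\<mu> > 0" "\<And>x. x \<in> S \<Longrightarrow> \<mu> \<le> vdist I (F x) v" by blast
  have "\<exists>c\<in>fibre v. vdist I x c < r" if y: "vdist I y v < min 1 \<mu>" and x: "x \<in> fibre y" for x y
  proof (rule ccontr)
    assume *: "\<not> (\<exists>c\<in>fibre v. vdist I x c < r)"
    have "norm (x i) \<le> R" if "i \<in> I" for i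
      using norm_le_nrm[OF finite_I that, of x] bound[OF x] y by simp
    then have "x \<in> S" using * fibreD(1)[OF x] by (auto simp: S_def PiE_iff not_less)
    moreover have "vdist I (F x) v = vdist I y v" by (rule vdist_cong) (use x fibreD in auto)
    ultimately show False using \<mu>(2)[of x] y by simp
  qed
  then show ?thesis using \<mu>(1) by (intro exI[of _ "min 1 \<mu>"]) auto
qed

theorem fibre_branches:
  assumes v: "\<Delta> v \<noteq> 0"
  obtains \<eta> L \<sigma> where "\<eta> > 0" "L > 0"
    "\<And>y. vdist I y v < \<eta> \<Longrightarrow> fibre y = (\<lambda>c. \<sigma> c y) ` fibre v"
    "\<And>y. vdist I y v < \<eta> \<Longrightarrow> inj_on (\<lambda>c. \<sigma> c y) (fibre v)"
    "\<And>c y y'. c \<in> fibre v \<Longrightarrow> vdist I y v < \<eta> \<Longrightarrow> vdist I y' v < \<eta> \<Longrightarrow> vdist I (\<sigma> c y) (\<sigma> c y') \<le> L * vdist I y y'"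
    "\<And>c. c \<in> fibre v \<Longrightarrow> \<sigma> c v = c"
proof -
  obtain r L \<eta> \<sigma> where \<sigma>0: "r > 0" "L > 0" "\<eta> > 0"
    "\<And>c y. c \<in> fibre v \<Longrightarrow> vdist I y v < \<eta> \<Longrightarrow> \<sigma> c y \<in> fibre y"
    "\<And>c y x. c \<in> fibre v \<Longrightarrow> vdist I y v < \<eta> \<Longrightarrow> x \<in> fibre y \<Longrightarrow> vdist I x c < r \<Longrightarrow> x = \<sigma> c y"
    "\<And>c y y'. c \<in> fibre v \<Longrightarrow> vdist I y v < \<eta> \<Longrightarrow> vdist I y' v < \<eta> \<Longrightarrow> vdist I (\<sigma> c y) (\<sigma> c y') \<le> L * vdist I y y'"
    "\<And>c. c \<in> fibre v \<Longrightarrow> \<sigma> c v = c"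
    "\<And>y. vdist I y v < \<eta> \<Longrightarrow> inj_on (\<lambda>c. \<sigma> c y) (fibre v)"
    by (fact branches[OF finite_fibre[OF v] order_refl v])
  note r = \<sigma>0(1) and L = \<sigma>0(2) and \<eta> = \<sigma>0(3) and \<sigma> = \<sigma>0(4-8)
  obtain \<eta>' where \<eta>': "\<eta>' > 0" "\<And>y x. vdist I y v < \<eta>' \<Longrightarrow> x \<in> fibre y \<Longrightarrow> \<exists>c\<in>fibre v. vdist I x c < r"
    using fibre_near[OF v r] by blast
  have "fibre y = (\<lambda>c. \<sigma> c y) ` fibre v" if y: "vdist I y v < min \<eta> \<eta>'" for y
  proof
    have yy: "vdist I y v < \<eta>" "vdist I y v < \<eta>'" using y by auto
    show "fibre y \<subseteq> (\<lambda>c. \<sigma> c y) ` fibre v"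
    proof
      fix x assume x: "x \<in> fibre y"
      obtain c where c: "c \<in> fibre v" "vdist I x c < r" using \<eta>'(2)[OF yy(2) x] by (elim bexE)
      have "x = \<sigma> c y" by (rule \<sigma>(2)[OF c(1) yy(1) x c(2)])
      then show "x \<in> (\<lambda>c. \<sigma> c y) ` fibre v"
        using imageI[of c "fibre v" "\<lambda>c. \<sigma> c y", OF c(1)] by (simp only:)
    qed
    show "(\<lambda>c. \<sigma> c y) ` fibre v \<subseteq> fibre y" using \<sigma>(1)[OF _ yy(1)] by blast
  qed
  note fib = this
  show ?thesis
  proof (rule that[of "min \<eta> \<eta>'" L \<sigma>])
    show "min \<eta> \<eta>' > 0" using \<eta> \<eta>'(1) by simp
    show "L > 0" by (rule L)
    show "fibre y = (\<lambda>c. \<sigma> c y) ` fibre v" if "vdist I y v < min \<eta> \<eta>'" for y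
      by (rule fib[OF that])
    show "inj_on (\<lambda>c. \<sigma> c y) (fibre v)" if "vdist I y v < min \<eta> \<eta>'" for y
      by (rule \<sigma>(5)) (use that in simp)
    show "vdist I (\<sigma> c y) (\<sigma> c y') \<le> L * vdist I y y'"
      if "c \<in> fibre v" "vdist I y v < min \<eta> \<eta>'" "vdist I y' v < min \<eta> \<eta>'" for c y y'
      by (rule \<sigma>(3)) (use that in simp_all)
    show "\<sigma> c v = c" if "c \<in> fibre v" for c by (rule \<sigma>(4)[OF that])
  qed
qed

section \<open>Finite polynomial maps: the number of points of a fibre\<close>

text \<open>The strict estimate at \<open>c\<close> turns the equation \<open>F (s (y t)) = y t\<close> into \<open>s (y t) - c = B (y t - v) + o(t - t0)\<close>, because the
Lipschitz bound controls the error by \<open>|t - t0|\<close>.\<close>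
lemma branch_field_differentiable:
  assumes v: "\<Delta> v \<noteq> 0" and c: "c \<in> fibre v" and \<eta>: "\<eta> > 0"
    and fib: "\<And>y. vdist I y v < \<eta> \<Longrightarrow> s y \<in> fibre y"
    and lip: "\<And>y. vdist I y v < \<eta> \<Longrightarrow> vdist I (s y) c \<le> L * vdist I y v"
    and line: "\<And>i. i \<in> I \<Longrightarrow> y t0 i = v i" "\<And>t i. i \<in> I \<Longrightarrow> y t i = v i + (t - t0) * w i"
    and j: "j \<in> I"
  shows "(\<lambda>t. s (y t) j) field_differentiable at t0"
proof -
  have "\<Delta> (F c) \<noteq> 0" using v c disc_F_fibre by simp
  from regular[OF this] obtain B where B: "\<forall>\<epsilon>>0. \<exists>r>0. \<forall>x x'. vdist I x c < r \<longrightarrow> vdist I x' c < r \<longrightarrow>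
          (\<forall>j\<in>I. norm ((x' j - x j) - (\<Sum>i\<in>I. B j i * (F x' i - F x i))) \<le> \<epsilon> * vdist I x' x)"
    by (elim exE conjE)
  have ydist: "vdist I (y t) v = norm (t - t0) * nrm I w" for t
    unfolding vdist_def nrm_def sum_distrib_left by (rule sum.cong) (use line in \<open>auto simp: norm_mult\<close>)
  define W where "W = nrm I w"
  have W: "W \<ge> 0" by (simp add: W_def)
  define D where "D = (\<Sum>i\<in>I. B j i * w i)"
  have sc: "s (y t0) j = c j"
  proof -
    have "vdist I (y t0) v = 0" using ydist[of t0] by simp
    then have "vdist I (s (y t0)) c = 0" using lip[of "y t0"] \<eta> vdist_nonneg[of I "s (y t0)" c] by simp
    then show ?thesis using vdist_eq_0[OF finite_I] j by blast
  qed
  have "\<exists>e'>0. \<forall>t. norm (t - t0) < e' \<longrightarrow> norm (s (y t) j - s (y t0) j - D * (t - t0)) \<le> e * norm (t - t0)"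
    if e: "e > 0" for e
  proof -
    define L' where "L' = \<bar>L\<bar> + 1"
    have L': "L' > 0" "L \<le> L'" by (auto simp: L'_def)
    define \<epsilon> where "\<epsilon> = e / (L' * (W + 1))"
    have \<epsilon>: "\<epsilon> > 0" using e L' W by (simp add: \<epsilon>_def)
    obtain r where r: "r > 0" "\<And>x'. vdist I x' c < r \<Longrightarrow>
        norm ((x' j - c j) - (\<Sum>i\<in>I. B j i * (F x' i - F c i))) \<le> \<epsilon> * vdist I x' c"
    proof -
      obtain r where "r > 0" and 1: "\<forall>x x'. vdist I x c < r \<longrightarrow> vdist I x' c < r \<longrightarrow>
          (\<forall>j\<in>I. norm ((x' j - x j) - (\<Sum>i\<in>I. B j i * (F x' i - F x i))) \<le> \<epsilon> * vdist I x' x)"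
        using B[rule_format, OF \<epsilon>] by (elim exE conjE)
      show thesis using 1[rule_format, of c _ j] j \<open>r > 0\<close> by (intro that[of r]) simp_all
    qed
    define e' where "e' = min \<eta> (r / L') / (W + 1)"
    have e': "e' > 0" using \<eta> r(1) L' W by (simp add: e'_def)
    have "norm (s (y t) j - s (y t0) j - D * (t - t0)) \<le> e * norm (t - t0)" if t: "norm (t - t0) < e'" for t
    proof -
      have "vdist I (y t) v \<le> norm (t - t0) * (W + 1)"
        unfolding ydist W_def by (intro mult_left_mono) auto
      also have "\<dots> < e' * (W + 1)" using t W by (intro mult_strict_right_mono) auto
      also have "\<dots> = min \<eta> (r / L')" using W by (simp add: e'_def)
      finally have y: "vdist I (y t) v < \<eta>" "vdist I (y t) v < r / L'" by auto
      have lip': "vdist I (s (y t)) c \<le> L' * vdist I (y t) v"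
        by (rule order_trans[OF lip[OF y(1)]]) (rule mult_right_mono, use L' in auto)
      also have "\<dots> < L' * (r / L')" using y(2) L' by (intro mult_strict_left_mono) auto
      finally have "vdist I (s (y t)) c < r" using L' by simp
      then have "norm ((s (y t) j - c j) - (\<Sum>i\<in>I. B j i * (F (s (y t)) i - F c i))) \<le> \<epsilon> * vdist I (s (y t)) c"
        by (rule r)
      also have "\<dots> \<le> \<epsilon> * (L' * (norm (t - t0) * W))"
        using lip' \<epsilon> unfolding ydist W_def[symmetric] by (intro mult_left_mono) auto
      also have "\<dots> \<le> \<epsilon> * (L' * (norm (t - t0) * (W + 1)))"
        using \<epsilon> L' by (intro mult_left_mono) auto
      also have "\<dots> = e * norm (t - t0)" using L' W by (simp add: \<epsilon>_def)
      finally have "norm ((s (y t) j - c j) - (\<Sum>i\<in>I. B j i * (F (s (y t)) i - F c i))) \<le> e * norm (t - t0)" .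
      moreover have "(\<Sum>i\<in>I. B j i * (F (s (y t)) i - F c i)) = D * (t - t0)"
        unfolding D_def sum_distrib_right
      proof (rule sum.cong)
        fix i assume i: "i \<in> I"
        have "F (s (y t)) i - F c i = y t i - v i" using fibreD(2)[OF fib[OF y(1)] i] fibreD(2)[OF c i] by simp
        then show "B j i * (F (s (y t)) i - F c i) = B j i * w i * (t - t0)" using line(2)[OF i, of t] by simp
      qed simp
      ultimately show ?thesis using sc by simp
    qed
    with e' show ?thesis by blast
  qed
  then have "((\<lambda>t. s (y t) j) has_field_derivative D) (at t0)"
    unfolding has_field_derivative_def has_derivative_at_alt by (auto intro: bounded_linear_mult_right)
  then show ?thesis by (auto simp: field_differentiable_def)
qed

definition fibre_sum :: "(('i \<Rightarrow> complex) \<Rightarrow> complex) \<Rightarrow> ('i \<Rightarrow> complex) \<Rightarrow> complex" where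
  "fibre_sum u y = (\<Sum>x\<in>fibre y. u x)"

lemma fibre_sum_field_differentiable:
  assumes u: "poly_fn I N u" and t0: "\<Delta> (\<lambda>i. a i + t0 * w i) \<noteq> 0"
  shows "(\<lambda>t. fibre_sum u (\<lambda>i. a i + t * w i)) field_differentiable at t0"
proof -
  define y where "y t = (\<lambda>i. a i + t * w i)" for t
  define v where "v = y t0"
  have v: "\<Delta> v \<noteq> 0" using t0 by (simp add: v_def y_def)
  have yv: "y t i = v i + (t - t0) * w i" for t i by (simp add: y_def v_def algebra_simps)
  show ?thesis
  proof (rule fibre_branches[OF v])
    fix \<eta> L \<sigma>
    assume \<eta>: "\<eta> > 0" "L > 0"
      and fib: "\<And>y. vdist I y v < \<eta> \<Longrightarrow> fibre y = (\<lambda>c. \<sigma> c y) ` fibre v"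
      and inj: "\<And>y. vdist I y v < \<eta> \<Longrightarrow> inj_on (\<lambda>c. \<sigma> c y) (fibre v)"
      and lip: "\<And>c y y'. c \<in> fibre v \<Longrightarrow> vdist I y v < \<eta> \<Longrightarrow> vdist I y' v < \<eta> \<Longrightarrow> vdist I (\<sigma> c y) (\<sigma> c y') \<le> L * vdist I y y'"
      and base: "\<And>c. c \<in> fibre v \<Longrightarrow> \<sigma> c v = c"
    have comp: "(\<lambda>t. u (\<sigma> c (y t))) field_differentiable at t0" if c: "c \<in> fibre v" for c
    proof (rule poly_fn_field_differentiable[OF finite_I u])
      fix j assume j: "j \<in> I"
      show "(\<lambda>t. \<sigma> c (y t) j) field_differentiable at t0"
      proof (rule branch_field_differentiable[OF v c \<eta>(1), where L = L and w = w and s = "\<sigma> c" and y = y and j = j])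
        show "\<sigma> c y \<in> fibre y" if "vdist I y v < \<eta>" for y
          unfolding fib[OF that] by (rule imageI[OF c])
        show "vdist I (\<sigma> c y) c \<le> L * vdist I y v" if "vdist I y v < \<eta>" for y
          using lip[OF c that, of v] base[OF c] \<eta>(1) by simp
        show "y t0 i = v i" for i by (simp add: v_def)
        show "y t i = v i + (t - t0) * w i" for t i by (rule yv)
        show "j \<in> I" by (rule j)
      qed
    qed
    have "(\<lambda>t. \<Sum>c\<in>fibre v. u (\<sigma> c (y t))) field_differentiable at t0"
      by (intro field_differentiable_sum comp)
    moreover have "\<exists>e>0. \<forall>t. dist t t0 < e \<longrightarrow> vdist I (y t) v < \<eta>"
    proof (intro exI[of _ "\<eta> / (nrm I w + 1)"] conjI allI impI)
      show "\<eta> / (nrm I w + 1) > 0" using \<eta> by (simp add: add_nonneg_pos)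
      fix t assume t: "dist t t0 < \<eta> / (nrm I w + 1)"
      have "vdist I (y t) v = norm (t - t0) * nrm I w"
        by (simp add: vdist_def nrm_def yv norm_mult sum_distrib_left)
      also have "\<dots> \<le> norm (t - t0) * (nrm I w + 1)" by (intro mult_left_mono) auto
      also have "\<dots> < \<eta> / (nrm I w + 1) * (nrm I w + 1)"
        using t by (intro mult_strict_right_mono) (auto simp: dist_norm add_nonneg_pos)
      also have "\<dots> = \<eta>" using nrm_nonneg[of I w] by (simp add: add_nonneg_eq_0_iff)
      finally show "vdist I (y t) v < \<eta>" .
    qed
    then obtain e where e: "e > 0" "\<And>t. dist t t0 < e \<Longrightarrow> vdist I (y t) v < \<eta>" by blast
    have "fibre_sum u (y t) = (\<Sum>c\<in>fibre v. u (\<sigma> c (y t)))" if "dist t t0 < e" for t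
      unfolding fibre_sum_def fib[OF e(2)[OF that]] using inj[OF e(2)[OF that]] by (simp add: sum.reindex)
    ultimately show ?thesis
      using field_differentiable_transform_within[OF e(1), of t0 UNIV "\<lambda>t. \<Sum>c\<in>fibre v. u (\<sigma> c (y t))" "\<lambda>t. fibre_sum u (y t)"]
      unfolding y_def by auto
  qed
qed

text \<open>Properness bounds \<open>|x|\<^sup>d\<close> by a multiple of \<open>|y|\<close> for \<open>x\<close> in the fibre over \<open>y\<close>, so the degree is divided by \<open>d\<close> on passing to the sum.\<close>
lemma fibre_sum_growth:
  assumes u: "poly_fn I (d * q) u"
  obtains K where "K \<ge> 0" "\<And>y. \<Delta> y \<noteq> 0 \<Longrightarrow> norm (fibre_sum u y) \<le> K * (1 + nrm I y) ^ q"
proof -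
  obtain A where A: "A \<ge> 0" "\<And>x. norm (u x) \<le> A * (1 + nrm I x) ^ (d * q)"
    using poly_fn_growth[OF finite_I u] by blast
  obtain K where K: "K > 0" "\<And>x y. x \<in> fibre y \<Longrightarrow> nrm I x ^ d \<le> K * nrm I y" by (rule proper_bound) blast
  define Q where "Q = 2 ^ d * (1 + K)"
  have Q: "Q \<ge> 0" using K by (simp add: Q_def)
  have x: "norm (u x) \<le> A * (Q * (1 + nrm I y)) ^ q" if "x \<in> fibre y" for x y
  proof -
    have "(1 + nrm I x) ^ d \<le> (2 * max 1 (nrm I x)) ^ d" by (intro power_mono) auto
    also have "\<dots> = 2 ^ d * max 1 (nrm I x ^ d)"
      by (cases "nrm I x \<le> 1") (auto simp: power_mult_distrib max_absorb1 max_absorb2 power_le_one one_le_power)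
    also have "\<dots> \<le> 2 ^ d * (1 + K * nrm I y)" using K(2)[OF that] K(1) by (intro mult_left_mono) auto
    also have "\<dots> \<le> 2 ^ d * ((1 + K) * (1 + nrm I y))"
      using K(1) by (intro mult_left_mono) (auto simp: algebra_simps)
    also have "\<dots> = Q * (1 + nrm I y)" by (simp add: Q_def)
    finally have "((1 + nrm I x) ^ d) ^ q \<le> (Q * (1 + nrm I y)) ^ q" by (intro power_mono) auto
    then have "A * (1 + nrm I x) ^ (d * q) \<le> A * (Q * (1 + nrm I y)) ^ q"
      using A(1) by (intro mult_left_mono) (auto simp: power_mult)
    then show ?thesis using A(2)[of x] by simp
  qed
  show thesis
  proof (rule that[of "real (d ^ card I) * (A * Q ^ q)"])
    show "0 \<le> real (d ^ card I) * (A * Q ^ q)" using A Q by simp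
    fix y assume y: "\<Delta> y \<noteq> 0"
    have "norm (fibre_sum u y) \<le> (\<Sum>x\<in>fibre y. A * (Q * (1 + nrm I y)) ^ q)"
      unfolding fibre_sum_def by (rule sum_norm_le) (rule x)
    also have "\<dots> \<le> real (d ^ card I) * (A * (Q * (1 + nrm I y)) ^ q)"
      unfolding sum_constant using card_fibre_le[OF y] A Q
      by (intro mult_right_mono) (auto intro!: mult_nonneg_nonneg zero_le_power)
    finally show "norm (fibre_sum u y) \<le> real (d ^ card I) * (A * Q ^ q) * (1 + nrm I y) ^ q"
      by (simp add: power_mult_distrib mult_ac)
  qed
qed

text \<open>Join \<open>v\<close> to \<open>y\<close> by a complex line and consider \<open>G = \<Delta> * (sum of h g over the fibre)\<close> on it, where \<open>g\<close> is \<open>1\<close> at \<open>x0\<close> and \<open>0\<close> on the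
rest of the fibre over \<open>y\<close>.  The factor \<open>\<Delta>\<close> makes \<open>G\<close> continuous at the finitely many points of the line where fibres degenerate, so \<open>G\<close> is entire.
Its growth is of order \<open>T + d ^ card I + \<delta>\<close>, below its order of vanishing at \<open>v\<close>, so it is zero; at \<open>y\<close> this
says that \<open>h x0 = 0\<close>.\<close>
lemma vanishes_on_fibre_of_vanishing_order:
  assumes v: "\<Delta> v \<noteq> 0" and y: "\<Delta> y \<noteq> 0" and h: "poly_fn I (d * T) h"
    and vanish: "\<And>c. c \<in> fibre v \<Longrightarrow>
      \<exists>K\<ge>0. \<forall>x. vdist I x c \<le> 1 \<longrightarrow> norm (h x) \<le> K * vdist I x c ^ Suc (T + d ^ card I + \<delta>)"
    and x0: "x0 \<in> fibre y"
  shows "h x0 = 0"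
proof -
  define D where "D = d ^ card I"
  define M where "M = Suc (T + D + \<delta>)"
  have "fibre y \<subseteq> I \<rightarrow>\<^sub>E UNIV" by (auto simp: fibre_def)
  from separating_poly_fn[OF finite_I finite_fibre[OF y] this x0] obtain g where
    g: "poly_fn I (card (fibre y)) g" "g x0 = 1" "\<And>x. x \<in> fibre y \<Longrightarrow> x \<noteq> x0 \<Longrightarrow> g x = 0" by blast
  have "1 * D \<le> d * D" using d_pos by (intro mult_le_mono1) simp
  then have "card (fibre y) \<le> d * D" using card_fibre_le[OF y] unfolding D_def by linarith
  then have g': "poly_fn I (d * D) g" by (rule poly_fn_mono[OF finite_I g(1)])
  define u where "u x = h x * g x" for x
  have u: "poly_fn I (d * (T + D)) u"
    unfolding u_def distrib_left by (rule poly_fn_mult[OF finite_I h g'])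
  define w where "w i = y i - v i" for i
  define Y where "Y t = (\<lambda>i. v i + t * w i)" for t
  have Y1: "Y 1 = y" by (auto simp: Y_def w_def)
  have Y0: "Y 0 = v" by (simp add: Y_def)
  define G where "G t = \<Delta> (Y t) * fibre_sum u (Y t)" for t
  obtain K where K: "K \<ge> 0" "\<And>y. \<Delta> y \<noteq> 0 \<Longrightarrow> norm (fibre_sum u y) \<le> K * (1 + nrm I y) ^ (T + D)"
    by (fact fibre_sum_growth[OF u])
  obtain p where p: "\<And>t. \<Delta> (Y t) = poly p t"
    using poly_fn_along_line[OF finite_I poly_disc, of v w] unfolding Y_def by blast
  have "p \<noteq> 0" using v p[of 0] Y0 by auto
  have nrmY: "nrm I (Y t) \<le> nrm I v + norm t * nrm I w" for t
    unfolding nrm_def sum_distrib_left sum.distrib[symmetric] Y_def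
    by (rule sum_mono) (metis norm_mult norm_triangle_ineq)
  have G_le: "norm (G t) \<le> norm (poly p t) * (K * (1 + (nrm I v + norm t * nrm I w)) ^ (T + D))" for t
  proof (cases "poly p t = 0")
    case False
    have "norm (fibre_sum u (Y t)) \<le> K * (1 + nrm I (Y t)) ^ (T + D)" by (rule K(2)) (use False p in simp)
    also have "\<dots> \<le> K * (1 + (nrm I v + norm t * nrm I w)) ^ (T + D)"
      using nrmY[of t] K(1) by (intro mult_left_mono power_mono) auto
    finally show ?thesis unfolding G_def norm_mult p by (intro mult_left_mono) auto
  qed (simp add: G_def p)
  have diff: "G field_differentiable at t" if "poly p t \<noteq> 0" for t
  proof -
    have "(\<lambda>t. fibre_sum u (Y t)) field_differentiable at t"
      unfolding Y_def by (rule fibre_sum_field_differentiable[OF u]) (use that p in \<open>simp add: Y_def\<close>)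
    moreover have "poly p field_differentiable at t"
      by (auto simp: field_differentiable_def intro: poly_DERIV)
    ultimately show ?thesis unfolding G_def p by (rule field_differentiable_mult[rotated])
  qed
  have cont: "isCont G t" for t
  proof (cases "poly p t = 0")
    case True
    have "((\<lambda>t. norm (poly p t) * (K * (1 + (nrm I v + norm t * nrm I w)) ^ (T + D))) \<longlongrightarrow>
        norm (poly p t) * (K * (1 + (nrm I v + norm t * nrm I w)) ^ (T + D))) (at t)"
      by (intro tendsto_intros poly_isCont[unfolded isCont_def])
    then have "((\<lambda>t. norm (poly p t) * (K * (1 + (nrm I v + norm t * nrm I w)) ^ (T + D))) \<longlongrightarrow> 0) (at t)"
      unfolding True by (simp only: norm_zero mult_zero_left)
    then have "(G \<longlongrightarrow> 0) (at t)"
      by (rule Lim_null_comparison[OF always_eventually[OF allI[OF G_le]]])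
    moreover have "G t = 0" using True p by (simp add: G_def)
    ultimately show ?thesis by (simp add: isCont_def)
  next
    case False
    show ?thesis by (rule field_differentiable_imp_continuous_at[OF diff[OF False]])
  qed
  have "G holomorphic_on UNIV"
  proof (rule no_isolated_singularity[where K = "{t. poly p t = 0}"])
    show "finite {t. poly p t = 0}" using \<open>p \<noteq> 0\<close> by (rule poly_roots_finite)
    show "continuous_on UNIV G" using cont continuous_at_imp_continuous_on by blast
    show "G holomorphic_on UNIV - {t. poly p t = 0}"
      unfolding holomorphic_on_def using diff field_differentiable_at_within by blast
  qed simp
  moreover have "\<exists>A. \<forall>t. norm (G t) \<le> A * (1 + norm t) ^ (T + D + \<delta>)"
  proof -
    obtain K' where K': "K' \<ge> 0" "\<And>z. norm (\<Delta> z) \<le> K' * (1 + nrm I z) ^ \<delta>"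
      using poly_fn_growth[OF finite_I poly_disc] by blast
    define R where "R = 1 + nrm I v + nrm I w"
    have R: "1 + (nrm I v + norm t * nrm I w) \<le> R * (1 + norm t)" for t :: complex
    proof -
      have "R * (1 + norm t) = 1 + (nrm I v + norm t * nrm I w) + (nrm I w + norm t * (1 + nrm I v))"
        by (simp add: R_def algebra_simps)
      then show ?thesis by simp
    qed
    have "norm (G t) \<le> K' * R ^ \<delta> * (K * R ^ (T + D)) * (1 + norm t) ^ (T + D + \<delta>)" for t
    proof -
      have b1: "norm (poly p t) \<le> K' * (R * (1 + norm t)) ^ \<delta>"
        unfolding p[symmetric] using nrmY[of t] R[of t] K'(1)
        by (intro order_trans[OF K'(2)] mult_left_mono power_mono) auto
      have b2: "K * (1 + (nrm I v + norm t * nrm I w)) ^ (T + D) \<le> K * (R * (1 + norm t)) ^ (T + D)"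
        using R[of t] K(1) by (intro mult_left_mono power_mono) auto
      have "0 \<le> K * (1 + (nrm I v + norm t * nrm I w)) ^ (T + D)" using K(1) by simp
      then have "norm (G t) \<le> (K' * (R * (1 + norm t)) ^ \<delta>) * (K * (R * (1 + norm t)) ^ (T + D))"
        by (rule order_trans[OF G_le mult_mono[OF b1 b2 order_trans[OF norm_ge_zero b1]]])
      then show ?thesis by (simp add: power_mult_distrib power_add mult_ac)
    qed
    then show ?thesis by blast
  qed
  then obtain A where "\<And>t. norm (G t) \<le> A * (1 + norm t) ^ (T + D + \<delta>)" by blast
  moreover have "\<exists>A. eventually (\<lambda>t. norm (G t) \<le> A * norm t ^ M) (nhds 0)"
  proof (rule fibre_branches[OF v])
    fix \<eta> L \<sigma>
    assume \<eta>: "\<eta> > 0" "L > 0"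
      and fib: "\<And>y. vdist I y v < \<eta> \<Longrightarrow> fibre y = (\<lambda>c. \<sigma> c y) ` fibre v"
      and inj: "\<And>y. vdist I y v < \<eta> \<Longrightarrow> inj_on (\<lambda>c. \<sigma> c y) (fibre v)"
      and lip: "\<And>c y y'. c \<in> fibre v \<Longrightarrow> vdist I y v < \<eta> \<Longrightarrow> vdist I y' v < \<eta> \<Longrightarrow> vdist I (\<sigma> c y) (\<sigma> c y') \<le> L * vdist I y y'"
      and base: "\<And>c. c \<in> fibre v \<Longrightarrow> \<sigma> c v = c"
    have distY: "vdist I (Y t) v = norm t * nrm I w" for t
      by (simp add: vdist_def nrm_def Y_def norm_mult sum_distrib_left)
    have "\<forall>\<^sub>F t in nhds (0::complex). norm t * nrm I w < min \<eta> (1 / L)"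
    proof (rule order_tendstoD(2))
      show "((\<lambda>t::complex. norm t * nrm I w) \<longlongrightarrow> norm (0::complex) * nrm I w) (nhds 0)"
        by (intro tendsto_intros filterlim_ident)
      show "norm (0::complex) * nrm I w < min \<eta> (1 / L)" using \<eta> by simp
    qed
    then have small: "\<forall>\<^sub>F t in nhds 0. vdist I (Y t) v < min \<eta> (1 / L)" by (simp add: distY)
    have each: "\<exists>B\<ge>0. \<forall>t. vdist I (Y t) v < min \<eta> (1 / L) \<longrightarrow> norm (u (\<sigma> c (Y t))) \<le> B * norm t ^ M"
      if c: "c \<in> fibre v" for c
    proof -
      obtain B1 where B1: "B1 \<ge> 0" "\<And>x. vdist I x c \<le> 1 \<Longrightarrow> norm (h x) \<le> B1 * vdist I x c ^ M"
        using vanish[OF c] unfolding M_def D_def by blast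
      obtain B2 where B2: "B2 \<ge> 0" "\<And>x. nrm I x \<le> nrm I c + 1 \<Longrightarrow> norm (g x) \<le> B2"
        using poly_fn_bounded_lipschitz[OF finite_I g', of "nrm I c + 1"] by blast
      have "norm (u (\<sigma> c (Y t))) \<le> B1 * (L * nrm I w) ^ M * B2 * norm t ^ M" if t: "vdist I (Y t) v < min \<eta> (1 / L)" for t
      proof -
        let ?x = "\<sigma> c (Y t)"
        have x: "vdist I ?x c \<le> L * vdist I (Y t) v"
          using lip[OF c, of "Y t" v] base[OF c] t \<eta>(1) by simp
        also have "\<dots> \<le> L * (1 / L)" using t \<eta> by (intro mult_left_mono) auto
        finally have x1: "vdist I ?x c \<le> 1" using \<eta> by simp
        have b1: "norm (h ?x) \<le> B1 * (L * (norm t * nrm I w)) ^ M"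
          by (rule order_trans[OF B1(2)[OF x1]]) (use x B1(1) distY in \<open>auto intro!: mult_left_mono power_mono\<close>)
        have b2: "norm (g ?x) \<le> B2" using nrm_le_vdist[of I ?x c] x1 by (intro B2) auto
        have "norm (u ?x) \<le> (B1 * (L * (norm t * nrm I w)) ^ M) * B2"
          unfolding u_def norm_mult by (rule mult_mono[OF b1 b2 order_trans[OF norm_ge_zero b1] norm_ge_zero])
        then show ?thesis by (simp add: power_mult_distrib mult_ac)
      qed
      moreover have "B1 * (L * nrm I w) ^ M * B2 \<ge> 0" using B1(1) B2(1) \<eta> by simp
      ultimately show ?thesis by blast
    qed
    have "\<forall>c\<in>fibre v. \<exists>B. B \<ge> 0 \<and> (\<forall>t. vdist I (Y t) v < min \<eta> (1 / L) \<longrightarrow> norm (u (\<sigma> c (Y t))) \<le> B * norm t ^ M)"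
      using each by blast
    from bchoice[OF this] obtain B where
      "\<forall>c\<in>fibre v. B c \<ge> 0 \<and> (\<forall>t. vdist I (Y t) v < min \<eta> (1 / L) \<longrightarrow> norm (u (\<sigma> c (Y t))) \<le> B c * norm t ^ M)"
      by (elim exE)
    then have B: "\<And>c. c \<in> fibre v \<Longrightarrow> B c \<ge> 0"
      "\<And>c t. c \<in> fibre v \<Longrightarrow> vdist I (Y t) v < min \<eta> (1 / L) \<Longrightarrow> norm (u (\<sigma> c (Y t))) \<le> B c * norm t ^ M"
      by simp_all
    have tr: "norm (fibre_sum u (Y t)) \<le> (\<Sum>c\<in>fibre v. B c) * norm t ^ M" if t: "vdist I (Y t) v < min \<eta> (1 / L)" for t
    proof -
      have t': "vdist I (Y t) v < \<eta>" using t by simp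
      have "fibre_sum u (Y t) = (\<Sum>c\<in>fibre v. u (\<sigma> c (Y t)))"
        unfolding fibre_sum_def fib[OF t'] using inj[OF t'] by (simp add: sum.reindex)
      also have "norm \<dots> \<le> (\<Sum>c\<in>fibre v. B c * norm t ^ M)" by (rule sum_norm_le) (rule B(2)[OF _ t])
      finally show ?thesis by (simp add: sum_distrib_right)
    qed
    have "(poly p \<longlongrightarrow> poly p 0) (nhds 0)"
      by (intro tendsto_intros filterlim_ident)
    then have "\<forall>\<^sub>F t in nhds 0. norm (poly p t) < norm (poly p 0) + 1"
      by (intro order_tendstoD(2)[OF tendsto_norm]) auto
    with small have "\<forall>\<^sub>F t in nhds 0. norm (G t) \<le> (norm (poly p 0) + 1) * (\<Sum>c\<in>fibre v. B c) * norm t ^ M"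
    proof eventually_elim
      case (elim t)
      have "norm (G t) \<le> (norm (poly p 0) + 1) * ((\<Sum>c\<in>fibre v. B c) * norm t ^ M)"
        unfolding G_def norm_mult p by (intro mult_mono tr less_imp_le[OF elim(2)] elim(1)) auto
      then show ?case by (simp add: mult_ac)
    qed
    then show ?thesis by blast
  qed
  then obtain A' where "eventually (\<lambda>t. norm (G t) \<le> A' * norm t ^ Suc (T + D + \<delta>)) (nhds 0)"
    unfolding M_def by blast
  ultimately have "G 1 = 0" by (rule entire_eq_0_of_growth_and_vanishing)
  then have "fibre_sum u y = 0" using y by (simp add: G_def Y1)
  moreover have "fibre_sum u y = u x0"
  proof -
    have "fibre_sum u y = (\<Sum>x\<in>fibre y. if x = x0 then u x0 else 0)"
      unfolding fibre_sum_def by (rule sum.cong) (auto simp: u_def g)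
    then show ?thesis using finite_fibre[OF y] x0 by simp
  qed
  ultimately show ?thesis by (simp add: u_def g)
qed

text \<open>If there were fewer points than \<open>d ^ card I\<close>, then for large \<open>T\<close> there would be fewer conditions for vanishing to order
\<open>T + d ^ card I + \<delta> + 1\<close> at all of them than polynomials of degree \<open>d * T\<close>.  A non-zero solution \<open>h\<close> would vanish outside of a hypersurface by
the preceding lemma, a contradiction.\<close>
theorem card_fibre:
  assumes v: "\<Delta> v \<noteq> 0"
  shows "card (fibre v) = d ^ card I"
proof (rule antisym[OF card_fibre_le[OF v]], rule ccontr)
  assume "\<not> d ^ card I \<le> card (fibre v)"
  then have "real (card (fibre v)) < real (d ^ card I)" unfolding of_nat_less_iff by simp
  then have small: "real (card (fibre v)) < real d ^ card I" unfolding of_nat_power .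
  define k where "k = card (fibre v)"
  define e where "e = d ^ card I + \<delta>"
  have "\<forall>\<^sub>F T in sequentially. real k < real ((d * T + 0 + card I) choose card I) / real ((T + e + card I) choose card I)"
    using choose_ratio_tendsto[of d 0 "card I" e] small unfolding k_def by (intro order_tendstoD(1))
  then obtain T where "real k < real ((d * T + card I) choose card I) / real ((T + e + card I) choose card I)"
    by (auto simp: eventually_sequentially)
  moreover have "real ((T + e + card I) choose card I) > 0" by simp
  ultimately have "real (k * card (exponents I (T + e))) < real (card (exponents I (d * T)))"
    by (simp add: card_exponents finite_I less_divide_eq del: of_nat_add)
  then have card: "card (fibre v \<times> exponents I (T + e)) < card (exponents I (d * T))"
    by (simp add: card_cartesian_product k_def del: of_nat_mult)
  have "\<exists>E. \<forall>c. \<forall>\<alpha>\<in>exponents I (d * T). \<forall>u. monomial I \<alpha> (\<lambda>i. c i + u i) = (\<Sum>\<beta>\<in>exponents I (d * T). E c \<alpha> \<beta> * monomial I \<beta> u)"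
    by (rule choice, rule allI, rule taylor_coefficients[OF finite_I])
  then obtain E where E: "\<And>c \<alpha> u. \<alpha> \<in> exponents I (d * T) \<Longrightarrow>
      monomial I \<alpha> (\<lambda>i. c i + u i) = (\<Sum>\<beta>\<in>exponents I (d * T). E c \<alpha> \<beta> * monomial I \<beta> u)" by blast
  obtain a where a: "\<exists>\<alpha>\<in>exponents I (d * T). a \<alpha> \<noteq> 0"
      "\<And>c \<beta>. c \<in> fibre v \<Longrightarrow> \<beta> \<in> exponents I (T + e) \<Longrightarrow> (\<Sum>\<alpha>\<in>exponents I (d * T). E c \<alpha> \<beta> * a \<alpha>) = 0"
    using homogeneous_system_nontrivial_solution[of "fibre v \<times> exponents I (T + e)" "exponents I (d * T)" "\<lambda>p \<alpha>. E (fst p) \<alpha> (snd p)"]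
      card finite_fibre[OF v] finite_I by (auto simp: finite_exponents)
  define h where "h x = (\<Sum>\<alpha>\<in>exponents I (d * T). a \<alpha> * monomial I \<alpha> x)" for x
  have h: "poly_fn I (d * T) h" unfolding h_def poly_fn_def by blast
  have taylor: "h (\<lambda>i. c i + u i) = (\<Sum>\<beta>\<in>exponents I (d * T). (\<Sum>\<alpha>\<in>exponents I (d * T). E c \<alpha> \<beta> * a \<alpha>) * monomial I \<beta> u)" for c u
  proof -
    have "h (\<lambda>i. c i + u i) = (\<Sum>\<alpha>\<in>exponents I (d * T). \<Sum>\<beta>\<in>exponents I (d * T). E c \<alpha> \<beta> * a \<alpha> * monomial I \<beta> u)"
      unfolding h_def by (intro sum.cong refl) (simp add: E sum_distrib_left mult_ac)
    also have "\<dots> = (\<Sum>\<beta>\<in>exponents I (d * T). (\<Sum>\<alpha>\<in>exponents I (d * T). E c \<alpha> \<beta> * a \<alpha>) * monomial I \<beta> u)"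
      by (subst sum.swap) (simp add: sum_distrib_right)
    finally show ?thesis .
  qed
  have vanish: "\<exists>K\<ge>0. \<forall>x. vdist I x c \<le> 1 \<longrightarrow> norm (h x) \<le> K * vdist I x c ^ Suc (T + d ^ card I + \<delta>)" if "c \<in> fibre v" for c
    by (rule vanishing_order_bound[OF finite_I taylor]) (use a(2)[OF that] in \<open>simp add: e_def add.assoc\<close>)
  have zero: "h x = 0" if "\<Delta> (F x) \<noteq> 0" for x
  proof -
    let ?x = "restrict x I"
    have "?x \<in> fibre (F x)" by (auto simp: fibre_def intro: F_cong)
    from vanishes_on_fibre_of_vanishing_order[OF v that h vanish this] have "h ?x = 0" .
    moreover have "h ?x = h x" by (rule poly_fn_cong[OF finite_I h]) simp
    ultimately show ?thesis by simp
  qed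
  obtain p where p: "\<Delta> (F p) \<noteq> 0" using nonempty by blast
  have "poly_fn I (d * \<delta>) (\<lambda>x. \<Delta> (F x))" by (rule poly_fn_compose[OF finite_I finite_I poly_F poly_disc])
  from poly_fn_continuous[OF finite_I this, of "norm (\<Delta> (F p))" p] p obtain \<eta> where
    \<eta>: "\<eta> > 0" "\<And>x. vdist I x p < \<eta> \<Longrightarrow> norm (\<Delta> (F x) - \<Delta> (F p)) < norm (\<Delta> (F p))" by auto
  have "a \<alpha> = 0" if \<alpha>: "\<alpha> \<in> exponents I (d * T)" for \<alpha>
  proof (rule monomials_independent[OF finite_I _ _ \<alpha>, of "\<eta> / (real (card I) + 1)" p a])
    show "\<eta> / (real (card I) + 1) > 0" using \<eta> by simp
    fix x assume x: "\<And>i. i \<in> I \<Longrightarrow> norm (x i - p i) < \<eta> / (real (card I) + 1)"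
    have "vdist I x p \<le> real (card I) * (\<eta> / (real (card I) + 1))"
      unfolding vdist_def by (rule sum_bounded_above) (use x in \<open>auto intro: less_imp_le\<close>)
    also have "\<dots> < \<eta>" using \<eta> by (simp add: field_simps)
    finally have "\<Delta> (F x) \<noteq> 0" using \<eta>(2)[of x] by auto
    then show "(\<Sum>\<alpha>\<in>exponents I (d * T). a \<alpha> * monomial I \<alpha> x) = 0" using zero[of x] by (simp add: h_def)
  qed
  then show False using a(1) by blast
qed

end

section \<open>Critical values as a polynomial map of the critical points\<close>

text \<open>Strict differentiability at \<open>p\<close> with derivative zero.\<close>
definition flat_at :: "'i set \<Rightarrow> ('i \<Rightarrow> complex) \<Rightarrow> (('i \<Rightarrow> complex) \<Rightarrow> complex) \<Rightarrow> bool" where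
  "flat_at I p h \<longleftrightarrow> (\<forall>\<epsilon>>0. \<exists>r>0. \<forall>x x'. vdist I x p < r \<longrightarrow> vdist I x' p < r \<longrightarrow> norm (h x' - h x) \<le> \<epsilon> * vdist I x' x)"

lemma flat_at_mult:
  assumes I: "finite I" and a: "poly_fn I N a" "a p = 0" and b: "poly_fn I M b" "b p = 0"
  shows "flat_at I p (\<lambda>x. a x * b x)"
  unfolding flat_at_def
proof (intro allI impI)
  fix \<epsilon> :: real assume \<epsilon>: "\<epsilon> > 0"
  obtain K where K: "K \<ge> 0" "\<And>x x'. nrm I x \<le> nrm I p + 1 \<Longrightarrow> nrm I x' \<le> nrm I p + 1 \<Longrightarrow> norm (a x - a x') \<le> K * vdist I x x'"
    using poly_fn_bounded_lipschitz[OF I a(1), of "nrm I p + 1"] by blast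
  obtain L where L: "L \<ge> 0" "\<And>x x'. nrm I x \<le> nrm I p + 1 \<Longrightarrow> nrm I x' \<le> nrm I p + 1 \<Longrightarrow> norm (b x - b x') \<le> L * vdist I x x'"
    using poly_fn_bounded_lipschitz[OF I b(1), of "nrm I p + 1"] by blast
  define r where "r = min 1 (\<epsilon> / (2 * (K * L) + 1))"
  have KL: "K * L \<ge> 0" using K L by simp
  have r: "r > 0" "r \<le> 1" using \<epsilon> KL by (auto simp: r_def)
  have r2: "2 * (K * L) * r \<le> \<epsilon>"
  proof -
    have "2 * (K * L) * r \<le> (2 * (K * L) + 1) * (\<epsilon> / (2 * (K * L) + 1))"
      using KL r(1) by (intro mult_mono) (auto simp: r_def)
    then show ?thesis using KL by simp
  qed
  have "norm (a x' * b x' - a x * b x) \<le> \<epsilon> * vdist I x' x" if x: "vdist I x p < r" "vdist I x' p < r" for x x'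
  proof -
    have n: "nrm I x \<le> nrm I p + 1" "nrm I x' \<le> nrm I p + 1"
      using nrm_le_vdist[of I x p] nrm_le_vdist[of I x' p] x r by auto
    have np: "nrm I p \<le> nrm I p + 1" by simp
    have "norm (a x') \<le> K * vdist I x' p" using K(2)[OF n(2) np] a(2) by simp
    also have "\<dots> \<le> K * r" using x K(1) by (intro mult_left_mono) auto
    finally have ax: "norm (a x') \<le> K * r" .
    have "norm (b x) \<le> L * vdist I x p" using L(2)[OF n(1) np] b(2) by simp
    also have "\<dots> \<le> L * r" using x L(1) by (intro mult_left_mono) auto
    finally have bx: "norm (b x) \<le> L * r" .
    have "a x' * b x' - a x * b x = a x' * (b x' - b x) + (a x' - a x) * b x" by (simp add: algebra_simps)
    then have "norm (a x' * b x' - a x * b x) \<le> norm (a x') * norm (b x' - b x) + norm (a x' - a x) * norm (b x)"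
      by (metis norm_mult norm_triangle_ineq)
    also have "\<dots> \<le> (K * r) * (L * vdist I x' x) + (K * vdist I x' x) * (L * r)"
      using K(1) L(1) r by (intro add_mono mult_mono ax bx L(2) K(2) n) auto
    also have "\<dots> = 2 * (K * L) * r * vdist I x' x" by (simp add: algebra_simps)
    also have "\<dots> \<le> \<epsilon> * vdist I x' x" by (rule mult_right_mono[OF r2]) simp
    finally show ?thesis .
  qed
  then show "\<exists>r>0. \<forall>x x'. vdist I x p < r \<longrightarrow> vdist I x' p < r \<longrightarrow> norm (a x' * b x' - a x * b x) \<le> \<epsilon> * vdist I x' x"
    using r(1) by blast
qed

lemma flat_at_add:
  assumes f: "flat_at I p f" and g: "flat_at I p g"
  shows "flat_at I p (\<lambda>x. f x + g x)"
  unfolding flat_at_def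
proof (intro allI impI)
  fix \<epsilon> :: real assume "\<epsilon> > 0"
  then have e: "\<epsilon> / 2 > 0" by simp
  obtain r where r: "r > 0" "\<And>x x'. vdist I x p < r \<Longrightarrow> vdist I x' p < r \<Longrightarrow> norm (f x' - f x) \<le> \<epsilon> / 2 * vdist I x' x"
    using f[unfolded flat_at_def, rule_format, OF e] by blast
  obtain s where s: "s > 0" "\<And>x x'. vdist I x p < s \<Longrightarrow> vdist I x' p < s \<Longrightarrow> norm (g x' - g x) \<le> \<epsilon> / 2 * vdist I x' x"
    using g[unfolded flat_at_def, rule_format, OF e] by blast
  have "norm (f x' + g x' - (f x + g x)) \<le> \<epsilon> * vdist I x' x" if "vdist I x p < min r s" "vdist I x' p < min r s" for x x'
  proof -
    have "norm (f x' + g x' - (f x + g x)) \<le> norm (f x' - f x) + norm (g x' - g x)"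
      by (metis add_diff_add norm_triangle_ineq)
    then show ?thesis using r(2)[of x x'] s(2)[of x x'] that by simp
  qed
  then show "\<exists>r>0. \<forall>x x'. vdist I x p < r \<longrightarrow> vdist I x' p < r \<longrightarrow> norm (f x' + g x' - (f x + g x)) \<le> \<epsilon> * vdist I x' x"
    using r(1) s(1) by (intro exI[of _ "min r s"]) simp
qed

lemma flat_at_sum:
  assumes "finite S" "\<And>s. s \<in> S \<Longrightarrow> flat_at I p (h s)"
  shows "flat_at I p (\<lambda>x. \<Sum>s\<in>S. h s x)"
  using assms
proof (induction S)
  case empty
  show ?case by (auto simp: flat_at_def intro!: exI[of _ 1])
qed (simp add: flat_at_add)

definition roots_poly :: "'i set \<Rightarrow> ('i \<Rightarrow> complex) \<Rightarrow> complex poly" where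
  "roots_poly I z = (\<Prod>i\<in>I. [:- z i, 1:])"

lemma poly_roots_poly: "poly (roots_poly I z) t = (\<Prod>i\<in>I. t - z i)"
  by (simp add: roots_poly_def poly_prod)

lemma poly_roots_poly_eq_0: "finite I \<Longrightarrow> poly (roots_poly I z) t = 0 \<longleftrightarrow> t \<in> z ` I"
  by (auto simp: poly_roots_poly)

lemma degree_roots_poly: "degree (roots_poly I z) = card I"
  by (simp add: roots_poly_def degree_prod_sum_eq)

lemma lead_coeff_roots_poly [simp]: "lead_coeff (roots_poly I z) = 1"
  by (simp add: roots_poly_def lead_coeff_prod)

lemma coeff_roots_poly_top: "coeff (roots_poly I z) (card I) = 1"
  using lead_coeff_roots_poly[of I z] by (simp only: degree_roots_poly)

lemma roots_poly_nonzero [simp]: "roots_poly I z \<noteq> 0"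
  using lead_coeff_roots_poly[of I z] by (metis leading_coeff_0_iff zero_neq_one)

lemma roots_poly_cong: "(\<And>i. i \<in> I \<Longrightarrow> z i = z' i) \<Longrightarrow> roots_poly I z = roots_poly I z'"
  unfolding roots_poly_def by (rule prod.cong) auto

lemma poly_fn_coeff_roots_poly:
  assumes "finite I" "k \<le> card I"
  shows "poly_fn I (card I - k) (\<lambda>z. coeff (roots_poly I z) k)"
proof -
  have "\<forall>k\<le>card S. poly_fn I (card S - k) (\<lambda>z. coeff (roots_poly S z) k)" if "finite S" "S \<subseteq> I" for S
    using that
  proof (induction S)
    case empty
    show ?case by (simp add: roots_poly_def poly_fn_const assms)
  next
    case (insert s S)
    have eq: "roots_poly (insert s S) z = [:- z s, 1:] * roots_poly S z" for z
      using insert.hyps by (simp add: roots_poly_def)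
    show ?case
    proof (intro allI impI)
      fix k assume k: "k \<le> card (insert s S)"
      have s: "poly_fn I (Suc 0) (\<lambda>z. (- 1) * z s)"
        using insert.prems by (intro poly_fn_cmult poly_fn_coord assms) auto
      have z: "poly_fn I (card (insert s S) - k) (\<lambda>z. - z s * coeff (roots_poly S z) k)"
      proof (cases "k \<le> card S")
        case True
        then have "poly_fn I (Suc 0 + (card S - k)) (\<lambda>z. (- 1) * z s * coeff (roots_poly S z) k)"
          using insert.IH insert.prems by (intro poly_fn_mult s assms) auto
        then show ?thesis using True insert.hyps by (simp add: Suc_diff_le)
      next
        case False
        then have "coeff (roots_poly S z) k = 0" for z by (intro coeff_eq_0) (simp add: degree_roots_poly)
        then show ?thesis by (simp add: poly_fn_const assms)
      qed
      show "poly_fn I (card (insert s S) - k) (\<lambda>z. coeff (roots_poly (insert s S) z) k)"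
      proof (cases k)
        case 0
        then show ?thesis using z by (simp add: eq)
      next
        case (Suc l)
        then have "l \<le> card S" using k insert.hyps by simp
        then have "poly_fn I (card S - l) (\<lambda>z. coeff (roots_poly S z) l)" using insert.IH insert.prems by auto
        then have "poly_fn I (card (insert s S) - k) (\<lambda>z. coeff (roots_poly S z) l)"
          using Suc insert.hyps by simp
        from poly_fn_add[OF this z] show ?thesis using Suc by (simp add: eq)
      qed
    qed
  qed
  then show ?thesis using assms by blast
qed

definition antideriv :: "complex poly \<Rightarrow> complex poly" where
  "antideriv p = (\<Sum>k\<le>degree p. monom (coeff p k / of_nat (Suc k)) (Suc k))"

lemma coeff_antideriv: "coeff (antideriv p) k = (case k of 0 \<Rightarrow> 0 | Suc l \<Rightarrow> coeff p l / of_nat (Suc l))"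
proof (cases k)
  case 0
  then show ?thesis by (simp add: antideriv_def coeff_sum)
next
  case (Suc l)
  then have "coeff (antideriv p) k = (\<Sum>j\<le>degree p. if j = l then coeff p l / of_nat (Suc l) else 0)"
    unfolding antideriv_def coeff_sum by (intro sum.cong) auto
  also have "\<dots> = coeff p l / of_nat (Suc l)" by (auto simp: not_le coeff_eq_0)
  finally show ?thesis using Suc by simp
qed

lemma pderiv_antideriv: "pderiv (antideriv p) = p"
  by (rule poly_eqI) (simp add: coeff_pderiv coeff_antideriv del: of_nat_Suc)

lemma poly_eq_of_pderiv_eq:
  assumes "pderiv p = pderiv (q :: complex poly)" "poly p a = poly q a"
  shows "p = q"
proof -
  have "pderiv (p - q) = 0" using assms by (simp add: pderiv_diff)
  then obtain h where "p - q = [:h:]" using pderiv_iszero by blast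
  moreover have "poly (p - q) a = 0" using assms(2) by simp
  ultimately show ?thesis by simp
qed

text \<open>The monic polynomial without constant term whose critical points are the \<open>c i\<close>.\<close>
definition crit_points_poly :: "'i set \<Rightarrow> ('i \<Rightarrow> complex) \<Rightarrow> complex poly" where
  "crit_points_poly I c = smult (of_nat (Suc (card I))) (antideriv (roots_poly I c))"

lemma pderiv_crit_points_poly: "pderiv (crit_points_poly I c) = smult (of_nat (Suc (card I))) (roots_poly I c)"
  by (simp add: crit_points_poly_def pderiv_smult pderiv_antideriv)

lemma poly_crit_points_poly_0 [simp]: "poly (crit_points_poly I c) 0 = 0"
  by (simp add: crit_points_poly_def poly_0_coeff_0 coeff_antideriv)

lemma coeff_crit_points_poly_Suc:
  "coeff (crit_points_poly I c) (Suc k) = of_nat (Suc (card I)) * coeff (roots_poly I c) k / of_nat (Suc k)"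
  by (simp add: crit_points_poly_def coeff_antideriv)

lemma coeff_crit_points_poly_0: "coeff (crit_points_poly I c) 0 = 0"
  by (simp add: crit_points_poly_def coeff_antideriv)

lemma coeff_crit_points_poly_top: "coeff (crit_points_poly I c) (Suc (card I)) = 1"
  by (simp add: coeff_crit_points_poly_Suc coeff_roots_poly_top del: of_nat_Suc)

lemma coeff_crit_points_poly_above: "k > Suc (card I) \<Longrightarrow> coeff (crit_points_poly I c) k = 0"
  by (cases k) (auto simp: coeff_crit_points_poly_Suc coeff_eq_0 degree_roots_poly)

lemma degree_crit_points_poly: "degree (crit_points_poly I c) = Suc (card I)"
proof (rule antisym)
  show "degree (crit_points_poly I c) \<le> Suc (card I)" by (rule degree_le) (simp add: coeff_crit_points_poly_above)
  show "Suc (card I) \<le> degree (crit_points_poly I c)" by (rule le_degree) (simp add: coeff_crit_points_poly_top)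
qed

lemma lead_coeff_crit_points_poly: "lead_coeff (crit_points_poly I c) = 1"
  by (simp only: degree_crit_points_poly coeff_crit_points_poly_top)

lemma poly_fn_coeff_crit_points_poly:
  assumes "finite I" "k \<le> Suc (card I)"
  shows "poly_fn I (Suc (card I) - k) (\<lambda>c. coeff (crit_points_poly I c) k)"
proof (cases k)
  case 0
  then show ?thesis by (simp add: coeff_crit_points_poly_0 poly_fn_const assms)
next
  case (Suc l)
  have "poly_fn I (card I - l) (\<lambda>c. (of_nat (Suc (card I)) / of_nat (Suc l)) * coeff (roots_poly I c) l)"
    using assms Suc by (intro poly_fn_cmult poly_fn_coeff_roots_poly) auto
  then show ?thesis using Suc by (simp add: coeff_crit_points_poly_Suc)
qed

lemma poly_crit_points_poly:
  "poly (crit_points_poly I c) t = (\<Sum>k\<le>Suc (card I). coeff (crit_points_poly I c) k * t ^ k)"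
  using poly_altdef[of "crit_points_poly I c" t] by (simp only: degree_crit_points_poly)

definition crit_values_map :: "'i set \<Rightarrow> ('i \<Rightarrow> complex) \<Rightarrow> 'i \<Rightarrow> complex" where
  "crit_values_map I c j = poly (crit_points_poly I c) (c j)"

lemma poly_fn_crit_values_map:
  assumes "finite I" "j \<in> I"
  shows "poly_fn I (Suc (card I)) (\<lambda>c. crit_values_map I c j)"
  unfolding crit_values_map_def poly_crit_points_poly
proof (rule poly_fn_sum)
  fix k assume k: "k \<in> {..Suc (card I)}"
  have "poly_fn I ((Suc (card I) - k) + k * Suc 0) (\<lambda>c. coeff (crit_points_poly I c) k * c j ^ k)"
    using k assms by (intro poly_fn_mult poly_fn_power poly_fn_coord poly_fn_coeff_crit_points_poly) auto
  then show "poly_fn I (Suc (card I)) (\<lambda>c. coeff (crit_points_poly I c) k * c j ^ k)" using k by simp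
qed

lemma crit_values_map_homogeneous:
  assumes "finite I" "j \<in> I"
  shows "crit_values_map I (\<lambda>i. t * c i) j = t ^ Suc (card I) * crit_values_map I c j"
proof -
  have "pcompose (crit_points_poly I (\<lambda>i. t * c i)) [:0, t:] = smult (t ^ Suc (card I)) (crit_points_poly I c)"
  proof (rule poly_eq_of_pderiv_eq[of _ _ 0])
    have "poly (pderiv (pcompose (crit_points_poly I (\<lambda>i. t * c i)) [:0, t:])) s
        = poly (pderiv (smult (t ^ Suc (card I)) (crit_points_poly I c))) s" for s
    proof -
      have "(\<Prod>i\<in>I. t * s - t * c i) = t ^ card I * (\<Prod>i\<in>I. s - c i)"
        by (simp add: right_diff_distrib[symmetric] prod.distrib)
      then show ?thesis
        by (simp add: pderiv_pcompose pderiv_smult pderiv_crit_points_poly poly_pcompose poly_roots_poly pderiv_pCons mult_ac)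
    qed
    then show "pderiv (pcompose (crit_points_poly I (\<lambda>i. t * c i)) [:0, t:]) = pderiv (smult (t ^ Suc (card I)) (crit_points_poly I c))"
      by (simp add: poly_eq_poly_eq_iff[symmetric] fun_eq_iff)
  qed (simp add: poly_pcompose)
  then have "poly (pcompose (crit_points_poly I (\<lambda>i. t * c i)) [:0, t:]) (c j) = poly (smult (t ^ Suc (card I)) (crit_points_poly I c)) (c j)"
    by simp
  then show ?thesis by (simp add: crit_values_map_def poly_pcompose mult.commute)
qed

text \<open>If all critical points are roots of \<open>f\<close>, then every root of \<open>f'\<close> is one of \<open>f\<close>, where the multiplicity is one higher.  Comparing
the sums of all multiplicities, which are the degrees, shows that \<open>f\<close> has only one root, and this is \<open>0\<close>.\<close>
lemma crit_values_map_eq_0: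
  assumes I: "finite I" and z: "\<And>j. j \<in> I \<Longrightarrow> crit_values_map I c j = 0" and j: "j \<in> I"
  shows "c j = 0"
proof -
  define f where "f = crit_points_poly I c"
  have f0: "f \<noteq> 0" using lead_coeff_crit_points_poly[of I c] unfolding f_def by (metis leading_coeff_0_iff zero_neq_one)
  define S where "S = {a. poly f a = 0}"
  have S: "finite S" using poly_roots_finite[OF f0] by (simp add: S_def)
  have f'0: "pderiv f \<noteq> 0" by (simp add: f_def pderiv_crit_points_poly del: of_nat_Suc)
  have roots': "{a. poly (pderiv f) a = 0} = c ` I"
    using I by (auto simp: f_def pderiv_crit_points_poly poly_roots_poly_eq_0 simp del: of_nat_Suc)
  have sub: "c ` I \<subseteq> S" using z by (auto simp: S_def f_def crit_values_map_def)
  have "Suc (card I) = size (proots f)" by (simp add: size_proots_complex f_def degree_crit_points_poly)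
  also have "\<dots> = (\<Sum>a\<in>S. order a f)"
    using f0 by (simp add: size_multiset_overloaded_eq S_def)
  also have "\<dots> = (\<Sum>a\<in>S. Suc (order a (pderiv f)))"
    by (rule sum.cong) (auto simp: S_def intro: order_pderiv[OF f0])
  also have "\<dots> = card S + (\<Sum>a\<in>S. order a (pderiv f))" by (simp add: sum_Suc)
  also have "(\<Sum>a\<in>S. order a (pderiv f)) = (\<Sum>a\<in>{a. poly (pderiv f) a = 0}. order a (pderiv f))"
    using S sub roots' by (intro sum.mono_neutral_right) (auto intro: order_0I)
  also have "\<dots> = size (proots (pderiv f))"
    using f'0 by (simp add: size_multiset_overloaded_eq)
  also have "\<dots> = card I"
    by (simp add: size_proots_complex f_def pderiv_crit_points_poly degree_roots_poly del: of_nat_Suc)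
  finally have "card S = 1" by simp
  moreover have "0 \<in> S" by (simp add: S_def f_def)
  ultimately have "S = {0}" by (auto simp: card_1_singleton_iff)
  then show ?thesis using sub j by auto
qed

text \<open>Homogeneity reduces the claim to the unit sphere, where the norm of the values has a positive minimum.\<close>
lemma crit_values_map_proper:
  assumes I: "finite I"
  shows "\<exists>K. \<forall>x. nrm I x ^ Suc (card I) \<le> K * nrm I (crit_values_map I x)"
proof -
  define S where "S = (I \<rightarrow>\<^sub>E cball 0 1) \<inter> {x. nrm I x = 1}"
  have "closed {x. nrm I x = 1}"
    by (intro closed_Collect_eq continuous_on_const continuous_on_vdist
        continuous_on_subset[OF continuous_on_product_coordinates]) auto
  then have S: "compact S" unfolding S_def by (intro compact_Int_closed compact_PiE_cball)
  have cont: "continuous_on S (\<lambda>x. nrm I (crit_values_map I x))"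
    by (intro continuous_on_vdist poly_fn_continuous_on[OF I poly_fn_crit_values_map[OF I]])
  have "\<exists>\<mu>>0. \<forall>x\<in>S. \<mu> \<le> nrm I (crit_values_map I x)"
  proof (cases "S = {}")
    case False
    then obtain x0 where x0: "x0 \<in> S" "\<And>x. x \<in> S \<Longrightarrow> nrm I (crit_values_map I x0) \<le> nrm I (crit_values_map I x)"
      using continuous_attains_inf[OF S _ cont] by blast
    have "nrm I (crit_values_map I x0) \<noteq> 0"
    proof
      assume "nrm I (crit_values_map I x0) = 0"
      then have "\<And>j. j \<in> I \<Longrightarrow> crit_values_map I x0 j = 0"
        using I by (simp add: nrm_def sum_nonneg_eq_0_iff)
      then have "\<And>j. j \<in> I \<Longrightarrow> x0 j = 0" by (rule crit_values_map_eq_0[OF I])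
      then have "nrm I x0 = 0" by (simp add: nrm_def)
      then show False using x0(1) by (simp add: S_def)
    qed
    then show ?thesis using x0(2) nrm_nonneg[of I "crit_values_map I x0"] by (metis less_eq_real_def)
  qed (auto intro: exI[of _ 1])
  then obtain \<mu> where \<mu>: "\<mu> > 0" "\<And>x. x \<in> S \<Longrightarrow> \<mu> \<le> nrm I (crit_values_map I x)" by blast
  have "nrm I x ^ Suc (card I) \<le> (1 / \<mu>) * nrm I (crit_values_map I x)" for x
  proof (cases "nrm I x = 0")
    case False
    define \<rho> where "\<rho> = nrm I x"
    have \<rho>: "\<rho> > 0" using False nrm_nonneg[of I x] unfolding \<rho>_def by linarith
    define y where "y = restrict (\<lambda>i. x i / of_real \<rho>) I"
    have ny: "nrm I y = 1"
    proof -
      have "nrm I y = (\<Sum>i\<in>I. norm (x i) / \<rho>)" unfolding nrm_def y_def using \<rho> by (intro sum.cong) (auto simp: norm_divide)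
      also have "\<dots> = nrm I x / \<rho>" by (simp add: nrm_def sum_divide_distrib)
      finally show ?thesis using \<rho> by (simp add: \<rho>_def)
    qed
    have "norm (y i) \<le> 1" if "i \<in> I" for i using norm_le_nrm[OF I that, of y] ny by simp
    then have "y \<in> S" using ny by (auto simp: S_def y_def)
    have "crit_values_map I x j = of_real \<rho> ^ Suc (card I) * crit_values_map I y j" if j: "j \<in> I" for j
    proof -
      have "crit_values_map I x j = crit_values_map I (\<lambda>i. of_real \<rho> * y i) j"
        by (rule poly_fn_cong[OF I poly_fn_crit_values_map[OF I j]]) (use \<rho> in \<open>simp add: y_def\<close>)
      then show ?thesis using crit_values_map_homogeneous[OF I j] by simp
    qed
    then have "nrm I (crit_values_map I x) = (\<Sum>j\<in>I. \<rho> ^ Suc (card I) * norm (crit_values_map I y j))"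
      unfolding nrm_def using \<rho> by (intro sum.cong) (auto simp: norm_mult norm_power)
    also have "\<dots> = \<rho> ^ Suc (card I) * nrm I (crit_values_map I y)" by (simp add: nrm_def sum_distrib_left)
    finally have "\<rho> ^ Suc (card I) * \<mu> \<le> nrm I (crit_values_map I x)"
      using \<mu>(2)[OF \<open>y \<in> S\<close>] \<rho> by (simp add: mult_left_mono)
    then show ?thesis using \<mu>(1) by (simp add: \<rho>_def field_simps)
  qed (use \<mu> in simp)
  then show ?thesis by blast
qed

lemma pderiv_sum: "pderiv (sum f S) = (\<Sum>s\<in>S. pderiv (f s))"
  using higher_pderiv_sum[of 1 f S] by simp

lemma poly_pderiv_eq_sum:
  fixes f :: "complex poly"
  assumes "degree f \<le> N"
  shows "poly (pderiv f) t = (\<Sum>k\<le>N. coeff f k * (of_nat k * t ^ (k - 1)))"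
proof -
  have "f = (\<Sum>k\<le>N. monom (coeff f k) k)" using poly_as_sum_of_monoms'[OF assms] by simp
  then have "pderiv f = (\<Sum>k\<le>N. pderiv (monom (coeff f k) k))" by (metis pderiv_sum)
  then show ?thesis by (simp add: poly_sum pderiv_monom poly_monom mult_ac)
qed

text \<open>As \<open>p i\<close> is a critical point of the polynomial with critical points \<open>p\<close>, the \<open>i\<close>-th critical value differs from the value at the fixed
point \<open>p i\<close> by a product of two functions that vanish at \<open>p\<close>.\<close>
lemma crit_values_map_difference_quotient:
  assumes I: "finite I" and i: "i \<in> I"
  shows "\<exists>N k. poly_fn I N k \<and> k p = 0 \<and>
    (\<forall>x. crit_values_map I x i = poly (crit_points_poly I x) (p i) + (x i - p i) * k x)"
proof -
  let ?n = "Suc (card I)"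
  define k where "k x = (\<Sum>l\<le>?n. coeff (crit_points_poly I x) l * (\<Sum>a<l. p i ^ (l - Suc a) * x i ^ a))" for x
  have "poly_fn I (2 * ?n) k"
    unfolding k_def
  proof (rule poly_fn_sum)
    fix l assume l: "l \<in> {..?n}"
    have "poly_fn I l (\<lambda>x. p i ^ (l - Suc a) * x i ^ a)" if "a < l" for a
      by (rule poly_fn_mono[OF I poly_fn_cmult[OF I poly_fn_power[OF I poly_fn_coord[OF I i]]]]) (use that in simp)
    then have "poly_fn I (?n - l + l) (\<lambda>x. coeff (crit_points_poly I x) l * (\<Sum>a<l. p i ^ (l - Suc a) * x i ^ a))"
      using l by (intro poly_fn_mult I poly_fn_coeff_crit_points_poly poly_fn_sum) auto
    then show "poly_fn I (2 * ?n) (\<lambda>x. coeff (crit_points_poly I x) l * (\<Sum>a<l. p i ^ (l - Suc a) * x i ^ a))"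
      by (rule poly_fn_mono[OF I]) (use l in simp)
  qed
  moreover have "k p = 0"
  proof -
    have "(\<Sum>a<l. p i ^ (l - Suc a) * p i ^ a) = of_nat l * p i ^ (l - 1)" for l
    proof -
      have "(\<Sum>a<l. p i ^ (l - Suc a) * p i ^ a) = (\<Sum>a<l. p i ^ (l - 1))"
        by (rule sum.cong) (auto simp flip: power_add)
      then show ?thesis by simp
    qed
    then have "k p = poly (pderiv (crit_points_poly I p)) (p i)"
      unfolding k_def by (subst poly_pderiv_eq_sum[of _ ?n]) (simp_all add: degree_crit_points_poly)
    also have "\<dots> = 0"
      using poly_roots_poly_eq_0[OF I, of p "p i"] i by (simp add: pderiv_crit_points_poly)
    finally show ?thesis .
  qed
  moreover have "crit_values_map I x i = poly (crit_points_poly I x) (p i) + (x i - p i) * k x" for x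
  proof -
    have "crit_values_map I x i - poly (crit_points_poly I x) (p i)
        = (\<Sum>l\<le>?n. coeff (crit_points_poly I x) l * (x i ^ l - p i ^ l))"
      unfolding crit_values_map_def poly_crit_points_poly by (simp only: sum_subtractf right_diff_distrib)
    also have "\<dots> = (x i - p i) * k x"
    proof -
      have "coeff (crit_points_poly I x) l * (x i ^ l - p i ^ l)
          = (x i - p i) * (coeff (crit_points_poly I x) l * (\<Sum>a<l. p i ^ (l - Suc a) * x i ^ a))" for l
        using power_diff_sumr2[of "x i" l "p i"] by (simp only: mult.left_commute)
      then show ?thesis unfolding k_def by (subst sum_distrib_left) (rule sum.cong[OF refl])
    qed
    finally show ?thesis by (simp add: algebra_simps)
  qed
  ultimately show ?thesis by blast
qed

text \<open>The Lagrange basis for the nodes \<open>0\<close> and \<open>p i\<close>, without the member that is non-zero at \<open>0\<close>.\<close>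
definition interpolation_basis :: "'i set \<Rightarrow> ('i \<Rightarrow> complex) \<Rightarrow> 'i \<Rightarrow> complex poly" where
  "interpolation_basis I p i =
     smult (inverse (p i * (\<Prod>l\<in>I - {i}. p i - p l))) ([:0, 1:] * roots_poly (I - {i}) p)"

context
  fixes I :: "'i set" and p :: "'i \<Rightarrow> complex"
  assumes I: "finite I" and inj: "inj_on p I" and nz: "\<And>i. i \<in> I \<Longrightarrow> p i \<noteq> 0"
begin

lemma node_products_nonzero: "i \<in> I \<Longrightarrow> (\<Prod>l\<in>I - {i}. p i - p l) \<noteq> 0"
  using I inj by (auto simp: inj_on_def)

lemma interpolation_basis_0: "poly (interpolation_basis I p i) 0 = 0"
  by (simp add: interpolation_basis_def)

lemma interpolation_basis_node:
  assumes "i \<in> I" "j \<in> I" shows "poly (interpolation_basis I p i) (p j) = (if j = i then 1 else 0)"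
proof (cases "j = i")
  case True
  define P where "P = p i * (\<Prod>l\<in>I - {i}. p i - p l)"
  have "poly (interpolation_basis I p i) (p i) = inverse P * P"
    by (simp add: interpolation_basis_def poly_roots_poly P_def)
  moreover have "P \<noteq> 0" using nz[OF assms(1)] node_products_nonzero[OF assms(1)] by (simp add: P_def)
  ultimately show ?thesis using True by simp
next
  case False
  then have "poly (roots_poly (I - {i}) p) (p j) = 0"
    using assms I by (subst poly_roots_poly_eq_0) auto
  then show ?thesis using False by (simp add: interpolation_basis_def)
qed

lemma degree_interpolation_basis: "i \<in> I \<Longrightarrow> degree (interpolation_basis I p i) \<le> card I"
proof -
  assume i: "i \<in> I"
  have "degree ([:0, 1:] * roots_poly (I - {i}) p) = Suc (card (I - {i}))"
    by (subst degree_mult_eq) (auto simp: degree_roots_poly)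
  then show ?thesis using I i card_gt_0_iff[of I] unfolding interpolation_basis_def
    by (intro order_trans[OF degree_smult_le]) auto
qed

lemma poly_eq_of_node_values:
  assumes "degree P \<le> card I" "degree Q \<le> card I" "poly P 0 = poly Q 0" "\<And>i. i \<in> I \<Longrightarrow> poly P (p i) = poly Q (p i)"
  shows "P = Q"
proof (rule poly_eqI_degree[of "insert 0 (p ` I)"])
  have "card (insert 0 (p ` I)) = Suc (card I)"
    using I nz by (subst card_insert_disjoint) (auto simp: card_image[OF inj])
  then show "degree P < card (insert 0 (p ` I))" "degree Q < card (insert 0 (p ` I))"
    using assms by auto
qed (use assms in auto)

lemma interpolation:
  assumes "degree Q \<le> card I" "poly Q 0 = 0"
  shows "Q = (\<Sum>i\<in>I. smult (poly Q (p i)) (interpolation_basis I p i))"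
proof (rule poly_eq_of_node_values)
  show "degree (\<Sum>i\<in>I. smult (poly Q (p i)) (interpolation_basis I p i)) \<le> card I"
    by (intro degree_sum_le I order_trans[OF degree_smult_le] degree_interpolation_basis)
qed (use assms I in \<open>simp_all add: poly_sum interpolation_basis_0 interpolation_basis_node if_distrib cong: if_cong\<close>)

text \<open>Let \<open>f x\<close> be the polynomial with critical points \<open>x\<close>, and let \<open>Q = f x' - f x\<close>.  Up to flat terms the \<open>i\<close>-th critical value changes by
\<open>Q (p i)\<close>.  Since \<open>Q\<close> has degree at most \<open>card I\<close> and vanishes at \<open>0\<close>, interpolation recovers \<open>Q' (p j)\<close> linearly from these
values, and \<open>Q'\<close> at \<open>p j\<close> is the difference of two multiples of \<open>\<Prod>(p j - x l)\<close>, whose derivative at \<open>p\<close> only involves the \<open>j\<close>-th coordinate.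
So \<open>B j i\<close> is the derivative at \<open>p j\<close> of the \<open>i\<close>-th basis polynomial, divided by \<open>- \<kappa> j\<close>.  It is injective because the
derivative of a polynomial of degree at most \<open>card I\<close> is determined by its values at the \<open>p j\<close>.\<close>
lemma crit_values_map_strict_left_inverse:
  "\<exists>B. (\<forall>u. (\<forall>j\<in>I. (\<Sum>i\<in>I. B j i * u i) = 0) \<longrightarrow> (\<forall>i\<in>I. u i = 0)) \<and>
    (\<forall>\<epsilon>>0. \<exists>r>0. \<forall>x x'. vdist I x p < r \<longrightarrow> vdist I x' p < r \<longrightarrow>
      (\<forall>j\<in>I. norm ((x' j - x j) - (\<Sum>i\<in>I. B j i * (crit_values_map I x' i - crit_values_map I x i))) \<le> \<epsilon> * vdist I x' x))"
proof -
  let ?n = "of_nat (Suc (card I)) :: complex"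
  let ?f = "crit_points_poly I"
  define \<kappa> where "\<kappa> j = ?n * (\<Prod>l\<in>I - {j}. p j - p l)" for j
  have \<kappa>: "\<kappa> j \<noteq> 0" if "j \<in> I" for j
    using node_products_nonzero[OF that] by (simp add: \<kappa>_def del: of_nat_Suc)
  define B where "B j i = - poly (pderiv (interpolation_basis I p i)) (p j) / \<kappa> j" for j i
  have B: "(\<Sum>i\<in>I. B j i * poly Q (p i)) = - poly (pderiv Q) (p j) / \<kappa> j"
    if "degree Q \<le> card I" "poly Q 0 = 0" for Q j
  proof -
    have "pderiv Q = (\<Sum>i\<in>I. smult (poly Q (p i)) (pderiv (interpolation_basis I p i)))"
      using arg_cong[OF interpolation[OF that], of pderiv] by (simp add: pderiv_sum pderiv_smult)
    then have "poly (pderiv Q) (p j) = (\<Sum>i\<in>I. poly Q (p i) * poly (pderiv (interpolation_basis I p i)) (p j))"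
      by (simp add: poly_sum)
    then show ?thesis by (simp add: B_def sum_divide_distrib sum_negf mult.commute)
  qed
  have "\<forall>i\<in>I. u i = 0" if u: "\<forall>j\<in>I. (\<Sum>i\<in>I. B j i * u i) = 0" for u
  proof
    fix i0 assume i0: "i0 \<in> I"
    define Q where "Q = (\<Sum>i\<in>I. smult (u i) (interpolation_basis I p i))"
    have Q: "degree Q \<le> card I" "poly Q 0 = 0" unfolding Q_def
      by (intro degree_sum_le I order_trans[OF degree_smult_le] degree_interpolation_basis)
         (simp_all add: poly_sum interpolation_basis_0)
    have Qi: "poly Q (p i) = u i" if "i \<in> I" for i
      using that I by (simp add: Q_def poly_sum interpolation_basis_node if_distrib cong: if_cong)
    have "poly (pderiv Q) (p j) = 0" if j: "j \<in> I" for j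
      using B[OF Q, of j] u j \<kappa>[OF j] Qi by simp
    moreover have "degree (pderiv Q) < card (p ` I)"
      using Q(1) i0 I card_gt_0_iff[of I] by (auto simp: degree_pderiv card_image[OF inj])
    ultimately have "pderiv Q = 0"
      by (intro poly_eqI_degree[of "p ` I"]) auto
    then have "Q = 0" using poly_eq_of_pderiv_eq[of Q 0 0] Q(2) by simp
    then show "u i0 = 0" using Qi[OF i0] by simp
  qed
  moreover have "\<exists>r>0. \<forall>x x'. vdist I x p < r \<longrightarrow> vdist I x' p < r \<longrightarrow>
      (\<forall>j\<in>I. norm ((x' j - x j) - (\<Sum>i\<in>I. B j i * (crit_values_map I x' i - crit_values_map I x i))) \<le> \<epsilon> * vdist I x' x)"
    if \<epsilon>: "\<epsilon> > 0" for \<epsilon> :: real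
  proof -
    have "\<forall>i\<in>I. \<exists>k. (\<exists>N. poly_fn I N k) \<and> k p = 0 \<and>
        (\<forall>x. crit_values_map I x i = poly (?f x) (p i) + (x i - p i) * k x)"
      using crit_values_map_difference_quotient[OF I, of _ p] by blast
    from bchoice[OF this] obtain k where k: "\<forall>i\<in>I. (\<exists>N. poly_fn I N (k i)) \<and> k i p = 0 \<and>
        (\<forall>x. crit_values_map I x i = poly (?f x) (p i) + (x i - p i) * k i x)" by (elim exE)
    have k_eq: "crit_values_map I x i = poly (?f x) (p i) + (x i - p i) * k i x" if "i \<in> I" for i x
      using k that by simp
    \<comment> \<open>After interpolation the j-th coordinate of the error is the difference of the values of E j, all of whose terms are products of two functions vanishing at p.\<close>
    define q where "q j x = 1 - ?n / \<kappa> j * (\<Prod>l\<in>I - {j}. p j - x l)" for j x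
    define E where "E j x = (x j - p j) * q j x + (\<Sum>i\<in>I. ((- B j i) * (x i - p i)) * k i x)" for j x
    have E: "(x' j - x j) - (\<Sum>i\<in>I. B j i * (crit_values_map I x' i - crit_values_map I x i)) = E j x' - E j x"
      if j: "j \<in> I" for j x x'
    proof -
      define Q where "Q = ?f x' - ?f x"
      have "coeff Q m = 0" if "m > card I" for m
        using that by (cases "m = Suc (card I)") (auto simp: Q_def coeff_crit_points_poly_top coeff_crit_points_poly_above)
      then have Q: "degree Q \<le> card I" "poly Q 0 = 0" by (auto intro: degree_le simp: Q_def)
      have R: "?n * poly (roots_poly I z) (p j) / \<kappa> j = (p j - z j) * (1 - q j z)" for z
        using j I by (simp add: poly_roots_poly prod.remove[of I j] q_def)
      have "(\<Sum>i\<in>I. B j i * poly Q (p i)) = (p j - x j) * (1 - q j x) - (p j - x' j) * (1 - q j x')"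
        unfolding B[OF Q] R[symmetric]
        by (simp add: Q_def pderiv_diff pderiv_crit_points_poly diff_divide_distrib minus_divide_left)
      moreover have "(\<Sum>i\<in>I. B j i * (crit_values_map I x' i - crit_values_map I x i))
          = (\<Sum>i\<in>I. B j i * poly Q (p i) + (B j i * ((x' i - p i) * k i x') - B j i * ((x i - p i) * k i x)))"
        by (rule sum.cong) (simp_all only: k_eq Q_def poly_diff right_diff_distrib distrib_left, simp)
      ultimately have "(\<Sum>i\<in>I. B j i * (crit_values_map I x' i - crit_values_map I x i))
          = (p j - x j) * (1 - q j x) - (p j - x' j) * (1 - q j x')
            + ((\<Sum>i\<in>I. B j i * ((x' i - p i) * k i x')) - (\<Sum>i\<in>I. B j i * ((x i - p i) * k i x)))"
        by (simp only: sum.distrib sum_subtractf)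
      moreover have E_eq: "E j z = (z j - p j) * q j z - (\<Sum>i\<in>I. B j i * ((z i - p i) * k i z))" for z
        by (simp add: E_def sum_negf mult.assoc)
      moreover have "(b' - b) - A = ((b' - a) * c' - S') - ((b - a) * c - S)"
        if "A = (a - b) * (1 - c) - (a - b') * (1 - c') + (S' - S)" for A a b b' c c' S S' :: complex
        unfolding that by (simp add: algebra_simps)
      ultimately show ?thesis by presburger
    qed
    have flat: "flat_at I p (E j)" if j: "j \<in> I" for j
    proof -
      have "poly_fn I (sum (\<lambda>_. Suc 0) (I - {j})) (\<lambda>x. \<Prod>l\<in>I - {j}. p j - x l)"
        by (intro poly_fn_prod poly_fn_diff poly_fn_const poly_fn_coord I) (use I in auto)
      then have "poly_fn I (sum (\<lambda>_. Suc 0) (I - {j})) (q j)"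
        unfolding q_def by (intro poly_fn_diff poly_fn_const poly_fn_cmult I)
      moreover have "q j p = 0" using \<kappa>[OF j] by (simp add: q_def \<kappa>_def)
      ultimately have "flat_at I p (\<lambda>x. (x j - p j) * q j x)"
        by (intro flat_at_mult[OF I, where N = "Suc 0"] poly_fn_diff poly_fn_const poly_fn_coord I j) auto
      moreover have "flat_at I p (\<lambda>x. ((- B j i) * (x i - p i)) * k i x)" if i: "i \<in> I" for i
      proof -
        obtain N where "poly_fn I N (k i)" "k i p = 0" using k i by blast
        then show ?thesis
          by (intro flat_at_mult[OF I, where N = "Suc 0"] poly_fn_cmult poly_fn_diff poly_fn_const poly_fn_coord I i) auto
      qed
      ultimately show ?thesis unfolding E_def by (intro flat_at_add flat_at_sum I)
    qed
    have "\<forall>j\<in>I. \<exists>r. r > 0 \<and> (\<forall>x x'. vdist I x p < r \<longrightarrow> vdist I x' p < r \<longrightarrow> norm (E j x' - E j x) \<le> \<epsilon> * vdist I x' x)"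
      using flat \<epsilon> unfolding flat_at_def by blast
    from bchoice[OF this] obtain r where r: "\<forall>j\<in>I. r j > 0 \<and>
        (\<forall>x x'. vdist I x p < r j \<longrightarrow> vdist I x' p < r j \<longrightarrow> norm (E j x' - E j x) \<le> \<epsilon> * vdist I x' x)" by (elim exE)
    define r0 where "r0 = Min (insert 1 (r ` I))"
    have r0: "r0 > 0" "\<And>j. j \<in> I \<Longrightarrow> r0 \<le> r j" using r I by (auto simp: r0_def)
    have "norm (E j x' - E j x) \<le> \<epsilon> * vdist I x' x" if "j \<in> I" "vdist I x p < r0" "vdist I x' p < r0" for j x x'
    proof -
      have "vdist I x p < r j" "vdist I x' p < r j" using that r0(2)[OF that(1)] by auto
      then show ?thesis using r that(1) by blast
    qed
    then show ?thesis using r0(1) E by (intro exI[of _ r0]) auto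
  qed
  ultimately show ?thesis by blast
qed

end

text \<open>Non-zero exactly on the ordered configurations of distinct non-zero points.\<close>
definition config_disc :: "'i set \<Rightarrow> ('i \<Rightarrow> complex) \<Rightarrow> complex" where
  "config_disc I y = (\<Prod>i\<in>I. y i) * (\<Prod>(i, j)\<in>I \<times> I - Id. y i - y j)"

lemma config_disc_nonzero_iff:
  "finite I \<Longrightarrow> config_disc I y \<noteq> 0 \<longleftrightarrow> inj_on y I \<and> (\<forall>i\<in>I. y i \<noteq> 0)"
proof -
  assume "finite I"
  moreover have "(\<forall>q\<in>I \<times> I - Id. y (fst q) \<noteq> y (snd q)) \<longleftrightarrow> inj_on y I"
  proof
    assume *: "\<forall>q\<in>I \<times> I - Id. y (fst q) \<noteq> y (snd q)"
    show "inj_on y I"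
    proof (rule inj_onI, rule ccontr)
      fix a b assume "a \<in> I" "b \<in> I" "y a = y b" "a \<noteq> b"
      then show False using bspec[OF *, of "(a, b)"] by simp
    qed
  qed (auto simp: inj_on_def)
  ultimately show ?thesis by (auto simp: config_disc_def case_prod_unfold)
qed

lemma poly_fn_config_disc:
  assumes I: "finite I" shows "poly_fn I (card I + card (I \<times> I - Id)) (config_disc I)"
proof -
  have "poly_fn I ((\<Sum>i\<in>I. Suc 0) + (\<Sum>q\<in>I \<times> I - Id. Suc 0)) (\<lambda>y. (\<Prod>i\<in>I. y i) * (\<Prod>q\<in>I \<times> I - Id. y (fst q) - y (snd q)))"
    by (intro poly_fn_mult poly_fn_prod poly_fn_diff poly_fn_coord I) (use I in auto)
  moreover have "config_disc I = (\<lambda>y. (\<Prod>i\<in>I. y i) * (\<Prod>q\<in>I \<times> I - Id. y (fst q) - y (snd q)))"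
    by (simp add: config_disc_def fun_eq_iff case_prod_unfold)
  ultimately show ?thesis by simp
qed

lemma monic_eq_roots_poly:
  assumes "finite I" "lead_coeff f = 1" "degree f = card I" "inj_on r I" "\<And>i. i \<in> I \<Longrightarrow> poly f (r i) = 0"
  shows "f = roots_poly I r"
proof -
  have "coeff (f - roots_poly I r) (card I) = 0"
    using assms(2,3) coeff_roots_poly_top[of I r] by simp
  moreover have "degree (f - roots_poly I r) \<le> card I"
    using assms(3) by (intro degree_diff_le) (auto simp: degree_roots_poly)
  ultimately have "f - roots_poly I r = 0 \<or> degree (f - roots_poly I r) < card I"
    by (metis leading_coeff_0_iff le_neq_implies_less)
  moreover have "f - roots_poly I r = 0" if "degree (f - roots_poly I r) < card I"
    by (rule poly_eqI_degree[of "r ` I"])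
       (use that assms in \<open>auto simp: card_image poly_roots_poly_eq_0 intro!: degree_diff_less\<close>)
  ultimately show ?thesis by auto
qed

text \<open>For \<open>z\<^sup>m\<^sup>+\<^sup>1 - (m + 1) z\<close> the critical points are the \<open>m\<close>-th roots of unity \<open>\<omega>\<close>, with values \<open>- m \<omega>\<close>.\<close>
lemma ex_distinct_crit_values:
  assumes I: "finite I"
  shows "\<exists>c. config_disc I (crit_values_map I c) \<noteq> 0"
proof (cases "I = {}")
  case False
  define m where "m = card I"
  have m: "m > 0" using I False by (simp add: m_def card_gt_0_iff)
  have "card I = card {z::complex. z ^ m = 1}" using card_roots_unity_eq[OF m] by (simp add: m_def)
  then obtain c where c: "bij_betw c I {z::complex. z ^ m = 1}"
    using finite_same_card_bij[OF I finite_roots_unity[of m]] m by auto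
  have cm: "c i ^ m = 1" if "i \<in> I" for i using bij_betwE[OF c] that by auto
  have "monom 1 m - 1 = roots_poly I c"
  proof (rule monic_eq_roots_poly[OF I])
    have d: "degree (monom 1 m - 1 :: complex poly) = m"
      using m by (subst degree_add_eq_left[of "-1", simplified]) (auto simp: degree_monom_eq)
    show "degree (monom 1 m - 1 :: complex poly) = card I" using d by (simp add: m_def)
    show "lead_coeff (monom 1 m - 1 :: complex poly) = 1" unfolding d using m by simp
    show "inj_on c I" using c by (simp add: bij_betw_def)
    show "poly (monom 1 m - 1) (c i) = 0" if "i \<in> I" for i using cm[OF that] by (simp add: poly_monom)
  qed
  then have pd: "pderiv (crit_points_poly I c) = smult (of_nat (Suc m)) (monom 1 m - 1)"
    by (simp add: pderiv_crit_points_poly m_def)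
  have fp: "crit_points_poly I c = monom 1 (Suc m) - smult (of_nat (Suc m)) [:0, 1:]"
  proof (rule poly_eq_of_pderiv_eq[of _ _ 0])
    show "pderiv (crit_points_poly I c) = pderiv (monom 1 (Suc m) - smult (of_nat (Suc m)) [:0, 1:])"
      unfolding pd by (simp add: pderiv_diff pderiv_monom pderiv_smult pderiv_pCons smult_diff_right smult_monom del: of_nat_Suc)
  qed (simp add: poly_monom)
  have val: "crit_values_map I c i = - of_nat m * c i" if "i \<in> I" for i
    unfolding crit_values_map_def fp using cm[OF that] by (simp add: poly_monom algebra_simps)
  have "c i \<noteq> 0" if "i \<in> I" for i using cm[OF that] m by (auto simp: power_0_left)
  then have "config_disc I (crit_values_map I c) \<noteq> 0"
    using c m val unfolding config_disc_nonzero_iff[OF I] by (auto simp: bij_betw_def inj_on_def)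
  then show ?thesis by blast
qed (simp add: config_disc_def)

lemma crit_points_of_distinct_crit_values:
  assumes I: "finite I" and d: "config_disc I (crit_values_map I c) \<noteq> 0"
  shows "inj_on c I" "\<And>i. i \<in> I \<Longrightarrow> c i \<noteq> 0"
proof -
  have "inj_on (crit_values_map I c) I" and nz: "\<And>i. i \<in> I \<Longrightarrow> crit_values_map I c i \<noteq> 0"
    using d config_disc_nonzero_iff[OF I] by blast+
  then show "inj_on c I" unfolding inj_on_def crit_values_map_def by metis
  show "c i \<noteq> 0" if "i \<in> I" for i
    using nz[OF that] poly_crit_points_poly_0[of I c] unfolding crit_values_map_def by metis
qed

lemma finite_polynomial_map_crit_values_map:
  assumes I: "finite I"
  shows "finite_polynomial_map I (Suc (card I)) (crit_values_map I) (config_disc I) (card I + card (I \<times> I - Id))"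
proof
  show "finite I" by (rule I)
  show "0 < Suc (card I)" by simp
  show "poly_fn I (Suc (card I)) (\<lambda>x. crit_values_map I x j)" if "j \<in> I" for j
    by (rule poly_fn_crit_values_map[OF I that])
  show "poly_fn I (card I + card (I \<times> I - Id)) (config_disc I)" by (rule poly_fn_config_disc[OF I])
  show "\<exists>K. \<forall>x. nrm I x ^ Suc (card I) \<le> K * nrm I (crit_values_map I x)" by (rule crit_values_map_proper[OF I])
  show "\<exists>x. config_disc I (crit_values_map I x) \<noteq> 0" by (rule ex_distinct_crit_values[OF I])
  show "\<exists>B. (\<forall>u. (\<forall>j\<in>I. (\<Sum>i\<in>I. B j i * u i) = 0) \<longrightarrow> (\<forall>i\<in>I. u i = 0)) \<and>
        (\<forall>\<epsilon>>0. \<exists>r>0. \<forall>x x'. vdist I x p < r \<longrightarrow> vdist I x' p < r \<longrightarrow>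
          (\<forall>j\<in>I. norm ((x' j - x j) - (\<Sum>i\<in>I. B j i * (crit_values_map I x' i - crit_values_map I x i))) \<le> \<epsilon> * vdist I x' x))"
    if "config_disc I (crit_values_map I p) \<noteq> 0" for p
    by (rule crit_values_map_strict_left_inverse[OF I crit_points_of_distinct_crit_values[OF I that]])
qed

section \<open>Covering maps and quotient spaces\<close>

text \<open>A name for the local condition in the definition of covering maps, which keeps the quantifiers over sheets out of later proofs.\<close>
definition evenly_covered :: "'a topology \<Rightarrow> 'b topology \<Rightarrow> ('a \<Rightarrow> 'b) \<Rightarrow> 'b set \<Rightarrow> bool" where
  "evenly_covered X Y p T \<longleftrightarrow> openin Y T \<and>
     (\<exists>\<V>. \<Union>\<V> = {x \<in> topspace X. p x \<in> T} \<and> (\<forall>U \<in> \<V>. openin X U) \<and> pairwise disjnt \<V> \<and>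
        (\<forall>U \<in> \<V>. homeomorphic_map (subtopology X U) (subtopology Y T) p))"

lemma covering_map_of_degree_iff:
  "covering_map_of_degree d X Y p \<longleftrightarrow> continuous_map X Y p \<and> p ` topspace X = topspace Y \<and>
     (\<forall>y\<in>topspace Y. \<exists>T. y \<in> T \<and> evenly_covered X Y p T) \<and>
     (\<forall>y\<in>topspace Y. card {x \<in> topspace X. p x = y} = d)"
  unfolding covering_map_of_degree_def covering_map_def evenly_covered_def by (simp only: conj_assoc)

text \<open>The sheets are the images of the sections.  Each of them is open because it is the complement of the finitely many others, and
these are closed as coincidence sets of maps into a Hausdorff space.\<close>
lemma covering_map_of_degreeI_sections:
  fixes p :: "'a \<Rightarrow> 'b"
  assumes X: "Hausdorff_space X" and p: "continuous_map X Y p" and d: "d > 0"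
    and loc: "\<And>y. y \<in> topspace Y \<Longrightarrow> \<exists>T (J :: 'j set) s. openin Y T \<and> y \<in> T \<and> card J = d \<and>
      (\<forall>j\<in>J. continuous_map (subtopology Y T) X (s j)) \<and> (\<forall>j\<in>J. \<forall>t\<in>T. p (s j t) = t) \<and>
      (\<forall>t\<in>T. inj_on (\<lambda>j. s j t) J) \<and> (\<forall>x\<in>topspace X. p x \<in> T \<longrightarrow> (\<exists>j\<in>J. s j (p x) = x))"
  shows "covering_map_of_degree d X Y p"
proof -
  have main: "(\<exists>T. y \<in> T \<and> evenly_covered X Y p T) \<and> card {x \<in> topspace X. p x = y} = d" if y: "y \<in> topspace Y" for y
  proof -
    from loc[OF y] obtain T and J :: "'j set" and s where "openin Y T" "y \<in> T" and J: "card J = d"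
      and s': "\<forall>j\<in>J. continuous_map (subtopology Y T) X (s j)" and ps': "\<forall>j\<in>J. \<forall>t\<in>T. p (s j t) = t"
      and inj': "\<forall>t\<in>T. inj_on (\<lambda>j. s j t) J"
      and all': "\<forall>x\<in>topspace X. p x \<in> T \<longrightarrow> (\<exists>j\<in>J. s j (p x) = x)"
      by (elim exE conjE)
    note T = \<open>openin Y T\<close> \<open>y \<in> T\<close> and s = s'[rule_format] and ps = ps'[rule_format]
      and inj = inj'[rule_format] and all = all'[rule_format]
    have finJ: "finite J" using J d card_ge_0_finite by blast
    have TY: "T \<subseteq> topspace Y" by (rule openin_subset[OF T(1)])
    have sX: "s j t \<in> topspace X" if "j \<in> J" "t \<in> T" for j t
      using continuous_map_image_subset_topspace[OF s[OF that(1)]] that(2) TY by auto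
    define P where "P = {x \<in> topspace X. p x \<in> T}"
    have P: "openin X P" unfolding P_def by (rule openin_continuous_map_preimage[OF p T(1)])
    define U where "U j = {x \<in> P. s j (p x) = x}" for j
    have pP: "continuous_map (subtopology X P) (subtopology Y T) p"
      by (auto simp: continuous_map_in_subtopology P_def intro: continuous_map_from_subtopology[OF p])
    have topP: "topspace (subtopology X P) = P" by (auto simp: P_def)
    have closedU: "closedin (subtopology X P) (U j)" if "j \<in> J" for j
    proof -
      have "closedin (subtopology X P) {x \<in> topspace (subtopology X P). (s j \<circ> p) x = x}"
        by (rule closedin_continuous_maps_eq[OF X continuous_map_compose[OF pP s[OF that]]])
           (rule continuous_map_from_subtopology[OF continuous_map_id[unfolded id_def]])
      then show ?thesis by (simp only: topP U_def o_apply)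
    qed
    have U_eq: "U j = P - (\<Union>i\<in>J - {j}. U i)" if j: "j \<in> J" for j
    proof (intro set_eqI iffI)
      fix x assume x: "x \<in> U j"
      have "x \<notin> U i" if "i \<in> J - {j}" for i
      proof
        assume "x \<in> U i"
        then have "s i (p x) = s j (p x)" "p x \<in> T" using x by (simp_all add: U_def P_def)
        then show False using inj_onD[OF inj, of "p x" i j] that j by simp
      qed
      moreover have "x \<in> P" using x by (simp add: U_def)
      ultimately show "x \<in> P - (\<Union>i\<in>J - {j}. U i)" by blast
    next
      fix x assume x: "x \<in> P - (\<Union>i\<in>J - {j}. U i)"
      then obtain i where "i \<in> J" "s i (p x) = x" using all[of x] by (auto simp: P_def)
      then have "x \<in> U i" using x by (simp add: U_def)
      then show "x \<in> U j" using x \<open>i \<in> J\<close> by (cases "i = j") simp_all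
    qed
    have openU: "openin X (U j)" if j: "j \<in> J" for j
    proof (rule openin_trans_full[OF _ P])
      have "closedin (subtopology X P) (\<Union>i\<in>J - {j}. U i)"
        by (rule closedin_Union) (use finJ closedU in auto)
      then have "openin (subtopology X P) (topspace (subtopology X P) - (\<Union>i\<in>J - {j}. U i))"
        by (rule openin_diff[OF openin_topspace])
      then show "openin (subtopology X P) (U j)" using U_eq[OF j] by (simp only: topP)
    qed
    have homeo: "homeomorphic_map (subtopology X (U j)) (subtopology Y T) p" if j: "j \<in> J" for j
      unfolding homeomorphic_map_maps homeomorphic_maps_def
    proof (intro exI[of _ "s j"] conjI ballI)
      show "continuous_map (subtopology X (U j)) (subtopology Y T) p"
        unfolding continuous_map_in_subtopology
        by (intro conjI continuous_map_from_subtopology[OF p]) (simp add: U_def P_def Pi_iff)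
      show "continuous_map (subtopology Y T) (subtopology X (U j)) (s j)"
        unfolding continuous_map_in_subtopology
        by (intro conjI s[OF j]) (simp add: U_def P_def Pi_iff sX[OF j] ps[OF j])
      show "s j (p x) = x" if "x \<in> topspace (subtopology X (U j))" for x
        using that by (simp add: U_def)
      show "p (s j t) = t" if "t \<in> topspace (subtopology Y T)" for t
        using that ps[OF j] by simp
    qed
    have "\<Union>(U ` J) = P"
    proof
      show "P \<subseteq> \<Union>(U ` J)"
      proof
        fix x assume x: "x \<in> P"
        then obtain i where "i \<in> J" "s i (p x) = x" using all[of x] by (auto simp: P_def)
        then show "x \<in> \<Union>(U ` J)" using x by (auto simp: U_def)
      qed
    qed (auto simp: U_def)
    then have "\<Union>(U ` J) = {x \<in> topspace X. p x \<in> T}" by (simp only: P_def)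
    moreover have "pairwise disjnt (U ` J)"
    proof (rule pairwiseI)
      fix A B assume "A \<in> U ` J" "B \<in> U ` J" "A \<noteq> B"
      then obtain i j where ij: "i \<in> J" "j \<in> J" "A = U i" "B = U j" "i \<noteq> j" by auto
      show "disjnt A B" using U_eq[OF ij(1)] ij by (auto simp: disjnt_def)
    qed
    ultimately have ec: "evenly_covered X Y p T"
      unfolding evenly_covered_def using T(1) openU homeo by (intro conjI exI[of _ "U ` J"]) simp_all
    have fib: "{x \<in> topspace X. p x = y} = (\<lambda>j. s j y) ` J"
    proof
      show "{x \<in> topspace X. p x = y} \<subseteq> (\<lambda>j. s j y) ` J"
      proof
        fix x assume x: "x \<in> {x \<in> topspace X. p x = y}"
        then obtain j where "j \<in> J" "s j y = x" using all[of x] T(2) by auto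
        then show "x \<in> (\<lambda>j. s j y) ` J" by blast
      qed
      show "(\<lambda>j. s j y) ` J \<subseteq> {x \<in> topspace X. p x = y}"
        using sX[OF _ T(2)] ps[OF _ T(2)] by (simp add: image_subset_iff)
    qed
    have "card {x \<in> topspace X. p x = y} = d"
      unfolding fib using card_image[OF inj[OF T(2)]] J by simp
    with ec T(2) show ?thesis by blast
  qed
  have "topspace Y \<subseteq> p ` topspace X"
  proof
    fix y assume "y \<in> topspace Y"
    then have "card {x \<in> topspace X. p x = y} = d" using main by blast
    then have "{x \<in> topspace X. p x = y} \<noteq> {}" using d by (metis card.empty less_irrefl)
    then show "y \<in> p ` topspace X" by blast
  qed
  then have "p ` topspace X = topspace Y"
    using continuous_map_image_subset_topspace[OF p] by blast
  then show ?thesis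
    unfolding covering_map_of_degree_iff using p main by blast
qed

lemma covering_map_of_degree_restrict:
  assumes cov: "covering_map_of_degree d X Y p" and S: "S \<subseteq> topspace Y"
  shows "covering_map_of_degree d (subtopology X {x \<in> topspace X. p x \<in> S}) (subtopology Y S) p"
proof -
  define P where "P = {x \<in> topspace X. p x \<in> S}"
  have p: "continuous_map X Y p" and surj: "p ` topspace X = topspace Y"
    and card: "\<And>y. y \<in> topspace Y \<Longrightarrow> card {x \<in> topspace X. p x = y} = d"
    and loc: "\<And>y. y \<in> topspace Y \<Longrightarrow> \<exists>T. y \<in> T \<and> evenly_covered X Y p T"
    using cov unfolding covering_map_of_degree_iff by blast+
  have topP: "topspace (subtopology X P) = P" and topS: "topspace (subtopology Y S) = S"
    using S by (auto simp: P_def)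
  have 1: "continuous_map (subtopology X P) (subtopology Y S) p"
    by (auto simp: continuous_map_in_subtopology P_def intro: continuous_map_from_subtopology[OF p])
  have 2: "p ` P = S"
  proof
    show "S \<subseteq> p ` P"
    proof
      fix y assume "y \<in> S"
      moreover from this obtain x where "x \<in> topspace X" "y = p x" using surj S by blast
      ultimately show "y \<in> p ` P" by (simp add: P_def)
    qed
  qed (auto simp: P_def)
  have 3: "\<exists>T. y \<in> T \<and> evenly_covered (subtopology X P) (subtopology Y S) p T"
    if y: "y \<in> S" for y
  proof -
    have "y \<in> topspace Y" using y S by blast
    from loc[OF this] obtain T where "y \<in> T" and ec: "evenly_covered X Y p T" by (elim exE conjE)
    from ec obtain \<V> where "openin Y T" and V1: "\<Union>\<V> = {x \<in> topspace X. p x \<in> T}" and V2: "\<forall>U \<in> \<V>. openin X U"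
      and V3: "pairwise disjnt \<V>" and V4: "\<forall>U \<in> \<V>. homeomorphic_map (subtopology X U) (subtopology Y T) p"
      unfolding evenly_covered_def by (elim exE conjE)
    note T = \<open>y \<in> T\<close> \<open>openin Y T\<close> and V = V1 V2[rule_format] V3 V4[rule_format]
    have homeo: "homeomorphic_map (subtopology (subtopology X P) (U \<inter> P)) (subtopology (subtopology Y S) (T \<inter> S)) p"
      if U: "U \<in> \<V>" for U
    proof -
      have UX: "U \<subseteq> topspace X" by (rule openin_subset[OF V(2)[OF U]])
      have "p ` U = T"
        using homeomorphic_imp_surjective_map[OF V(4)[OF U]] UX openin_subset[OF T(2)] by (simp add: Int_absorb1)
      moreover have "topspace (subtopology X U) = U" "topspace (subtopology Y T) = T"
        using UX openin_subset[OF T(2)] by (simp_all add: Int_absorb1)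
      moreover have "p ` (U \<inter> P) = p ` U \<inter> S" using UX unfolding P_def by blast
      ultimately have "p ` (topspace (subtopology X U) \<inter> P) = topspace (subtopology Y T) \<inter> S" by (simp only:)
      from homeomorphic_map_subtopologies[OF V(4)[OF U] this] show ?thesis
        unfolding subtopology_subtopology by (simp only: Int_commute Int_left_commute Int_assoc Int_left_absorb Int_absorb)
    qed
    have "\<Union>((\<lambda>U. U \<inter> P) ` \<V>) = {x \<in> P. p x \<in> T \<inter> S}"
    proof -
      have "\<Union>((\<lambda>U. U \<inter> P) ` \<V>) = \<Union>\<V> \<inter> P" by blast
      also have "\<dots> = {x \<in> P. p x \<in> T \<inter> S}" unfolding V(1) P_def by blast
      finally show ?thesis .
    qed
    moreover have "\<forall>U\<in>(\<lambda>U. U \<inter> P) ` \<V>. openin (subtopology X P) U"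
      using V(2) by (simp add: openin_subtopology_Int)
    moreover have "pairwise disjnt ((\<lambda>U. U \<inter> P) ` \<V>)"
    proof (rule pairwiseI)
      fix A B assume "A \<in> (\<lambda>U. U \<inter> P) ` \<V>" "B \<in> (\<lambda>U. U \<inter> P) ` \<V>" "A \<noteq> B"
      then obtain U U' where "U \<in> \<V>" "U' \<in> \<V>" "A = U \<inter> P" "B = U' \<inter> P" "U \<noteq> U'" by auto
      then have "disjnt U U'" using pairwiseD[OF V(3)] by simp
      then show "disjnt A B" unfolding \<open>A = U \<inter> P\<close> \<open>B = U' \<inter> P\<close> disjnt_def by blast
    qed
    moreover have "openin (subtopology Y S) (T \<inter> S)" using T(2) by (simp add: openin_subtopology_Int)
    moreover have "\<forall>U\<in>(\<lambda>U. U \<inter> P) ` \<V>. homeomorphic_map (subtopology (subtopology X P) U) (subtopology (subtopology Y S) (T \<inter> S)) p"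
      using homeo by blast
    ultimately have "evenly_covered (subtopology X P) (subtopology Y S) p (T \<inter> S)"
      unfolding evenly_covered_def topP by (intro conjI exI[of _ "(\<lambda>U. U \<inter> P) ` \<V>"])
    then show ?thesis using T(1) y by blast
  qed
  have 4: "card {x \<in> P. p x = y} = d" if y: "y \<in> S" for y
  proof -
    have "{x \<in> P. p x = y} = {x \<in> topspace X. p x = y}" using y by (auto simp: P_def)
    moreover have "y \<in> topspace Y" using y S by blast
    ultimately show ?thesis using card by (simp only:)
  qed
  show ?thesis
    unfolding covering_map_of_degree_iff P_def[symmetric] topP topS by (intro conjI ballI 1 2 3 4)
qed

lemma covering_map_of_degree_lift_homeomorphism:
  assumes cov: "covering_map_of_degree d X Y p" and \<kappa>: "homeomorphic_map Y' Y \<kappa>"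
    and q: "\<And>x. x \<in> topspace X \<Longrightarrow> q x \<in> topspace Y' \<and> \<kappa> (q x) = p x"
  shows "covering_map_of_degree d X Y' q"
proof -
  have p: "continuous_map X Y p" and surj: "p ` topspace X = topspace Y"
    and card: "\<And>y. y \<in> topspace Y \<Longrightarrow> card {x \<in> topspace X. p x = y} = d"
    and loc: "\<And>y. y \<in> topspace Y \<Longrightarrow> \<exists>T. y \<in> T \<and> evenly_covered X Y p T"
    using cov unfolding covering_map_of_degree_iff by blast+
  obtain \<mu> where l: "continuous_map Y' Y \<kappa>" "continuous_map Y Y' \<mu>"
    "\<And>y. y \<in> topspace Y' \<Longrightarrow> \<mu> (\<kappa> y) = y" "\<And>y. y \<in> topspace Y \<Longrightarrow> \<kappa> (\<mu> y) = y"
    using \<kappa> unfolding homeomorphic_map_maps homeomorphic_maps_def by blast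
  have homl: "homeomorphic_map Y Y' \<mu>"
    unfolding homeomorphic_map_maps homeomorphic_maps_def using l by blast
  have l_img: "\<mu> y \<in> topspace Y'" if "y \<in> topspace Y" for y
    using continuous_map_image_subset_topspace[OF l(2)] that by blast
  have k_img: "\<kappa> y \<in> topspace Y" if "y \<in> topspace Y'" for y
    using continuous_map_image_subset_topspace[OF l(1)] that by blast
  have ql: "q x = (\<mu> \<circ> p) x" if "x \<in> topspace X" for x using l(3)[OF conjunct1[OF q[OF that]]] conjunct2[OF q[OF that]] by simp
  have 1: "continuous_map X Y' q"
    by (rule continuous_map_eq[OF continuous_map_compose[OF p l(2)]]) (simp only: ql)
  have 2: "q ` topspace X = topspace Y'"
  proof
    show "q ` topspace X \<subseteq> topspace Y'" using q by blast
    show "topspace Y' \<subseteq> q ` topspace X"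
    proof
      fix y assume y: "y \<in> topspace Y'"
      then obtain x where "x \<in> topspace X" "p x = \<kappa> y" using surj k_img by (metis imageE)
      then have "q x = y" using ql[of x] l(3)[OF y] by simp
      then show "y \<in> q ` topspace X" using \<open>x \<in> topspace X\<close> by blast
    qed
  qed
  have 3: "\<exists>T. y \<in> T \<and> evenly_covered X Y' q T"
    if y: "y \<in> topspace Y'" for y
  proof -
    from loc[OF k_img[OF y]] obtain T where "\<kappa> y \<in> T" and ec: "evenly_covered X Y p T" by (elim exE conjE)
    from ec obtain \<V> where "openin Y T" and V1: "\<Union>\<V> = {x \<in> topspace X. p x \<in> T}" and V2: "\<forall>U \<in> \<V>. openin X U"
      and V3: "pairwise disjnt \<V>" and V4: "\<forall>U \<in> \<V>. homeomorphic_map (subtopology X U) (subtopology Y T) p"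
      unfolding evenly_covered_def by (elim exE conjE)
    note T = \<open>\<kappa> y \<in> T\<close> \<open>openin Y T\<close> and V = V1 V2 V3 V4[rule_format]
    define T' where "T' = {y \<in> topspace Y'. \<kappa> y \<in> T}"
    have T'1: "openin Y' T'" unfolding T'_def by (rule openin_continuous_map_preimage[OF l(1) T(2)])
    have T'2: "y \<in> T'" using y T by (simp add: T'_def)
    have T'3: "{x \<in> topspace X. p x \<in> T} = {x \<in> topspace X. q x \<in> T'}"
      unfolding T'_def by (rule Collect_cong) (use q in force)
    have T'4: "homeomorphic_map (subtopology X U) (subtopology Y' T') q" if U: "U \<in> \<V>" for U
    proof -
      have TY: "T \<subseteq> topspace Y" by (rule openin_subset[OF T(2)])
      have "\<mu> ` (topspace Y \<inter> T) = topspace Y' \<inter> T'"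
      proof (intro set_eqI iffI)
        fix z assume "z \<in> topspace Y' \<inter> T'"
        then have "\<kappa> z \<in> topspace Y \<inter> T" "\<mu> (\<kappa> z) = z" using l(3)[of z] k_img[of z] by (simp_all add: T'_def)
        then show "z \<in> \<mu> ` (topspace Y \<inter> T)" by (metis imageI)
      next
        fix z assume "z \<in> \<mu> ` (topspace Y \<inter> T)"
        then obtain t where "t \<in> topspace Y" "t \<in> T" "z = \<mu> t" by blast
        then show "z \<in> topspace Y' \<inter> T'" using l(4)[of t] l_img[of t] by (simp add: T'_def)
      qed
      then have "homeomorphic_map (subtopology Y T) (subtopology Y' T') \<mu>"
        by (rule homeomorphic_map_subtopologies[OF homl])
      from homeomorphic_map_compose[OF V(4)[OF U] this] show ?thesis
        by (rule homeomorphic_map_eq) (simp add: ql)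
    qed
    have "evenly_covered X Y' q T'"
      unfolding evenly_covered_def T'3[symmetric] using T'1 V(1-3) T'4 by (intro conjI exI[of _ \<V>]) simp_all
    then show ?thesis using T'2 by blast
  qed
  have 4: "card {x \<in> topspace X. q x = y} = d" if y: "y \<in> topspace Y'" for y
  proof -
    have "q x = y \<longleftrightarrow> p x = \<kappa> y" if "x \<in> topspace X" for x
      using q[OF that] l(3)[OF y] l(3)[of "q x"] by metis
    then have "{x \<in> topspace X. q x = y} = {x \<in> topspace X. p x = \<kappa> y}" by auto
    then show ?thesis using card[OF k_img[OF y]] by simp
  qed
  show ?thesis
    unfolding covering_map_of_degree_iff by (intro conjI ballI 1 2 3 4)
qed

lemma continuous_map_locally:
  assumes "\<And>x. x \<in> topspace X \<Longrightarrow> \<exists>T. openin X T \<and> x \<in> T \<and> continuous_map (subtopology X T) Y f"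
  shows "continuous_map X Y f"
proof -
  from assms obtain T where T: "\<And>x. x \<in> topspace X \<Longrightarrow> openin X (T x)" "\<And>x. x \<in> topspace X \<Longrightarrow> x \<in> T x"
    "\<And>x. x \<in> topspace X \<Longrightarrow> continuous_map (subtopology X (T x)) Y f" by metis
  show ?thesis by (rule pasting_lemma[of "topspace X" X T Y "\<lambda>_. f"]) (use T in auto)
qed

text \<open>Local sections of \<open>g\<close> make the inverse of the induced bijection continuous, so no openness of \<open>g\<close> has to be shown.\<close>
lemma quotient_topology_homeomorphism:
  assumes g: "continuous_map X Z g"
    and eq: "\<And>x x'. x \<in> topspace X \<Longrightarrow> x' \<in> topspace X \<Longrightarrow> q x = q x' \<longleftrightarrow> g x = g x'"
    and sec: "\<And>z. z \<in> topspace Z \<Longrightarrow> \<exists>T s. openin Z T \<and> z \<in> T \<and> continuous_map (subtopology Z T) X s \<and> (\<forall>t\<in>T. g (s t) = t)"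
  obtains \<kappa> where "homeomorphic_map (quotient_topology X q) Z \<kappa>" "\<And>x. x \<in> topspace X \<Longrightarrow> \<kappa> (q x) = g x"
proof -
  define \<kappa> where "\<kappa> c = g (SOME x. x \<in> topspace X \<and> q x = c)" for c
  have \<kappa>: "\<kappa> (q x) = g x" if "x \<in> topspace X" for x
  proof -
    have "\<exists>x'. x' \<in> topspace X \<and> q x' = q x" using that by blast
    from someI_ex[OF this] show ?thesis unfolding \<kappa>_def using eq that by blast
  qed
  have quo: "quotient_map X (quotient_topology X q) q" by (rule quotient_map_quotient_topology)
  have cont: "continuous_map (quotient_topology X q) Z \<kappa>"
    by (rule continuous_compose_quotient_map[OF quo], rule continuous_map_eq[OF g]) (simp add: \<kappa>)
  have pre: "\<exists>x\<in>topspace X. g x = z" if z: "z \<in> topspace Z" for z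
  proof -
    from sec[OF z] obtain T s where "z \<in> T" "continuous_map (subtopology Z T) X s" "\<forall>t\<in>T. g (s t) = t" by blast
    then show ?thesis using continuous_map_image_subset_topspace[of "subtopology Z T" X s] z
      by (intro bexI[of _ "s z"]) auto
  qed
  define \<mu> where "\<mu> z = q (SOME x. x \<in> topspace X \<and> g x = z)" for z
  have l: "\<mu> (g x) = q x" if "x \<in> topspace X" for x
  proof -
    have "\<exists>x'. x' \<in> topspace X \<and> g x' = g x" using that by blast
    from someI_ex[OF this] show ?thesis unfolding \<mu>_def using eq that by blast
  qed
  have "continuous_map Z (quotient_topology X q) \<mu>"
  proof (rule continuous_map_locally)
    fix z assume "z \<in> topspace Z"
    from sec[OF this] obtain T s where T: "openin Z T" "z \<in> T" and s: "continuous_map (subtopology Z T) X s"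
      "\<forall>t\<in>T. g (s t) = t" by blast
    have "continuous_map (subtopology Z T) (quotient_topology X q) (q \<circ> s)"
      by (rule continuous_map_compose[OF s(1) quotient_imp_continuous_map[OF quo]])
    then have "continuous_map (subtopology Z T) (quotient_topology X q) \<mu>"
    proof (rule continuous_map_eq)
      fix t assume t: "t \<in> topspace (subtopology Z T)"
      then have "s t \<in> topspace X" using continuous_map_image_subset_topspace[OF s(1)] by blast
      from l[OF this] show "(q \<circ> s) t = \<mu> t" using s(2) t by simp
    qed
    then show "\<exists>T. openin Z T \<and> z \<in> T \<and> continuous_map (subtopology Z T) (quotient_topology X q) \<mu>"
      using T by blast
  qed
  moreover have "\<mu> (\<kappa> c) = c" if "c \<in> topspace (quotient_topology X q)" for c
    using that \<kappa> l by auto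
  moreover have "\<kappa> (\<mu> z) = z" if "z \<in> topspace Z" for z
    using pre[OF that] \<kappa> l by auto
  ultimately have "homeomorphic_map (quotient_topology X q) Z \<kappa>"
    unfolding homeomorphic_map_maps homeomorphic_maps_def using cont by blast
  then show ?thesis using \<kappa> by (rule that)
qed

section \<open>The topology of spaces of polynomials\<close>

lemma continuous_map_poly_fn:
  assumes I: "finite I" and a: "\<And>i. i \<in> I \<Longrightarrow> continuous_map X euclidean (\<lambda>x. a x i)" and h: "poly_fn I N h"
  shows "continuous_map X euclidean (\<lambda>x. h (a x))"
  using I h
proof (induction rule: poly_fn_induct)
  case (mult f g)
  then show ?case by (simp add: continuous_map_atin tendsto_mult)
qed (simp_all add: a continuous_map_add)

lemma continuous_map_euclideanI_dist:
  fixes f :: "'a \<Rightarrow> 'b::metric_space"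
  assumes "\<And>x \<epsilon>. x \<in> topspace X \<Longrightarrow> \<epsilon> > 0 \<Longrightarrow> \<exists>U. openin X U \<and> x \<in> U \<and> (\<forall>y\<in>U. dist (f y) (f x) < \<epsilon>)"
  shows "continuous_map X euclidean f"
  unfolding continuous_map_atin limitin_canonical_iff tendsto_iff eventually_atin
  using assms by (metis DiffD1)

lemma continuous_map_coeff: "continuous_map coeff_top euclidean (\<lambda>f. coeff f k)"
proof -
  have "continuous_map coeff_top euclidean ((\<lambda>x. x k) \<circ> coeff)"
    unfolding coeff_top_def by (rule continuous_map_pullback) (rule continuous_map_product_projection, simp)
  then show ?thesis by (simp add: o_def)
qed

lemma continuous_map_coeff_top_iff:
  "continuous_map X coeff_top g \<longleftrightarrow> (\<forall>k. continuous_map X euclidean (\<lambda>x. coeff (g x) k))"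
proof
  assume "continuous_map X coeff_top g"
  from continuous_map_compose[OF this continuous_map_coeff]
  show "\<forall>k. continuous_map X euclidean (\<lambda>x. coeff (g x) k)" by (simp add: o_def)
next
  assume "\<forall>k. continuous_map X euclidean (\<lambda>x. coeff (g x) k)"
  then show "continuous_map X coeff_top g"
    unfolding coeff_top_def by (intro continuous_map_pullback') (simp_all add: continuous_map_componentwise_UNIV)
qed

lemma topspace_coeff_top [simp]: "topspace coeff_top = UNIV"
  by (simp add: coeff_top_def topspace_pullback_topology)

lemma Hausdorff_space_coeff_top: "Hausdorff_space coeff_top"
proof (rule Hausdorff_space_injective_preimage)
  show "Hausdorff_space (product_topology (\<lambda>_. euclidean :: complex topology) (UNIV :: nat set))"
    by (simp add: Hausdorff_space_product_topology)
  show "continuous_map coeff_top (product_topology (\<lambda>_. euclidean) UNIV) coeff"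
    by (simp add: continuous_map_componentwise_UNIV continuous_map_coeff)
  show "inj_on coeff (topspace coeff_top)" by (auto simp: inj_on_def poly_eq_iff)
qed

text \<open>The polynomials of \<open>C\<^sub>n\<close> that have \<open>0\<close> as a root.  This space is a model of \<open>V\<^sub>n\<close> without quotients.\<close>
definition C0_set :: "nat \<Rightarrow> complex poly set" where
  "C0_set n = {f \<in> C_set n. poly f 0 = 0}"

definition C0_top :: "nat \<Rightarrow> complex poly topology" where
  "C0_top n = subtopology coeff_top (C0_set n)"

lemma topspace_C_top [simp]: "topspace (C_top n) = C_set n"
  by (simp add: C_top_def)

lemma topspace_C0_top [simp]: "topspace (C0_top n) = C0_set n"
  by (simp add: C0_top_def)

lemma C0_top_eq: "C0_top n = subtopology (C_top n) (C0_set n)"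
proof -
  have "C_set n \<inter> C0_set n = C0_set n" by (auto simp: C0_set_def)
  then show ?thesis by (simp add: C0_top_def C_top_def subtopology_subtopology)
qed

lemma C_setD:
  assumes "f \<in> C_set n"
  shows "lead_coeff f = 1" "degree f = n" "card {z. poly f z = 0} = n"
  using assms unfolding C_set_def by blast+

lemma roots_of_roots_poly: "finite J \<Longrightarrow> {t. poly (roots_poly J z) t = 0} = z ` J"
  using poly_roots_poly_eq_0[of J z] by blast

lemma roots_poly_in_C_set:
  assumes "finite J" "inj_on z J"
  shows "roots_poly J z \<in> C_set (card J)"
  using assms by (simp add: C_set_def degree_roots_poly roots_of_roots_poly card_image coeff_roots_poly_top)

lemma roots_poly_in_C0_set:
  assumes "finite J" "inj_on z J" "j \<in> J" "z j = 0"
  shows "roots_poly J z \<in> C0_set (card J)"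
  using assms roots_poly_in_C_set[OF assms(1,2)] poly_roots_poly_eq_0[OF assms(1), of z 0]
  by (force simp: C0_set_def)

lemma C_set_eq_roots_poly:
  assumes "f \<in> C_set (card J)" "finite J" "inj_on r J" "\<And>j. j \<in> J \<Longrightarrow> poly f (r j) = 0"
  shows "roots_poly J r = f"
  by (rule monic_eq_roots_poly[OF assms(2) C_setD(1,2)[OF assms(1)] assms(3,4), symmetric])

lemma roots_poly_eq_iff_image:
  assumes J: "finite J" and z: "inj_on z J" "inj_on z' J"
  shows "roots_poly J z = roots_poly J z' \<longleftrightarrow> z ` J = z' ` J"
proof
  assume "roots_poly J z = roots_poly J z'"
  then show "z ` J = z' ` J" using roots_of_roots_poly[OF J, of z] roots_of_roots_poly[OF J, of z'] by simp
next
  assume img: "z ` J = z' ` J"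
  show "roots_poly J z = roots_poly J z'"
  proof (rule C_set_eq_roots_poly[OF roots_poly_in_C_set[OF J z(2)] J z(1)])
    fix j assume "j \<in> J"
    then have "z j \<in> z' ` J" unfolding img[symmetric] by (rule imageI)
    then show "poly (roots_poly J z') (z j) = 0" by (simp only: poly_roots_poly_eq_0[OF J])
  qed
qed

lemma continuous_map_roots_poly:
  assumes J: "finite J" and a: "\<And>j. j \<in> J \<Longrightarrow> continuous_map X euclidean (\<lambda>x. a x j)"
  shows "continuous_map X coeff_top (\<lambda>x. roots_poly J (a x))"
  unfolding continuous_map_coeff_top_iff
proof
  fix k show "continuous_map X euclidean (\<lambda>x. coeff (roots_poly J (a x)) k)"
  proof (cases "k \<le> card J")
    case True
    show ?thesis by (rule continuous_map_poly_fn[OF J a poly_fn_coeff_roots_poly[OF J True]])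
  next
    case False
    then have "coeff (roots_poly J z) k = 0" for z by (intro coeff_eq_0) (simp add: degree_roots_poly)
    then show ?thesis by simp
  qed
qed

lemma continuous_map_poly_eval: "continuous_map (C_top n) euclidean (\<lambda>f. poly f z)"
proof -
  have "poly_fn {..n} (Suc 0) (\<lambda>x. \<Sum>k\<in>{..n}. z ^ k * x k)"
    by (intro poly_fn_sum poly_fn_cmult poly_fn_coord) auto
  then have "continuous_map (C_top n) euclidean (\<lambda>f. \<Sum>k\<in>{..n}. z ^ k * coeff f k)"
    by (rule continuous_map_poly_fn[rotated 2])
       (auto simp: C_top_def intro: continuous_map_from_subtopology[OF continuous_map_coeff])
  then show ?thesis
  proof (rule continuous_map_eq)
    fix f assume "f \<in> topspace (C_top n)"
    then have "degree f = n" using C_setD(2) by simp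
    then show "(\<Sum>k\<in>{..n}. z ^ k * coeff f k) = poly f z" by (simp add: poly_altdef mult.commute)
  qed
qed

text \<open>The value at \<open>z\<close> is the product of the \<open>n\<close> differences between \<open>z\<close> and the roots.\<close>
lemma root_near_small_value:
  assumes f: "f \<in> C_set n" and \<epsilon>: "\<epsilon> > 0" and z: "norm (poly f z) < \<epsilon> ^ n"
  shows "\<exists>a. poly f a = 0 \<and> norm (z - a) < \<epsilon>"
proof (rule ccontr)
  assume no: "\<not> (\<exists>a. poly f a = 0 \<and> norm (z - a) < \<epsilon>)"
  define A where "A = {a. poly f a = 0}"
  have "card A = n" unfolding A_def by (rule C_setD(3)[OF f])
  have "f \<noteq> 0" using C_setD(1)[OF f] by auto
  then have A: "finite A" unfolding A_def by (rule poly_roots_finite)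
  have "roots_poly A (\<lambda>a. a) = f"
    by (rule C_set_eq_roots_poly[OF _ A]) (use f \<open>card A = n\<close> in \<open>simp_all add: A_def\<close>)
  then have "poly f z = (\<Prod>a\<in>A. z - a)" using poly_roots_poly[of A "\<lambda>a. a" z] by simp
  then have "norm (poly f z) = (\<Prod>a\<in>A. norm (z - a))" by (simp add: prod_norm)
  also have "(\<Prod>a\<in>A. norm (z - a)) \<ge> (\<Prod>a\<in>A. \<epsilon>)"
    by (rule prod_mono) (use no \<epsilon> in \<open>auto simp: A_def not_less\<close>)
  finally show False using z \<open>card A = n\<close> by simp
qed

text \<open>Discs of radius \<open>\<epsilon>\<close> around the \<open>n\<close> roots of \<open>f0\<close> are disjoint.  For \<open>f\<close> near \<open>f0\<close> each of them contains a root of \<open>f\<close>, hence exactly one.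
The same estimate at another polynomial of \<open>T\<close> gives the continuity of the root in a given disc.\<close>
lemma local_roots:
  assumes f0: "f0 \<in> C_set n" and J: "finite J" "card J = n" and r: "bij_betw r J {z. poly f0 z = 0}"
  obtains T \<rho> \<epsilon> where "openin (C_top n) T" "f0 \<in> T" "\<epsilon> > 0"
    "\<And>j. j \<in> J \<Longrightarrow> continuous_map (subtopology (C_top n) T) euclidean (\<lambda>f. \<rho> f j)"
    "\<And>f. f \<in> T \<Longrightarrow> inj_on (\<rho> f) J" "\<And>f. f \<in> T \<Longrightarrow> roots_poly J (\<rho> f) = f"
    "\<And>f j z. f \<in> T \<Longrightarrow> j \<in> J \<Longrightarrow> poly f z = 0 \<Longrightarrow> norm (r j - z) < \<epsilon> \<Longrightarrow> \<rho> f j = z"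
proof -
  have r_inj: "inj_on r J" and r_root: "\<And>j. j \<in> J \<Longrightarrow> poly f0 (r j) = 0"
    using r by (auto simp: bij_betw_def)
  define D where "D = insert 1 ((\<lambda>p. norm (r (fst p) - r (snd p)) / 2) ` (J \<times> J - Id))"
  define \<epsilon> where "\<epsilon> = Min D"
  have fin: "finite D" using J by (simp add: D_def)
  have "x > 0" if x: "x \<in> D" for x
  proof (cases "x = 1")
    case False
    then have "x \<in> (\<lambda>p. norm (r (fst p) - r (snd p)) / 2) ` (J \<times> J - Id)" using x by (simp only: D_def insert_iff) simp
    then obtain p where p: "p \<in> J \<times> J - Id" "x = norm (r (fst p) - r (snd p)) / 2" by blast
    then have "r (fst p) \<noteq> r (snd p)" using inj_onD[OF r_inj, of "fst p" "snd p"] by (cases p) auto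
    then show ?thesis unfolding p(2) by simp
  qed simp
  then have \<epsilon>: "\<epsilon> > 0" unfolding \<epsilon>_def using Min_in[OF fin] by (simp add: D_def)
  have sep: "i = j" if ij: "i \<in> J" "j \<in> J" "norm (r i - r j) < 2 * \<epsilon>" for i j
  proof (rule ccontr)
    assume "i \<noteq> j"
    then have "(i, j) \<in> J \<times> J - Id" using ij by simp
    from imageI[OF this, of "\<lambda>p. norm (r (fst p) - r (snd p)) / 2"]
    have "norm (r i - r j) / 2 \<in> D" by (simp add: D_def)
    from Min_le[OF fin this] show False using ij(3) by (simp add: \<epsilon>_def)
  qed
  define T where "T = (\<Inter>j\<in>J. {f \<in> topspace (C_top n). poly f (r j) \<in> ball 0 (\<epsilon> ^ n)}) \<inter> topspace (C_top n)"
  have T: "openin (C_top n) T" unfolding T_def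
    by (intro openin_INT J openin_continuous_map_preimage[OF continuous_map_poly_eval]) simp
  have f0T: "f0 \<in> T" using f0 r_root \<epsilon> by (simp add: T_def)
  have TC: "f \<in> C_set n" if "f \<in> T" for f using that by (simp add: T_def)
  have T_small: "norm (poly f (r j)) < \<epsilon> ^ n" if "f \<in> T" "j \<in> J" for f j
    using that by (auto simp: T_def)
  define \<rho> where "\<rho> f j = (SOME z. poly f z = 0 \<and> norm (r j - z) < \<epsilon>)" for f j
  have \<rho>: "poly f (\<rho> f j) = 0 \<and> norm (r j - \<rho> f j) < \<epsilon>" if "f \<in> T" "j \<in> J" for f j
    unfolding \<rho>_def by (rule someI_ex) (rule root_near_small_value[OF TC[OF that(1)] \<epsilon> T_small[OF that]])
  have \<rho>_inj: "inj_on (\<rho> f) J" if f: "f \<in> T" for f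
  proof (rule inj_onI)
    fix i j assume ij: "i \<in> J" "j \<in> J" "\<rho> f i = \<rho> f j"
    have "norm (r i - r j) \<le> norm (r i - \<rho> f i) + norm (r j - \<rho> f j)"
      using norm_triangle_ineq4[of "r i - \<rho> f i" "r j - \<rho> f j"] ij(3) by simp
    then show "i = j" using \<rho>[OF f ij(1)] \<rho>[OF f ij(2)] by (intro sep ij) linarith
  qed
  have \<rho>_eq: "roots_poly J (\<rho> f) = f" if f: "f \<in> T" for f
    by (rule C_set_eq_roots_poly[OF _ J(1) \<rho>_inj[OF f]]) (use TC[OF f] J(2) \<rho>[OF f] in auto)
  have uniq: "\<rho> f j = z" if f: "f \<in> T" and j: "j \<in> J" and z: "poly f z = 0" "norm (r j - z) < \<epsilon>" for f j z
  proof -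
    have "poly (roots_poly J (\<rho> f)) z = 0" unfolding \<rho>_eq[OF f] by (rule z(1))
    then have "z \<in> \<rho> f ` J" unfolding poly_roots_poly_eq_0[OF J(1)] .
    then obtain i where i: "i \<in> J" "z = \<rho> f i" by blast
    have "norm (r i - r j) \<le> norm (r i - \<rho> f i) + norm (r j - z)"
      using norm_triangle_ineq4[of "r i - \<rho> f i" "r j - z"] i(2) by simp
    then have "i = j" using \<rho>[OF f i(1)] z(2) by (intro sep i j) linarith
    then show ?thesis using i(2) by simp
  qed
  have cont: "continuous_map (subtopology (C_top n) T) euclidean (\<lambda>f. \<rho> f j)" if j: "j \<in> J" for j
  proof (rule continuous_map_euclideanI_dist)
    fix f1 and e :: real
    assume "f1 \<in> topspace (subtopology (C_top n) T)" and e: "e > 0"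
    then have f1: "f1 \<in> T" by simp
    \<comment> \<open>A root this close to that of f1 still lies in the j-th disc.\<close>
    define \<eta> where "\<eta> = min e (\<epsilon> - norm (r j - \<rho> f1 j))"
    have \<eta>: "\<eta> > 0" "\<eta> \<le> e" "\<eta> \<le> \<epsilon> - norm (r j - \<rho> f1 j)" using e \<rho>[OF f1 j] by (auto simp: \<eta>_def)
    define U where "U = {f \<in> topspace (subtopology (C_top n) T). poly f (\<rho> f1 j) \<in> ball 0 (\<eta> ^ n)}"
    have "openin (subtopology (C_top n) T) U" unfolding U_def
      by (rule openin_continuous_map_preimage[OF continuous_map_from_subtopology[OF continuous_map_poly_eval]]) simp
    moreover have "f1 \<in> U" using f1 TC[OF f1] \<rho>[OF f1 j] \<eta>(1) by (simp add: U_def)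
    moreover have "dist (\<rho> f j) (\<rho> f1 j) < e" if f: "f \<in> U" for f
    proof -
      have fT: "f \<in> T" and "norm (poly f (\<rho> f1 j)) < \<eta> ^ n" using f by (auto simp: U_def)
      from root_near_small_value[OF TC[OF fT] \<eta>(1) this(2)]
      obtain a where a: "poly f a = 0" "norm (\<rho> f1 j - a) < \<eta>" by blast
      have "norm (r j - a) \<le> norm (r j - \<rho> f1 j) + norm (\<rho> f1 j - a)"
        using norm_triangle_ineq[of "r j - \<rho> f1 j" "\<rho> f1 j - a"] by simp
      then have "norm (r j - a) < \<epsilon>" using a(2) \<eta>(3) by linarith
      then have "\<rho> f j = a" by (rule uniq[OF fT j a(1)])
      then show ?thesis using a(2) \<eta>(2) by (simp add: dist_norm norm_minus_commute)
    qed
    ultimately show "\<exists>U. openin (subtopology (C_top n) T) U \<and> f1 \<in> U \<and> (\<forall>f\<in>U. dist (\<rho> f j) (\<rho> f1 j) < e)"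
      by blast
  qed
  show ?thesis by (rule that[of T \<epsilon> \<rho>, OF T f0T \<epsilon> cont \<rho>_inj \<rho>_eq uniq])
qed

text \<open>The root \<open>0\<close> gets the index \<open>j0\<close> and keeps it nearby, by the uniqueness of the root in its disc.\<close>
lemma local_roots_C0:
  assumes w0: "w0 \<in> C0_set n" and J: "finite J" "card J = n" "j0 \<in> J"
  obtains T \<rho> where "openin (C0_top n) T" "w0 \<in> T"
    "\<And>j. j \<in> J \<Longrightarrow> continuous_map (subtopology (C0_top n) T) euclidean (\<lambda>f. \<rho> f j)"
    "\<And>w. w \<in> T \<Longrightarrow> inj_on (\<rho> w) J" "\<And>w. w \<in> T \<Longrightarrow> roots_poly J (\<rho> w) = w"
    "\<And>w. w \<in> T \<Longrightarrow> \<rho> w j0 = 0"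
proof -
  have w0C: "w0 \<in> C_set n" and w00: "poly w0 0 = 0" using w0 by (auto simp: C0_set_def)
  have "w0 \<noteq> 0" using C_setD(1)[OF w0C] by auto
  then have "finite {z. poly w0 z = 0}" by (rule poly_roots_finite)
  moreover have "card J = card {z. poly w0 z = 0}" using C_setD(3)[OF w0C] J(2) by simp
  ultimately obtain g where g: "bij_betw g J {z. poly w0 z = 0}"
    using finite_same_card_bij[OF J(1)] by blast
  have "0 \<in> g ` J" using g w00 by (auto simp: bij_betw_def)
  then obtain i where i: "i \<in> J" "g i = 0" by auto
  define r where "r = g \<circ> Transposition.transpose i j0"
  have "bij_betw (Transposition.transpose i j0) J J"
    using i(1) J(3) by (intro permutes_imp_bij permutes_swap_id)
  then have r: "bij_betw r J {z. poly w0 z = 0}" unfolding r_def by (rule bij_betw_trans[OF _ g])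
  have r0: "r j0 = 0" using i(2) by (simp add: r_def)
  show ?thesis
  proof (rule local_roots[OF w0C J(1,2) r])
    fix T \<rho> and \<epsilon> :: real
    assume T: "openin (C_top n) T" "w0 \<in> T" and \<epsilon>: "\<epsilon> > 0"
      and cont: "\<And>j. j \<in> J \<Longrightarrow> continuous_map (subtopology (C_top n) T) euclidean (\<lambda>f. \<rho> f j)"
      and inj: "\<And>f. f \<in> T \<Longrightarrow> inj_on (\<rho> f) J" and eq: "\<And>f. f \<in> T \<Longrightarrow> roots_poly J (\<rho> f) = f"
      and uniq: "\<And>f j z. f \<in> T \<Longrightarrow> j \<in> J \<Longrightarrow> poly f z = 0 \<Longrightarrow> norm (r j - z) < \<epsilon> \<Longrightarrow> \<rho> f j = z"
    show thesis
    proof (rule that[of "C0_set n \<inter> T" \<rho>])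
      show "openin (C0_top n) (C0_set n \<inter> T)"
        unfolding C0_top_eq by (rule openin_subtopology_Int2[OF T(1)])
      show "w0 \<in> C0_set n \<inter> T" using w0 T(2) by simp
      show "continuous_map (subtopology (C0_top n) (C0_set n \<inter> T)) euclidean (\<lambda>f. \<rho> f j)" if "j \<in> J" for j
        unfolding C0_top_eq subtopology_subtopology
        by (rule continuous_map_from_subtopology_mono[OF cont[OF that]]) auto
      show "\<rho> w j0 = 0" if "w \<in> C0_set n \<inter> T" for w
        by (rule uniq) (use that J(3) r0 \<epsilon> in \<open>auto simp: C0_set_def\<close>)
    qed (use inj eq in auto)
  qed
qed

lemma perm_class_comp:
  assumes "\<sigma> permutes J" shows "perm_class J (z \<circ> \<sigma>) = perm_class J z"
proof
  show "perm_class J (z \<circ> \<sigma>) \<subseteq> perm_class J z"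
  proof
    fix y assume "y \<in> perm_class J (z \<circ> \<sigma>)"
    then obtain \<tau> where "\<tau> permutes J" "y = z \<circ> (\<sigma> \<circ> \<tau>)" by (auto simp: perm_class_def o_assoc)
    then show "y \<in> perm_class J z" using permutes_compose[OF _ assms] unfolding perm_class_def by blast
  qed
  show "perm_class J z \<subseteq> perm_class J (z \<circ> \<sigma>)"
  proof
    fix y assume "y \<in> perm_class J z"
    then obtain \<tau> where t: "\<tau> permutes J" "y = z \<circ> \<tau>" by (auto simp: perm_class_def)
    have "y = (z \<circ> \<sigma>) \<circ> (inv \<sigma> \<circ> \<tau>)"
      unfolding t(2) by (simp add: fun_eq_iff permutes_inverses[OF assms])
    moreover have "inv \<sigma> \<circ> \<tau> permutes J" by (rule permutes_compose[OF t(1) permutes_inv[OF assms]])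
    ultimately show "y \<in> perm_class J (z \<circ> \<sigma>)" unfolding perm_class_def by blast
  qed
qed

lemma perm_class_eq_iff:
  assumes z: "inj_on z J" and z': "inj_on z' J"
  shows "perm_class J z = perm_class J z' \<longleftrightarrow> (\<forall>i. i \<notin> J \<longrightarrow> z i = z' i) \<and> z ` J = z' ` J"
proof
  assume "perm_class J z = perm_class J z'"
  moreover have "z \<in> perm_class J z"
    unfolding perm_class_def by (auto intro!: exI[of _ id] permutes_id)
  ultimately obtain \<sigma> where s: "\<sigma> permutes J" "z = z' \<circ> \<sigma>" by (auto simp: perm_class_def)
  have "z i = z' i" if "i \<notin> J" for i using s that by (simp add: permutes_not_in)
  moreover have "z ` J = z' ` J" unfolding s(2) image_comp[symmetric] permutes_image[OF s(1)] ..
  ultimately show "(\<forall>i. i \<notin> J \<longrightarrow> z i = z' i) \<and> z ` J = z' ` J" by blast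
next
  assume *: "(\<forall>i. i \<notin> J \<longrightarrow> z i = z' i) \<and> z ` J = z' ` J"
  define \<sigma> where "\<sigma> i = (if i \<in> J then inv_into J z' (z i) else i)" for i
  have img: "z' (\<sigma> i) = z i" if "i \<in> J" for i
  proof -
    have "z i \<in> z' ` J" using * that by blast
    then show ?thesis using that by (simp add: \<sigma>_def f_inv_into_f)
  qed
  have "bij_betw (inv_into J z' \<circ> z) J J"
    by (rule bij_betw_trans[of z J "z' ` J"]) (use * z z' in \<open>auto simp: bij_betw_def inj_on_inv_into intro: bij_betw_inv_into[unfolded bij_betw_def, THEN conjunct2]\<close>)
  then have "bij_betw \<sigma> J J"
    by (rule bij_betw_cong[THEN iffD1, rotated]) (simp add: \<sigma>_def)
  then have "\<sigma> permutes J" by (rule bij_imp_permutes) (simp add: \<sigma>_def)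
  moreover have "z = z' \<circ> \<sigma>"
  proof
    fix i show "z i = (z' \<circ> \<sigma>) i" using * img[of i] by (cases "i \<in> J") (auto simp: \<sigma>_def)
  qed
  ultimately show "perm_class J z = perm_class J z'" using perm_class_comp by simp
qed

section \<open>Configuration spaces as spaces of polynomials\<close>

lemma topspace_ordered_configs_top [simp]: "topspace (ordered_configs_top m A) = ordered_configs m A"
proof -
  have "ordered_configs m A \<subseteq> topspace (product_topology (\<lambda>_. euclidean :: complex topology) {1..m})"
    using PiE_mono[of "{1..m}" "\<lambda>_. A" "\<lambda>_. UNIV"] unfolding ordered_configs_def by auto
  then show ?thesis by (simp add: ordered_configs_top_def Int_absorb1)
qed

lemma continuous_map_ordered_configs_coord:
  assumes "j \<in> {1..m}" shows "continuous_map (ordered_configs_top m A) euclidean (\<lambda>z. z j)"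
  unfolding ordered_configs_top_def
  by (rule continuous_map_from_subtopology[OF continuous_map_product_projection[OF assms]])

lemma continuous_map_into_ordered_configs_top:
  assumes "\<And>x. x \<in> topspace X \<Longrightarrow> s x \<in> ordered_configs m A"
    and "\<And>j. j \<in> {1..m} \<Longrightarrow> continuous_map X euclidean (\<lambda>x. s x j)"
  shows "continuous_map X (ordered_configs_top m A) s"
  unfolding ordered_configs_top_def continuous_map_in_subtopology continuous_map_componentwise
proof (intro conjI ballI)
  show "s ` topspace X \<subseteq> extensional {1..m}"
    using assms(1) by (force simp: ordered_configs_def PiE_iff)
  show "s \<in> topspace X \<rightarrow> ordered_configs m A" using assms(1) by blast
qed (rule assms(2))

lemma ordered_configsD:
  assumes "z \<in> ordered_configs m A"
  shows "inj_on z {1..m}" "\<And>i. i \<in> {1..m} \<Longrightarrow> z i \<in> A" "\<And>i. i \<notin> {1..m} \<Longrightarrow> z i = undefined"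
  using assms by (auto simp: ordered_configs_def PiE_iff extensional_def)

lemma ordered_configsI:
  assumes "inj_on z {1..m}" "\<And>i. i \<in> {1..m} \<Longrightarrow> z i \<in> A"
  shows "restrict z {1..m} \<in> ordered_configs m A"
  using assms by (auto simp: ordered_configs_def inj_on_restrict_eq)

text \<open>An ordering of the values is extended by \<open>0\<close> at the index \<open>0\<close>, so that the polynomial is a product over \<open>{0..n-1}\<close>.\<close>
lemma V_top_homeomorphism:
  assumes "n \<ge> 1"
  obtains \<kappa> where "homeomorphic_map (V_top n) (C0_top n) \<kappa>"
    "\<And>v. v \<in> ordered_configs (n - 1) (- {0}) \<Longrightarrow> \<kappa> (perm_class {1..n-1} v) = roots_poly {0..n-1} (v(0 := 0))"
proof -
  let ?I = "{1..n-1}" and ?J = "{0..n-1}"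
  let ?X = "ordered_configs_top (n - 1) (- {0})"
  define g where "g v = roots_poly ?J (v(0 := 0))" for v :: "nat \<Rightarrow> complex"
  have J: "finite ?J" "card ?J = n" "0 \<in> ?J" using assms by auto
  have JI: "?J = insert 0 ?I" by auto
  have inj0: "inj_on (v(0 := 0)) ?J" if "v \<in> ordered_configs (n - 1) (- {0})" for v
  proof -
    have "inj_on (v(0 := 0)) ?I" using ordered_configsD(1)[OF that] by (auto simp: inj_on_def)
    moreover have "(v(0 := 0)) 0 \<notin> (v(0 := 0)) ` ?I" using ordered_configsD(2)[OF that] by force
    ultimately show ?thesis unfolding JI by simp
  qed
  have gC: "g v \<in> C0_set n" if "v \<in> ordered_configs (n - 1) (- {0})" for v
    using roots_poly_in_C0_set[OF J(1) inj0[OF that] J(3)] J(2) by (simp add: g_def)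
  have contg: "continuous_map ?X (C0_top n) g"
    unfolding C0_top_def continuous_map_in_subtopology
  proof
    show "continuous_map ?X coeff_top g"
      unfolding g_def
    proof (rule continuous_map_roots_poly[OF J(1)])
      fix j assume j: "j \<in> ?J"
      show "continuous_map ?X euclidean (\<lambda>v. (v(0 := 0)) j)"
        using j continuous_map_ordered_configs_coord[of j "n - 1" "- {0}"] by (cases "j = 0") auto
    qed
    show "g \<in> topspace ?X \<rightarrow> C0_set n" using gC by simp
  qed
  have eq: "perm_class ?I v = perm_class ?I v' \<longleftrightarrow> g v = g v'"
    if v: "v \<in> topspace ?X" and v': "v' \<in> topspace ?X" for v v'
  proof -
    have vv: "v \<in> ordered_configs (n - 1) (- {0})" "v' \<in> ordered_configs (n - 1) (- {0})" using v v' by simp_all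
    have img: "(u(0 := 0)) ` ?J = insert 0 (u ` ?I)" for u :: "nat \<Rightarrow> complex"
    proof -
      have "(u(0 := 0)) ` ?I = u ` ?I" by (rule image_cong) auto
      then show ?thesis unfolding JI image_insert by (simp only: fun_upd_same)
    qed
    have "0 \<notin> v ` ?I" "0 \<notin> v' ` ?I" using ordered_configsD(2)[OF vv(1)] ordered_configsD(2)[OF vv(2)] by force+
    then have "insert 0 (v ` ?I) = insert 0 (v' ` ?I) \<longleftrightarrow> v ` ?I = v' ` ?I" by (simp add: insert_ident)
    moreover have "v i = v' i" if "i \<notin> ?I" for i
      using ordered_configsD(3)[OF vv(1) that] ordered_configsD(3)[OF vv(2) that] by (rule trans[OF _ sym])
    ultimately show ?thesis
      unfolding g_def roots_poly_eq_iff_image[OF J(1) inj0[OF vv(1)] inj0[OF vv(2)]] img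
        perm_class_eq_iff[OF ordered_configsD(1)[OF vv(1)] ordered_configsD(1)[OF vv(2)]] by blast
  qed
  have sec: "\<exists>T s. openin (C0_top n) T \<and> w0 \<in> T \<and> continuous_map (subtopology (C0_top n) T) ?X s \<and> (\<forall>w\<in>T. g (s w) = w)"
    if "w0 \<in> topspace (C0_top n)" for w0
  proof -
    have w0: "w0 \<in> C0_set n" using that by simp
    show ?thesis
    proof (rule local_roots_C0[OF w0 J])
      fix T \<rho>
      assume T: "openin (C0_top n) T" "w0 \<in> T"
        and cont: "\<And>j. j \<in> ?J \<Longrightarrow> continuous_map (subtopology (C0_top n) T) euclidean (\<lambda>f. \<rho> f j)"
        and inj: "\<And>w. w \<in> T \<Longrightarrow> inj_on (\<rho> w) ?J" and rp: "\<And>w. w \<in> T \<Longrightarrow> roots_poly ?J (\<rho> w) = w"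
        and r0: "\<And>w. w \<in> T \<Longrightarrow> \<rho> w 0 = 0"
      define s where "s w = restrict (\<rho> w) ?I" for w
      have "s w \<in> ordered_configs (n - 1) (- {0})" if w: "w \<in> T" for w
        unfolding s_def
      proof (rule ordered_configsI)
        show "inj_on (\<rho> w) ?I" by (rule inj_on_subset[OF inj[OF w]]) auto
        show "\<rho> w i \<in> - {0}" if "i \<in> ?I" for i
          using inj_onD[OF inj[OF w], of i 0] r0[OF w] that by auto
      qed
      moreover have "continuous_map (subtopology (C0_top n) T) euclidean (\<lambda>w. s w j)" if "j \<in> ?I" for j
        using cont[of j] that by (simp add: s_def)
      ultimately have "continuous_map (subtopology (C0_top n) T) ?X s"
        by (intro continuous_map_into_ordered_configs_top) simp_all
      moreover have "g (s w) = w" if w: "w \<in> T" for w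
      proof -
        have "g (s w) = roots_poly ?J (\<rho> w)"
          unfolding g_def by (rule roots_poly_cong) (use r0[OF w] in \<open>auto simp: s_def\<close>)
        then show ?thesis using rp[OF w] by simp
      qed
      ultimately show ?thesis using T by blast
    qed
  qed
  show ?thesis
  proof (rule quotient_topology_homeomorphism[OF contg eq sec])
    fix \<kappa>
    assume "homeomorphic_map (quotient_topology ?X (perm_class ?I)) (C0_top n) \<kappa>"
      "\<And>v. v \<in> topspace ?X \<Longrightarrow> \<kappa> (perm_class ?I v) = g v"
    then show thesis by (intro that[of \<kappa>]) (simp_all add: V_top_def g_def)
  qed
qed

text \<open>A configuration with a marked point is the marked point together with the configuration translated by it to \<open>0\<close>.\<close>
lemma D_top_homeomorphic:
  assumes "n \<ge> 1"
  shows "D_top n homeomorphic_space prod_topology (euclidean :: complex topology) (C0_top n)"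
proof -
  let ?J = "{1..n}" and ?K = "{2..n}"
  let ?X = "ordered_configs_top n UNIV" and ?Z = "prod_topology (euclidean :: complex topology) (C0_top n)"
  define g where "g z = (z 1, roots_poly ?J (\<lambda>i. z i - z 1))" for z :: "nat \<Rightarrow> complex"
  have J: "finite ?J" "card ?J = n" "1 \<in> ?J" using assms by auto
  have JK: "?J = insert 1 ?K" using atLeastAtMost_insertL[OF assms] by (simp add: numeral_2_eq_2)
  have K1: "1 \<notin> ?K" by simp
  have shift_inj: "inj_on (\<lambda>i. z i - z 1) ?J" if "z \<in> ordered_configs n UNIV" for z
  proof (rule inj_onI)
    fix i j assume "i \<in> ?J" "j \<in> ?J" "z i - z 1 = z j - z 1"
    then show "i = j" using inj_onD[OF ordered_configsD(1)[OF that], of i j] by simp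
  qed
  have c1: "continuous_map ?X euclidean (\<lambda>z. z 1)" by (rule continuous_map_ordered_configs_coord[OF J(3)])
  have contg: "continuous_map ?X ?Z g"
    unfolding g_def continuous_map_paired
  proof
    show "continuous_map ?X euclidean (\<lambda>z. z 1)" by (rule c1)
    show "continuous_map ?X (C0_top n) (\<lambda>z. roots_poly ?J (\<lambda>i. z i - z 1))"
      unfolding C0_top_def continuous_map_in_subtopology
    proof
      show "continuous_map ?X coeff_top (\<lambda>z. roots_poly ?J (\<lambda>i. z i - z 1))"
        by (rule continuous_map_roots_poly[OF J(1)])
           (rule continuous_map_diff[OF continuous_map_ordered_configs_coord c1])
      show "(\<lambda>z. roots_poly ?J (\<lambda>i. z i - z 1)) \<in> topspace ?X \<rightarrow> C0_set n"
      proof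
        fix z assume "z \<in> topspace ?X"
        then have "z \<in> ordered_configs n UNIV" by simp
        from roots_poly_in_C0_set[OF J(1) shift_inj[OF this] J(3)] J(2)
        show "roots_poly ?J (\<lambda>i. z i - z 1) \<in> C0_set n" by simp
      qed
    qed
  qed
  have eq: "perm_class ?K z = perm_class ?K z' \<longleftrightarrow> g z = g z'"
    if "z \<in> topspace ?X" "z' \<in> topspace ?X" for z z'
  proof -
    have zz: "z \<in> ordered_configs n UNIV" "z' \<in> ordered_configs n UNIV" using that by simp_all
    have inj: "inj_on z ?J" "inj_on z' ?J" by (rule ordered_configsD(1)[OF zz(1)], rule ordered_configsD(1)[OF zz(2)])
    have injK: "inj_on z ?K" "inj_on z' ?K" using inj unfolding JK by simp_all
    have notin: "u 1 \<notin> u ` ?K" if "inj_on u ?J" for u :: "nat \<Rightarrow> complex" using that unfolding JK by simp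
    have out: "z i = z' i" if "i \<notin> ?J" for i
      using ordered_configsD(3)[OF zz(1) that] ordered_configsD(3)[OF zz(2) that] by (rule trans[OF _ sym])
    have a: "(\<forall>i. i \<notin> ?K \<longrightarrow> z i = z' i) \<longleftrightarrow> z 1 = z' 1"
    proof
      assume "z 1 = z' 1"
      show "\<forall>i. i \<notin> ?K \<longrightarrow> z i = z' i"
      proof (intro allI impI)
        fix i assume "i \<notin> ?K"
        then show "z i = z' i" using \<open>z 1 = z' 1\<close> out[of i] unfolding JK by (cases "i = 1") simp_all
      qed
    next
      assume "\<forall>i. i \<notin> ?K \<longrightarrow> z i = z' i"
      from this[rule_format, OF K1] show "z 1 = z' 1" .
    qed
    have b: "(\<lambda>i. z i - z 1) ` ?J = (\<lambda>i. z' i - z' 1) ` ?J \<longleftrightarrow> z ` ?K = z' ` ?K" if z1: "z 1 = z' 1"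
    proof -
      have sh: "(\<lambda>i. u i - a) ` ?J = (\<lambda>t. t - a) ` (u ` ?J)" for u :: "nat \<Rightarrow> complex" and a by (simp add: image_image)
      have "(\<lambda>i. z i - z 1) ` ?J = (\<lambda>i. z' i - z' 1) ` ?J \<longleftrightarrow> z ` ?J = z' ` ?J"
        unfolding sh z1 by (rule inj_image_eq_iff) (simp add: inj_on_def)
      also have "\<dots> \<longleftrightarrow> insert (z' 1) (z ` ?K) = insert (z' 1) (z' ` ?K)" unfolding JK image_insert z1 ..
      also have "\<dots> \<longleftrightarrow> z ` ?K = z' ` ?K"
        by (rule insert_ident[OF notin[OF inj(1), unfolded z1] notin[OF inj(2)]])
      finally show ?thesis .
    qed
    show ?thesis
      unfolding g_def prod.inject roots_poly_eq_iff_image[OF J(1) shift_inj[OF zz(1)] shift_inj[OF zz(2)]]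
        perm_class_eq_iff[OF injK] a by (rule conj_cong[OF refl b[symmetric]])
  qed
  have sec: "\<exists>T s. openin ?Z T \<and> y0 \<in> T \<and> continuous_map (subtopology ?Z T) ?X s \<and> (\<forall>y\<in>T. g (s y) = y)"
    if "y0 \<in> topspace ?Z" for y0
  proof -
    have w0: "snd y0 \<in> C0_set n" using that by auto
    show ?thesis
    proof (rule local_roots_C0[OF w0 J])
      fix T \<rho>
      assume T: "openin (C0_top n) T" "snd y0 \<in> T"
        and cont: "\<And>j. j \<in> ?J \<Longrightarrow> continuous_map (subtopology (C0_top n) T) euclidean (\<lambda>f. \<rho> f j)"
        and inj: "\<And>w. w \<in> T \<Longrightarrow> inj_on (\<rho> w) ?J" and rp: "\<And>w. w \<in> T \<Longrightarrow> roots_poly ?J (\<rho> w) = w"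
        and r0: "\<And>w. w \<in> T \<Longrightarrow> \<rho> w 1 = 0"
      let ?T = "UNIV \<times> T"
      define s where "s y = restrict (\<lambda>i. fst y + \<rho> (snd y) i) ?J" for y
      have openT: "openin ?Z ?T" using T(1) by (simp add: openin_prod_Times_iff)
      have "s y \<in> ordered_configs n UNIV" if "y \<in> ?T" for y
        unfolding s_def
      proof (rule ordered_configsI)
        have "snd y \<in> T" using that by (simp add: mem_Times_iff)
        from inj_onD[OF inj[OF this]] show "inj_on (\<lambda>i. fst y + \<rho> (snd y) i) ?J"
          by (intro inj_onI) simp
      qed simp
      moreover have "continuous_map (subtopology ?Z ?T) euclidean (\<lambda>y. s y j)" if j: "j \<in> ?J" for j
      proof -
        have "continuous_map (subtopology ?Z ?T) euclidean fst"
          by (rule continuous_map_from_subtopology[OF continuous_map_fst])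
        moreover have "continuous_map (subtopology ?Z ?T) (subtopology (C0_top n) T) snd"
          unfolding continuous_map_in_subtopology
          by (intro conjI continuous_map_from_subtopology[OF continuous_map_snd]) auto
        from continuous_map_compose[OF this cont[OF j]]
        have "continuous_map (subtopology ?Z ?T) euclidean (\<lambda>y. \<rho> (snd y) j)" by (simp add: o_def)
        ultimately have "continuous_map (subtopology ?Z ?T) euclidean (\<lambda>y. fst y + \<rho> (snd y) j)"
          by (rule continuous_map_add)
        then show ?thesis using j by (simp add: s_def)
      qed
      ultimately have "continuous_map (subtopology ?Z ?T) ?X s"
        by (intro continuous_map_into_ordered_configs_top) (simp_all add: mem_Times_iff)
      moreover have "g (s y) = y" if y: "y \<in> ?T" for y
      proof -
        have sT: "snd y \<in> T" using y by (simp add: mem_Times_iff)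
        have s1: "s y 1 = fst y" using r0[OF sT] J(3) by (simp add: s_def)
        have "roots_poly ?J (\<lambda>i. s y i - s y 1) = roots_poly ?J (\<rho> (snd y))"
          by (rule roots_poly_cong) (unfold s1, simp add: s_def)
        then show ?thesis unfolding g_def s1 rp[OF sT] by simp
      qed
      moreover have "y0 \<in> ?T" using T(2) by (cases y0) simp
      ultimately show ?thesis using openT by blast
    qed
  qed
  show ?thesis
  proof (rule quotient_topology_homeomorphism[OF contg eq sec])
    fix \<kappa>
    assume "homeomorphic_map (quotient_topology ?X (perm_class ?K)) ?Z \<kappa>"
    then show ?thesis unfolding D_top_def by (rule homeomorphic_map_imp_homeomorphic_space)
  qed
qed

lemma homotopy_equivalent_space_complex_times:
  "prod_topology (euclidean :: complex topology) Y homotopy_equivalent_space Y"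
proof -
  let ?P = "prod_topology (euclidean :: complex topology) Y"
  have hom: "homotopic_with (\<lambda>_. True) (euclidean :: complex topology) euclidean (\<lambda>_. 0) (\<lambda>x. x)"
    using homotopic_with_linear[of UNIV "\<lambda>_::complex. 0::complex" "\<lambda>x. x" UNIV] by simp
  have "homotopic_with (\<lambda>_. True) Y Y (\<lambda>y. y) (\<lambda>y. y)" using continuous_map_id[of Y] by (simp add: id_def)
  from homotopic_with_prod_topology[OF hom this]
  have "homotopic_with (\<lambda>_. True) ?P ?P (\<lambda>z. (0, snd z)) (\<lambda>z. (fst z, snd z))" by simp
  then have "homotopic_with (\<lambda>_. True) ?P ?P ((\<lambda>y. (0, y)) \<circ> snd) id" by (simp add: o_def id_def)
  moreover have "homotopic_with (\<lambda>_. True) Y Y (snd \<circ> (\<lambda>y. (0::complex, y))) id" by (simp add: o_def id_def continuous_map_id[unfolded id_def])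
  moreover have "continuous_map Y ?P (\<lambda>y. (0, y))"
    by (simp add: continuous_map_paired continuous_map_id[unfolded id_def])
  ultimately show ?thesis
    unfolding homotopy_equivalent_space_def by (intro exI[of _ snd] exI[of _ "\<lambda>y. (0, y)"] conjI continuous_map_snd)
qed

lemma V_top_homotopy_equivalent_D_top:
  assumes "n \<ge> 1" shows "V_top n homotopy_equivalent_space D_top n"
proof -
  have "V_top n homeomorphic_space C0_top n"
    by (rule V_top_homeomorphism[OF assms]) (rule homeomorphic_map_imp_homeomorphic_space)
  then have "V_top n homotopy_equivalent_space C0_top n" by (rule homeomorphic_imp_homotopy_equivalent_space)
  also have "C0_top n homotopy_equivalent_space prod_topology (euclidean :: complex topology) (C0_top n)"
    by (rule homotopy_equivalent_space_sym[THEN iffD1, OF homotopy_equivalent_space_complex_times])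
  also have "prod_topology (euclidean :: complex topology) (C0_top n) homotopy_equivalent_space D_top n"
    by (rule homotopy_equivalent_space_sym[THEN iffD1, OF homeomorphic_imp_homotopy_equivalent_space[OF D_top_homeomorphic[OF assms]]])
  finally show ?thesis .
qed

lemma D_to_C_eq_roots_poly: "n \<ge> 1 \<Longrightarrow> D_to_C n (perm_class {2..n} z) = roots_poly {1..n} z"
  unfolding roots_poly_def by (rule D_to_C_perm_class) auto

text \<open>Locally the roots can be numbered continuously, and the \<open>j\<close>-th section marks the \<open>j\<close>-th root.\<close>
lemma covering_D_to_C:
  assumes n: "n \<ge> 1"
  shows "covering_map_of_degree n (D_top n) (C_top n) (D_to_C n)"
proof -
  let ?J = "{1..n}" and ?K = "{2..n}"
  let ?X = "ordered_configs_top n UNIV"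
  have J: "finite ?J" "card ?J = n" "1 \<in> ?J" using n by auto
  have JK: "?J = insert 1 ?K" using atLeastAtMost_insertL[OF n] by (simp add: numeral_2_eq_2)
  have quo: "quotient_map ?X (D_top n) (perm_class ?K)" unfolding D_top_def by (rule quotient_map_quotient_topology)
  have topD: "topspace (D_top n) = perm_class ?K ` ordered_configs n UNIV" by (simp add: D_top_def)
  have "Hausdorff_space (prod_topology (euclidean :: complex topology) (C0_top n))"
    unfolding Hausdorff_space_prod_topology C0_top_def
    using Hausdorff_space_subtopology[OF Hausdorff_space_coeff_top] by simp
  then have haus: "Hausdorff_space (D_top n)"
    by (simp only: homeomorphic_Hausdorff_space[OF D_top_homeomorphic[OF n]])
  have cont: "continuous_map (D_top n) (C_top n) (D_to_C n)"
  proof (rule continuous_compose_quotient_map[OF quo])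
    have "continuous_map ?X (C_top n) (roots_poly ?J)"
      unfolding C_top_def continuous_map_in_subtopology
    proof
      show "continuous_map ?X coeff_top (roots_poly ?J)"
        by (rule continuous_map_roots_poly[OF J(1) continuous_map_ordered_configs_coord])
      show "roots_poly ?J \<in> topspace ?X \<rightarrow> C_set n"
        using roots_poly_in_C_set[OF J(1)] J(2) ordered_configsD(1) by simp
    qed
    then show "continuous_map ?X (C_top n) (D_to_C n \<circ> perm_class ?K)"
      by (rule continuous_map_eq) (simp add: D_to_C_eq_roots_poly[OF n])
  qed
  have loc: "\<exists>T (A :: nat set) s. openin (C_top n) T \<and> f0 \<in> T \<and> card A = n \<and>
      (\<forall>j\<in>A. continuous_map (subtopology (C_top n) T) (D_top n) (s j)) \<and> (\<forall>j\<in>A. \<forall>f\<in>T. D_to_C n (s j f) = f) \<and>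
      (\<forall>f\<in>T. inj_on (\<lambda>j. s j f) A) \<and> (\<forall>c\<in>topspace (D_top n). D_to_C n c \<in> T \<longrightarrow> (\<exists>j\<in>A. s j (D_to_C n c) = c))"
    if "f0 \<in> topspace (C_top n)" for f0
  proof -
    have f0: "f0 \<in> C_set n" using that by simp
    have "f0 \<noteq> 0" using C_setD(1)[OF f0] by auto
    then have "finite {z. poly f0 z = 0}" by (rule poly_roots_finite)
    moreover have "card ?J = card {z. poly f0 z = 0}" using C_setD(3)[OF f0] J(2) by simp
    ultimately obtain r where r: "bij_betw r ?J {z. poly f0 z = 0}"
      using finite_same_card_bij[OF J(1)] by blast
    show ?thesis
    proof (rule local_roots[OF f0 J(1,2) r])
      fix T \<rho> and \<epsilon> :: real
      assume T: "openin (C_top n) T" "f0 \<in> T"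
        and contr: "\<And>j. j \<in> ?J \<Longrightarrow> continuous_map (subtopology (C_top n) T) euclidean (\<lambda>f. \<rho> f j)"
        and inj: "\<And>f. f \<in> T \<Longrightarrow> inj_on (\<rho> f) ?J" and rp: "\<And>f. f \<in> T \<Longrightarrow> roots_poly ?J (\<rho> f) = f"
      have TC: "topspace (subtopology (C_top n) T) = T" using openin_subset[OF T(1)] by auto
      define z where "z j f = restrict (\<lambda>i. \<rho> f (Transposition.transpose 1 j i)) ?J" for j f
      have tr: "Transposition.transpose 1 j i \<in> ?J" if "j \<in> ?J" "i \<in> ?J" for i j
        using that n by (auto simp: Transposition.transpose_def)
      have zc: "z j f \<in> ordered_configs n UNIV" if j: "j \<in> ?J" and f: "f \<in> T" for j f
        unfolding z_def
      proof (rule ordered_configsI)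
        show "inj_on (\<lambda>i. \<rho> f (Transposition.transpose 1 j i)) ?J"
        proof (rule inj_onI)
          fix i i' assume i: "i \<in> ?J" "i' \<in> ?J" and eq: "\<rho> f (Transposition.transpose 1 j i) = \<rho> f (Transposition.transpose 1 j i')"
          have "Transposition.transpose 1 j i = Transposition.transpose 1 j i'"
            by (rule inj_onD[OF inj[OF f] eq tr[OF j i(1)] tr[OF j i(2)]])
          then show "i = i'" by (metis transpose_involutory)
        qed
      qed simp
      have z1: "z j f 1 = \<rho> f j" for j f using J(3) by (simp add: z_def)
      have z_img: "z j f ` ?J = \<rho> f ` ?J" if j: "j \<in> ?J" for j f
      proof -
        have "Transposition.transpose 1 j permutes ?J" by (rule permutes_swap_id[OF J(3) j])
        then have "\<rho> f ` (Transposition.transpose 1 j ` ?J) = \<rho> f ` ?J" by (simp only: permutes_image)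
        then show ?thesis unfolding z_def image_restrict_eq by (simp only: image_image)
      qed
      have z_rp: "roots_poly ?J (z j f) = f" if j: "j \<in> ?J" and f: "f \<in> T" for j f
        using roots_poly_eq_iff_image[OF J(1) ordered_configsD(1)[OF zc[OF j f]] inj[OF f]] z_img[OF j] rp[OF f] by simp
      define s where "s j f = perm_class ?K (z j f)" for j f
      have s_cont: "continuous_map (subtopology (C_top n) T) (D_top n) (s j)" if j: "j \<in> ?J" for j
      proof -
        have "continuous_map (subtopology (C_top n) T) ?X (z j)"
        proof (rule continuous_map_into_ordered_configs_top)
          show "z j f \<in> ordered_configs n UNIV" if "f \<in> topspace (subtopology (C_top n) T)" for f
            using zc[OF j] that TC by blast
          show "continuous_map (subtopology (C_top n) T) euclidean (\<lambda>f. z j f i)" if i: "i \<in> ?J" for i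
            using contr[OF tr[OF j i]] i by (simp add: z_def)
        qed
        from continuous_map_compose[OF this quotient_imp_continuous_map[OF quo]]
        show ?thesis by (simp add: s_def[abs_def] o_def)
      qed
      have s_sec: "D_to_C n (s j f) = f" if "j \<in> ?J" "f \<in> T" for j f
        unfolding s_def D_to_C_eq_roots_poly[OF n] by (rule z_rp[OF that])
      have injK: "inj_on u ?K" if "u \<in> ordered_configs n UNIV" for u
        using ordered_configsD(1)[OF that] unfolding JK by simp
      have s_inj: "inj_on (\<lambda>j. s j f) ?J" if f: "f \<in> T" for f
      proof (rule inj_onI)
        fix j j' assume j: "j \<in> ?J" "j' \<in> ?J" "s j f = s j' f"
        have "\<forall>i. i \<notin> ?K \<longrightarrow> z j f i = z j' f i"
          using j(3) unfolding s_def perm_class_eq_iff[OF injK[OF zc[OF j(1) f]] injK[OF zc[OF j(2) f]]] by (rule conjunct1)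
        then have "z j f 1 = z j' f 1" by simp
        then show "j = j'" unfolding z1 by (rule inj_onD[OF inj[OF f] _ j(1,2)])
      qed
      have s_all: "\<exists>j\<in>?J. s j (D_to_C n c) = c" if c: "c \<in> topspace (D_top n)" "D_to_C n c \<in> T" for c
      proof -
        obtain u where u: "u \<in> ordered_configs n UNIV" "c = perm_class ?K u" using c(1) unfolding topD by blast
        define f where "f = roots_poly ?J u"
        have cf: "D_to_C n c = f" unfolding u(2) f_def by (rule D_to_C_eq_roots_poly[OF n])
        have f: "f \<in> T" using c(2) cf by simp
        have img: "u ` ?J = \<rho> f ` ?J"
          using roots_poly_eq_iff_image[OF J(1) ordered_configsD(1)[OF u(1)] inj[OF f]] rp[OF f] by (simp add: f_def)
        have "u 1 \<in> \<rho> f ` ?J" unfolding img[symmetric] by (rule imageI[OF J(3)])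
        then obtain j where j: "j \<in> ?J" "u 1 = \<rho> f j" by blast
        have 1: "z j f 1 = u 1" by (simp only: z1 j(2))
        have "u 1 \<notin> u ` ?K" "z j f 1 \<notin> z j f ` ?K"
          using ordered_configsD(1)[OF u(1)] ordered_configsD(1)[OF zc[OF j(1) f]] unfolding JK by simp_all
        moreover have "insert (z j f 1) (z j f ` ?K) = insert (u 1) (u ` ?K)"
          using z_img[OF j(1), of f] img unfolding JK image_insert by simp
        ultimately have "z j f ` ?K = u ` ?K" unfolding 1 by (simp only: insert_ident not_False_eq_True)
        moreover have "z j f i = u i" if "i \<notin> ?K" for i
        proof (cases "i = 1")
          case False
          then have "i \<notin> ?J" using that JK by blast
          from ordered_configsD(3)[OF zc[OF j(1) f] this] ordered_configsD(3)[OF u(1) this]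
          show ?thesis by (rule trans[OF _ sym])
        qed (simp only: 1)
        ultimately have "s j f = c"
          unfolding s_def u(2) perm_class_eq_iff[OF injK[OF zc[OF j(1) f]] injK[OF u(1)]] by blast
        then show ?thesis unfolding cf using j(1) by (rule bexI)
      qed
      show ?thesis
        by (rule exI[of _ T], rule exI[of _ ?J], rule exI[of _ s])
           (intro conjI T J(2) ballI impI s_cont s_sec s_inj s_all)
    qed
  qed
  show ?thesis by (rule covering_map_of_degreeI_sections[OF haus cont _ loc]) (use n in auto)
qed

section \<open>The tower of coverings\<close>

lemma crit_points_poly_of_distinct_values:
  assumes I: "finite I" and d: "config_disc I v \<noteq> 0" and v: "\<And>i. i \<in> I \<Longrightarrow> crit_values_map I c i = v i"
  shows "critical_values (crit_points_poly I c) = v ` I"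
    and "crit_points_poly I c \<in> C0_set (Suc (card I))"
    and "crit_points_poly I c \<in> Z_set (Suc (card I))"
    and "crit_poly (crit_points_poly I c) = [:0, 1:] * roots_poly I v"
proof -
  let ?f = "crit_points_poly I c"
  have vd: "inj_on v I \<and> (\<forall>i\<in>I. v i \<noteq> 0)" using d unfolding config_disc_nonzero_iff[OF I] .
  note v_inj = conjunct1[OF vd] and v_nz = bspec[OF conjunct2[OF vd]]
  have crit: "poly (pderiv ?f) t = 0 \<longleftrightarrow> t \<in> c ` I" for t
    using poly_roots_poly_eq_0[OF I, of c t] by (simp add: pderiv_crit_points_poly del: of_nat_Suc)
  have val: "poly ?f (c i) = v i" if "i \<in> I" for i using v[OF that] by (simp add: crit_values_map_def)
  show cv: "critical_values ?f = v ` I"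
  proof
    show "critical_values ?f \<subseteq> v ` I"
    proof
      fix y assume "y \<in> critical_values ?f"
      then obtain t where t: "poly (pderiv ?f) t = 0" "y = poly ?f t" unfolding critical_values_def by blast
      from t(1) have "t \<in> c ` I" unfolding crit .
      then obtain i where "i \<in> I" "t = c i" by blast
      then show "y \<in> v ` I" using t(2) val by simp
    qed
    show "v ` I \<subseteq> critical_values ?f"
    proof
      fix y assume "y \<in> v ` I"
      then obtain i where i: "i \<in> I" "y = v i" by blast
      have "poly (pderiv ?f) (c i) = 0" unfolding crit by (rule imageI[OF i(1)])
      then show "y \<in> critical_values ?f" unfolding critical_values_def i(2) val[OF i(1), symmetric] by blast
    qed
  qed
  have sf: "rsquarefree ?f"
    unfolding rsquarefree_roots
  proof (intro allI notI, elim conjE)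
    fix a assume a: "poly ?f a = 0" "poly (pderiv ?f) a = 0"
    from a(2) have "a \<in> c ` I" unfolding crit .
    then obtain i where i: "i \<in> I" "a = c i" by blast
    then show False using val[OF i(1)] v_nz[OF i(1)] a(1) by simp
  qed
  have lc: "lead_coeff ?f = 1" by (rule lead_coeff_crit_points_poly)
  define A where "A = {z. poly ?f z = 0}"
  have "roots_poly A (\<lambda>z. z) = ?f"
    using complex_poly_decompose_rsquarefree[OF sf] lc by (simp add: roots_poly_def A_def)
  then have "card A = Suc (card I)" using degree_roots_poly[of A "\<lambda>z. z"] degree_crit_points_poly[of I c] by simp
  then have "?f \<in> C_set (Suc (card I))"
    unfolding C_set_def A_def using lc degree_crit_points_poly[of I c] by blast
  then show C0: "?f \<in> C0_set (Suc (card I))" by (simp add: C0_set_def)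
  show "?f \<in> Z_set (Suc (card I))"
    using C0 by (simp add: Z_set_def C0_set_def cv card_image[OF v_inj])
  show "crit_poly ?f = [:0, 1:] * roots_poly I v"
    unfolding crit_poly_def cv roots_poly_def by (simp only: prod.reindex[OF v_inj] o_def)
qed

text \<open>A critical point with value \<open>0\<close> would be a multiple root.\<close>
lemma Z_set_crit_values_nonzero:
  assumes "f \<in> Z_set n" shows "0 \<notin> critical_values f"
proof
  assume "0 \<in> critical_values f"
  then obtain c where c: "poly (pderiv f) c = 0" "poly f c = 0" unfolding critical_values_def by auto
  have f: "f \<in> C_set n" using assms by (simp add: Z_set_def)
  define A where "A = {z. poly f z = 0}"
  have "f \<noteq> 0" using C_setD(1)[OF f] by auto
  then have A: "finite A" unfolding A_def by (rule poly_roots_finite)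
  have "f \<in> C_set (card A)" using C_setD(3)[OF f] f by (simp add: A_def)
  then have fA: "roots_poly A (\<lambda>a. a) = f"
    by (rule C_set_eq_roots_poly[OF _ A]) (simp_all add: A_def)
  have cA: "c \<in> A" using c(2) by (simp add: A_def)
  have "f = [:- c, 1:] * roots_poly (A - {c}) (\<lambda>a. a)"
    unfolding fA[symmetric] roots_poly_def by (rule prod.remove[OF A cA])
  then have "pderiv f = [:- c, 1:] * pderiv (roots_poly (A - {c}) (\<lambda>a. a)) + roots_poly (A - {c}) (\<lambda>a. a) * pderiv [:- c, 1:]"
    by (simp only: pderiv_mult)
  then have "poly (pderiv f) c = poly (roots_poly (A - {c}) (\<lambda>a. a)) c" by (simp add: pderiv_pCons)
  then show False using c(1) poly_roots_poly_eq_0[of "A - {c}" "\<lambda>a. a" c] A by simp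
qed

text \<open>There are as many critical values as critical points, so choosing a critical point for each value enumerates all of them.\<close>
lemma Z_set_eq_crit_points_poly:
  assumes I: "finite I" and f: "f \<in> Z_set (Suc (card I))" and v: "bij_betw v I (critical_values f)"
  obtains c where "c \<in> I \<rightarrow>\<^sub>E UNIV" "crit_points_poly I c = f" "\<And>i. i \<in> I \<Longrightarrow> crit_values_map I c i = v i"
    "inj_on c I" "\<And>i. i \<in> I \<Longrightarrow> poly (pderiv f) (c i) = 0" "config_disc I v \<noteq> 0"
proof -
  have fC: "f \<in> C_set (Suc (card I))" and f0: "poly f 0 = 0" using f unfolding Z_set_def by blast+
  have "\<exists>t. poly (pderiv f) t = 0 \<and> poly f t = v i" if "i \<in> I" for i
  proof -
    have "v i \<in> critical_values f" using v that by (auto simp: bij_betw_def)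
    then obtain t where t: "v i = poly f t" "poly (pderiv f) t = 0" unfolding critical_values_def by blast
    show ?thesis using t(2) t(1)[symmetric] by (intro exI[of _ t] conjI)
  qed
  then have "\<forall>i\<in>I. \<exists>t. poly (pderiv f) t = 0 \<and> poly f t = v i" by (intro ballI)
  from bchoice[OF this] obtain c0 where c00: "\<forall>i\<in>I. poly (pderiv f) (c0 i) = 0 \<and> poly f (c0 i) = v i"
    by (elim exE)
  note c0 = bspec[OF c00]
  define c where "c = restrict c0 I"
  have c: "poly (pderiv f) (c i) = 0" "poly f (c i) = v i" if "i \<in> I" for i
    using c0[OF that] that by (simp_all add: c_def)
  have v_inj: "inj_on v I" using v by (simp add: bij_betw_def)
  have c_inj: "inj_on c I"
  proof (rule inj_onI)
    fix i j assume ij: "i \<in> I" "j \<in> I" "c i = c j"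
    have "v i = v j" unfolding c(2)[OF ij(1), symmetric] c(2)[OF ij(2), symmetric] ij(3) ..
    then show "i = j" by (rule inj_onD[OF v_inj _ ij(1,2)])
  qed
  let ?k = "of_nat (Suc (card I)) :: complex"
  have k: "?k \<noteq> 0" by (simp del: of_nat_Suc)
  have "smult (inverse ?k) (pderiv f) = roots_poly I c"
  proof (rule monic_eq_roots_poly[OF I _ _ c_inj])
    have deg: "degree (pderiv f) = card I" using C_setD(2)[OF fC] by (simp add: degree_pderiv)
    show deg': "degree (smult (inverse ?k) (pderiv f)) = card I" using k by (simp add: deg del: of_nat_Suc)
    have "coeff f (Suc (card I)) = 1" using C_setD(1)[OF fC] unfolding C_setD(2)[OF fC] .
    then have "coeff (pderiv f) (card I) = ?k" unfolding coeff_pderiv by (simp only: mult_1_right)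
    then show "lead_coeff (smult (inverse ?k) (pderiv f)) = 1"
      unfolding deg' coeff_smult by (simp only: left_inverse[OF k])
    show "poly (smult (inverse ?k) (pderiv f)) (c i) = 0" if "i \<in> I" for i using c(1)[OF that] by simp
  qed
  then have "smult ?k (roots_poly I c) = smult ?k (smult (inverse ?k) (pderiv f))" by (simp only:)
  also have "\<dots> = pderiv f" unfolding smult_smult right_inverse[OF k] by simp
  finally have "pderiv (crit_points_poly I c) = pderiv f" by (simp only: pderiv_crit_points_poly)
  then have fc: "crit_points_poly I c = f"
    by (rule poly_eq_of_pderiv_eq[of _ _ 0]) (simp only: poly_crit_points_poly_0 f0)
  have "v ` I = critical_values f" using v by (simp add: bij_betw_def)
  then have "\<forall>i\<in>I. v i \<noteq> 0" using Z_set_crit_values_nonzero[OF f] by (metis imageI)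
  then have disc: "config_disc I v \<noteq> 0" unfolding config_disc_nonzero_iff[OF I] by (rule conjI[OF v_inj])
  have val: "crit_values_map I c i = v i" if "i \<in> I" for i
    unfolding crit_values_map_def fc by (rule c(2)[OF that])
  have cE: "c \<in> I \<rightarrow>\<^sub>E UNIV" by (simp add: c_def)
  show ?thesis by (rule that[of c, OF cE fc val c_inj c(1) disc])
qed

text \<open>The polynomial determines the set of its critical points, and the distinct values \<open>v\<close> determine their order.\<close>
lemma crit_points_poly_inject:
  assumes I: "finite I" and v: "inj_on v I"
    and c: "c \<in> I \<rightarrow>\<^sub>E UNIV" "\<And>i. i \<in> I \<Longrightarrow> crit_values_map I c i = v i"
    and c': "c' \<in> I \<rightarrow>\<^sub>E UNIV" "\<And>i. i \<in> I \<Longrightarrow> crit_values_map I c' i = v i"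
    and eq: "crit_points_poly I c = crit_points_poly I c'"
  shows "c = c'"
proof (rule PiE_ext[OF c(1) c'(1)])
  fix i assume i: "i \<in> I"
  have crit: "{t. poly (pderiv (crit_points_poly I b)) t = 0} = b ` I" for b
    using roots_of_roots_poly[OF I, of b] by (simp add: pderiv_crit_points_poly del: of_nat_Suc)
  have "c ` I = c' ` I" unfolding crit[symmetric] eq ..
  then have "c i \<in> c' ` I" using imageI[OF i, of c] by (simp only:)
  then obtain k where k: "k \<in> I" "c i = c' k" by blast
  have "v i = v k"
    unfolding c(2)[OF i, symmetric] c'(2)[OF k(1), symmetric] crit_values_map_def eq k(2) ..
  then have "i = k" by (rule inj_onD[OF v _ i k(1)])
  then show "c i = c' i" using k(2) by simp
qed

lemma X_times_roots_poly:
  assumes "finite I" "j0 \<notin> I" "z j0 = 0"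
  shows "[:0, 1:] * roots_poly I z = roots_poly (insert j0 I) z"
  using assms by (simp add: roots_poly_def)

text \<open>Given \<open>w\<close>, number its non-zero roots continuously near \<open>w\<close> and apply the local inverses of the map from critical points to
critical values.  The resulting critical points define the sections; there are \<open>n ^ (n - 1)\<close> of them by the count of the fibre.\<close>
lemma covering_crit_poly:
  assumes n: "n \<ge> 2"
  shows "covering_map_of_degree (n ^ (n - 1)) (Z_top n) (C0_top n) crit_poly"
proof -
  let ?I = "{1..n-1}" and ?J = "{0..n-1}"
  have I: "finite ?I" "card ?I = n - 1" "Suc (card ?I) = n" using n by auto
  have J: "finite ?J" "card ?J = n" "0 \<in> ?J" using n by auto
  have JI: "?J = insert 0 ?I" by auto
  have I0: "0 \<notin> ?I" by simp
  let ?F = "crit_values_map ?I" and ?f = "crit_points_poly ?I"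
  interpret finite_polynomial_map ?I "Suc (card ?I)" ?F "config_disc ?I" "card ?I + card (?I \<times> ?I - Id)"
    by (rule finite_polynomial_map_crit_values_map[OF I(1)])
  have topZ: "topspace (Z_top n) = Z_set n" by (simp add: Z_top_def)
  have haus: "Hausdorff_space (Z_top n)"
    unfolding Z_top_def by (rule Hausdorff_space_subtopology[OF Hausdorff_space_coeff_top])
  have critW: "crit_poly f \<in> C0_set n" if f: "f \<in> Z_set n" for f
  proof -
    define A where "A = insert 0 (critical_values f)"
    have 0: "0 \<notin> critical_values f" by (rule Z_set_crit_values_nonzero[OF f])
    have "card (critical_values f) = n - 1" using f by (simp add: Z_set_def)
    then have fin: "finite (critical_values f)" using n by (intro card_ge_0_finite) simp
    then have A: "finite A" "card A = n" using 0 \<open>card (critical_values f) = n - 1\<close> n by (simp_all add: A_def)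
    have "crit_poly f = roots_poly A (\<lambda>a. a)"
      unfolding crit_poly_def roots_poly_def A_def using fin 0 by simp
    then show ?thesis using roots_poly_in_C0_set[of A "\<lambda>a. a" 0] A by (simp add: A_def)
  qed
  have cont: "continuous_map (Z_top n) (C0_top n) crit_poly"
    unfolding C0_top_def continuous_map_in_subtopology
  proof
    show "crit_poly \<in> topspace (Z_top n) \<rightarrow> C0_set n" using critW by (simp add: topZ)
    let ?k = "of_nat n :: complex"
    have k: "?k \<noteq> 0" using n by simp
    \<comment> \<open>Continuity: the critical points are the roots of the monic multiple of the derivative, so they and their values can locally be numbered continuously.\<close>
    define h where "h f = smult (inverse ?k) (pderiv f)" for f
    have h_crit: "h (?f c) = roots_poly ?I c" for c
      unfolding h_def pderiv_crit_points_poly I(3) using k by simp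
    have Z_ex: "\<exists>c. ?f c = f \<and> inj_on c ?I \<and> config_disc ?I (?F c) \<noteq> 0" if f: "f \<in> Z_set n" for f
    proof -
      have cf: "card (critical_values f) = n - 1" using f by (simp add: Z_set_def)
      then have "finite (critical_values f)" using n by (intro card_ge_0_finite) simp
      then obtain v where v: "bij_betw v ?I (critical_values f)"
        using finite_same_card_bij[OF I(1)] I(2) cf by metis
      have f': "f \<in> Z_set (Suc (card ?I))" using f unfolding I(3) .
      show ?thesis
      proof (rule Z_set_eq_crit_points_poly[OF I(1) f' v])
        fix c assume c: "?f c = f" "inj_on c ?I" "config_disc ?I v \<noteq> 0" "\<And>i. i \<in> ?I \<Longrightarrow> ?F c i = v i"
        have "config_disc ?I (?F c) = config_disc ?I v" by (rule disc_cong) (rule c(4))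
        then have "config_disc ?I (?F c) \<noteq> 0" using c(3) by simp
        then show ?thesis using c(1,2) by blast
      qed
    qed
    have hC: "h f \<in> C_set (n - 1)" if f: "f \<in> Z_set n" for f
    proof -
      obtain c where c: "?f c = f" "inj_on c ?I" using Z_ex[OF f] by blast
      have "h f = roots_poly ?I c" using h_crit[of c] c(1) by simp
      then show ?thesis using roots_poly_in_C_set[OF I(1) c(2)] I(2) by simp
    qed
    have h_cont: "continuous_map (Z_top n) (C_top (n - 1)) h"
      unfolding C_top_def continuous_map_in_subtopology continuous_map_coeff_top_iff
    proof (intro conjI allI)
      show "h \<in> topspace (Z_top n) \<rightarrow> C_set (n - 1)" using hC by (simp add: topZ)
      fix l
      have "poly_fn {Suc l} (Suc 0) (\<lambda>x. (inverse ?k * of_nat (Suc l)) * x (Suc l))"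
        by (intro poly_fn_cmult poly_fn_coord) auto
      then have "continuous_map (Z_top n) euclidean (\<lambda>f. (inverse ?k * of_nat (Suc l)) * coeff f (Suc l))"
        by (rule continuous_map_poly_fn[rotated 2])
           (simp_all add: Z_top_def continuous_map_from_subtopology[OF continuous_map_coeff])
      then show "continuous_map (Z_top n) euclidean (\<lambda>f. coeff (h f) l)"
        by (simp add: h_def coeff_pderiv mult.assoc)
    qed
    show "continuous_map (Z_top n) coeff_top crit_poly"
    proof (rule continuous_map_locally)
      fix f0 assume "f0 \<in> topspace (Z_top n)"
      then have f0: "f0 \<in> Z_set n" by (simp add: topZ)
      obtain c where c: "?f c = f0" "inj_on c ?I" using Z_ex[OF f0] by blast
      have "h f0 = roots_poly ?I c" using h_crit[of c] c(1) by simp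
      then have r: "bij_betw c ?I {z. poly (h f0) z = 0}"
        using roots_of_roots_poly[OF I(1), of c] c(2) by (simp add: bij_betw_def)
      show "\<exists>T. openin (Z_top n) T \<and> f0 \<in> T \<and> continuous_map (subtopology (Z_top n) T) coeff_top crit_poly"
      proof (rule local_roots[OF hC[OF f0] I(1,2) r])
        fix T \<rho> and \<epsilon> :: real
        assume T: "openin (C_top (n - 1)) T" "h f0 \<in> T"
          and contr: "\<And>j. j \<in> ?I \<Longrightarrow> continuous_map (subtopology (C_top (n - 1)) T) euclidean (\<lambda>g. \<rho> g j)"
          and inj: "\<And>g. g \<in> T \<Longrightarrow> inj_on (\<rho> g) ?I" and rp: "\<And>g. g \<in> T \<Longrightarrow> roots_poly ?I (\<rho> g) = g"
        define U where "U = {f \<in> topspace (Z_top n). h f \<in> T}"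
        have U: "openin (Z_top n) U" unfolding U_def by (rule openin_continuous_map_preimage[OF h_cont T(1)])
        have UZ: "f \<in> Z_set n" "h f \<in> T" if "f \<in> U" for f using that by (simp_all add: U_def topZ)
        define a where "a f = (?F (\<rho> (h f)))(0 := 0)" for f
        have a_cont: "continuous_map (subtopology (Z_top n) U) euclidean (\<lambda>f. a f j)" if j: "j \<in> ?J" for j
        proof (cases "j = 0")
          case False
          then have jI: "j \<in> ?I" using j by simp
          have hU: "continuous_map (subtopology (Z_top n) U) (subtopology (C_top (n - 1)) T) h"
            unfolding continuous_map_in_subtopology
            by (intro conjI continuous_map_from_subtopology[OF h_cont]) (simp add: U_def)
          have "continuous_map (subtopology (Z_top n) U) euclidean (\<lambda>f. \<rho> (h f) i)" if "i \<in> ?I" for i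
            using continuous_map_compose[OF hU contr[OF that]] by (simp add: o_def)
          from continuous_map_poly_fn[OF I(1) this poly_F[OF jI]] show ?thesis using False by (simp add: a_def)
        qed (simp add: a_def)
        have "continuous_map (subtopology (Z_top n) U) coeff_top (\<lambda>f. roots_poly ?J (a f))"
          by (rule continuous_map_roots_poly[OF J(1) a_cont])
        then have "continuous_map (subtopology (Z_top n) U) coeff_top crit_poly"
        proof (rule continuous_map_eq)
          fix f assume "f \<in> topspace (subtopology (Z_top n) U)"
          then have f: "f \<in> U" by simp
          obtain c where c: "?f c = f" "inj_on c ?I" "config_disc ?I (?F c) \<noteq> 0" using Z_ex[OF UZ(1)[OF f]] by blast
          have "roots_poly ?I (\<rho> (h f)) = roots_poly ?I c" using rp[OF UZ(2)[OF f]] h_crit[of c] c(1) by simp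
          then have f\<rho>: "?f (\<rho> (h f)) = f" using c(1) by (simp only: crit_points_poly_def)
          have img: "\<rho> (h f) ` ?I = c ` I" if "I = ?I" for I
            using roots_poly_eq_iff_image[OF I(1) inj[OF UZ(2)[OF f]] c(2)]
              \<open>roots_poly ?I (\<rho> (h f)) = roots_poly ?I c\<close> that by simp
          have Fimg: "?F b ` ?I = poly f ` (b ` ?I)" if "?f b = f" for b
            unfolding image_image crit_values_map_def that ..
          have "?F (\<rho> (h f)) ` ?I = ?F c ` ?I"
            unfolding Fimg[OF f\<rho>] Fimg[OF c(1)] img[OF refl] ..
          then have F_img: "?F (\<rho> (h f)) ` ?I = ?F c ` ?I" .
          have Fc: "inj_on (?F c) ?I \<and> (\<forall>i\<in>?I. ?F c i \<noteq> 0)" using c(3) unfolding config_disc_nonzero_iff[OF I(1)] .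
          have "card (?F (\<rho> (h f)) ` ?I) = card ?I" unfolding F_img by (rule card_image[OF conjunct1[OF Fc]])
          then have F_inj: "inj_on (?F (\<rho> (h f))) ?I" by (rule eq_card_imp_inj_on[OF I(1)])
          have F_nz: "?F (\<rho> (h f)) i \<noteq> 0" if "i \<in> ?I" for i
          proof -
            have "?F (\<rho> (h f)) i \<in> ?F c ` ?I" unfolding F_img[symmetric] by (rule imageI[OF that])
            then obtain k where "k \<in> ?I" "?F (\<rho> (h f)) i = ?F c k" by (rule imageE)
            then show ?thesis using bspec[OF conjunct2[OF Fc], of k] by simp
          qed
          have "config_disc ?I (?F (\<rho> (h f))) \<noteq> 0"
            unfolding config_disc_nonzero_iff[OF I(1)] by (intro conjI ballI F_inj F_nz)
          from crit_points_poly_of_distinct_values(4)[OF I(1) this refl]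
          have "crit_poly f = [:0, 1:] * roots_poly ?I (?F (\<rho> (h f)))" by (simp only: f\<rho>)
          also have "roots_poly ?I (?F (\<rho> (h f))) = roots_poly ?I (a f)"
            by (rule roots_poly_cong) (simp add: a_def)
          also have "[:0, 1:] * roots_poly ?I (a f) = roots_poly ?J (a f)"
            unfolding JI by (rule X_times_roots_poly[OF I(1) I0]) (simp add: a_def)
          finally show "roots_poly ?J (a f) = crit_poly f" by simp
        qed
        moreover have "f0 \<in> U" using f0 T(2) by (simp add: U_def topZ)
        ultimately show ?thesis using U by blast
      qed
    qed
  qed
  have loc: "\<exists>T (A :: (nat \<Rightarrow> complex) set) s. openin (C0_top n) T \<and> w0 \<in> T \<and> card A = n ^ (n - 1) \<and>
      (\<forall>j\<in>A. continuous_map (subtopology (C0_top n) T) (Z_top n) (s j)) \<and> (\<forall>j\<in>A. \<forall>w\<in>T. crit_poly (s j w) = w) \<and>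
      (\<forall>w\<in>T. inj_on (\<lambda>j. s j w) A) \<and> (\<forall>f\<in>topspace (Z_top n). crit_poly f \<in> T \<longrightarrow> (\<exists>j\<in>A. s j (crit_poly f) = f))"
    if "w0 \<in> topspace (C0_top n)" for w0
  proof -
    have w0: "w0 \<in> C0_set n" using that by simp
    show ?thesis
    proof (rule local_roots_C0[OF w0 J])
      fix T0 \<rho>
      assume T0: "openin (C0_top n) T0" "w0 \<in> T0"
        and contr: "\<And>j. j \<in> ?J \<Longrightarrow> continuous_map (subtopology (C0_top n) T0) euclidean (\<lambda>f. \<rho> f j)"
        and inj: "\<And>w. w \<in> T0 \<Longrightarrow> inj_on (\<rho> w) ?J" and rp: "\<And>w. w \<in> T0 \<Longrightarrow> roots_poly ?J (\<rho> w) = w"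
        and r0: "\<And>w. w \<in> T0 \<Longrightarrow> \<rho> w 0 = 0"
      have injI: "inj_on (\<rho> w) ?I" if "w \<in> T0" for w by (rule inj_on_subset[OF inj[OF that]]) (simp add: JI)
      have nzI: "0 \<notin> \<rho> w ` ?I" if "w \<in> T0" for w
        using inj[OF that] r0[OF that] unfolding JI by simp
      have disc: "config_disc ?I (\<rho> w) \<noteq> 0" if "w \<in> T0" for w
        unfolding config_disc_nonzero_iff[OF I(1)]
      proof (intro conjI ballI injI[OF that] notI)
        fix i assume "i \<in> ?I" "\<rho> w i = 0"
        from imageI[OF this(1), of "\<rho> w"] show False using nzI[OF that] unfolding \<open>\<rho> w i = 0\<close> by (rule notE[rotated])
      qed
      have wI: "[:0, 1:] * roots_poly ?I (\<rho> w) = w" if "w \<in> T0" for w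
        unfolding X_times_roots_poly[where z = "\<rho> w", OF I(1) I0 r0[OF that]] JI[symmetric] by (rule rp[OF that])
      define v where "v = \<rho> w0"
      have dv: "config_disc ?I v \<noteq> 0" unfolding v_def by (rule disc[OF T0(2)])
      show ?thesis
      proof (rule fibre_branches[OF dv])
        fix \<eta> L \<sigma>
        assume \<eta>: "\<eta> > 0" "L > 0"
          and fib: "\<And>y. vdist ?I y v < \<eta> \<Longrightarrow> fibre y = (\<lambda>c. \<sigma> c y) ` fibre v"
          and s_inj: "\<And>y. vdist ?I y v < \<eta> \<Longrightarrow> inj_on (\<lambda>c. \<sigma> c y) (fibre v)"
          and lip: "\<And>c y y'. c \<in> fibre v \<Longrightarrow> vdist ?I y v < \<eta> \<Longrightarrow> vdist ?I y' v < \<eta> \<Longrightarrow> vdist ?I (\<sigma> c y) (\<sigma> c y') \<le> L * vdist ?I y y'"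
        define T where "T = {w \<in> topspace (subtopology (C0_top n) T0). vdist ?I (\<rho> w) v < \<eta>}"
        have dist_open: "openin (subtopology (C0_top n) T0) {w \<in> topspace (subtopology (C0_top n) T0). vdist ?I (\<rho> w) u < e}" for u e
        proof -
          have "continuous_map (subtopology (C0_top n) T0) euclidean (\<lambda>w. \<rho> w i)" if "i \<in> ?I" for i
            using contr[of i] that by simp
          then have "continuous_map (subtopology (C0_top n) T0) euclidean (\<lambda>w. vdist ?I (\<rho> w) u)"
            unfolding vdist_def continuous_map_atin limitin_canonical_iff by (intro ballI tendsto_intros) auto
          from openin_continuous_map_preimage[OF this, of "{..<e}"] show ?thesis by simp
        qed
        have T_open: "openin (C0_top n) T" unfolding T_def by (rule openin_trans_full[OF dist_open T0(1)])
        have T0C: "topspace (subtopology (C0_top n) T0) = T0" using openin_subset[OF T0(1)] by auto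
        have TT0: "w \<in> T0" "vdist ?I (\<rho> w) v < \<eta>" if "w \<in> T" for w using that T0C by (auto simp: T_def)
        have TC: "topspace (subtopology (C0_top n) T) = T" using openin_subset[OF T_open] by auto
        have w0T: "w0 \<in> T" using T0 \<eta>(1) T0C by (simp add: T_def v_def)
        define s where "s c w = ?f (\<sigma> c (\<rho> w))" for c w
        have s_fib: "\<sigma> c (\<rho> w) \<in> fibre (\<rho> w)" if "c \<in> fibre v" "w \<in> T" for c w
          unfolding fib[OF TT0(2)[OF that(2)]] by (rule imageI[OF that(1)])
        have s_val: "?F (\<sigma> c (\<rho> w)) i = \<rho> w i" if "c \<in> fibre v" "w \<in> T" "i \<in> ?I" for c w i
          by (rule fibreD(2)[OF s_fib[OF that(1,2)] that(3)])
        have s_sec: "crit_poly (s c w) = w" and s_Z: "s c w \<in> Z_set n" if c: "c \<in> fibre v" and w: "w \<in> T" for c w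
        proof -
          have "crit_poly (s c w) = [:0, 1:] * roots_poly ?I (\<rho> w)"
            unfolding s_def by (rule crit_points_poly_of_distinct_values(4)[OF I(1) disc[OF TT0(1)[OF w]]]) (rule s_val[OF c w])
          then show "crit_poly (s c w) = w" unfolding wI[OF TT0(1)[OF w]] .
          have "s c w \<in> Z_set (Suc (card ?I))"
            unfolding s_def by (rule crit_points_poly_of_distinct_values(3)[OF I(1) disc[OF TT0(1)[OF w]]]) (rule s_val[OF c w])
          then show "s c w \<in> Z_set n" unfolding I(3) .
        qed
        have s_cont: "continuous_map (subtopology (C0_top n) T) (Z_top n) (s c)" if c: "c \<in> fibre v" for c
          unfolding Z_top_def continuous_map_in_subtopology
        proof
          show "s c \<in> topspace (subtopology (C0_top n) T) \<rightarrow> Z_set n" unfolding TC using s_Z[OF c] by blast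
          have coord: "continuous_map (subtopology (C0_top n) T) euclidean (\<lambda>w. \<sigma> c (\<rho> w) i)" if i: "i \<in> ?I" for i
          proof (rule continuous_map_euclideanI_dist)
            fix w1 and e :: real assume "w1 \<in> topspace (subtopology (C0_top n) T)" and e: "e > 0"
            then have w1: "w1 \<in> T" using TC by blast
            define U where "U = {w \<in> topspace (subtopology (C0_top n) T0). vdist ?I (\<rho> w) (\<rho> w1) < e / L}"
            have "openin (C0_top n) U" unfolding U_def by (rule openin_trans_full[OF dist_open T0(1)])
            then have "openin (subtopology (C0_top n) T) (T \<inter> U)" by (rule openin_subtopology_Int2)
            moreover have "w1 \<in> T \<inter> U" using w1 TT0(1)[OF w1] T0C e \<eta>(2) by (simp add: U_def)
            moreover have "dist (\<sigma> c (\<rho> w) i) (\<sigma> c (\<rho> w1) i) < e" if w: "w \<in> T \<inter> U" for w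
            proof -
              have wT: "w \<in> T" and wU: "vdist ?I (\<rho> w) (\<rho> w1) < e / L" using w by (simp_all add: U_def)
              have "dist (\<sigma> c (\<rho> w) i) (\<sigma> c (\<rho> w1) i) \<le> vdist ?I (\<sigma> c (\<rho> w)) (\<sigma> c (\<rho> w1))"
                unfolding dist_norm by (rule norm_le_vdist[OF I(1) i])
              also have "\<dots> \<le> L * vdist ?I (\<rho> w) (\<rho> w1)" by (rule lip[OF c TT0(2)[OF wT] TT0(2)[OF w1]])
              also have "\<dots> < L * (e / L)" by (rule mult_strict_left_mono[OF wU \<eta>(2)])
              also have "\<dots> = e" using \<eta>(2) by simp
              finally show ?thesis .
            qed
            ultimately show "\<exists>U. openin (subtopology (C0_top n) T) U \<and> w1 \<in> U \<and> (\<forall>w\<in>U. dist (\<sigma> c (\<rho> w) i) (\<sigma> c (\<rho> w1) i) < e)"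
              by blast
          qed
          show "continuous_map (subtopology (C0_top n) T) coeff_top (s c)"
            unfolding continuous_map_coeff_top_iff s_def
          proof
            fix k show "continuous_map (subtopology (C0_top n) T) euclidean (\<lambda>w. coeff (?f (\<sigma> c (\<rho> w))) k)"
            proof (cases "k \<le> Suc (card ?I)")
              case True
              show ?thesis by (rule continuous_map_poly_fn[OF I(1) coord poly_fn_coeff_crit_points_poly[OF I(1) True]])
            next
              case False
              then have "coeff (?f z) k = 0" for z by (intro coeff_crit_points_poly_above) simp
              then show ?thesis by simp
            qed
          qed
        qed
        have s_inj': "inj_on (\<lambda>c. s c w) (fibre v)" if w: "w \<in> T" for w
        proof (rule inj_onI)
          fix c c' assume c: "c \<in> fibre v" "c' \<in> fibre v" "s c w = s c' w"
          have "\<sigma> c (\<rho> w) = \<sigma> c' (\<rho> w)"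
            by (rule crit_points_poly_inject[OF I(1) injI[OF TT0(1)[OF w]] fibreD(1)[OF s_fib[OF c(1) w]] s_val[OF c(1) w]
                  fibreD(1)[OF s_fib[OF c(2) w]] s_val[OF c(2) w] c(3)[unfolded s_def]])
          then show "c = c'" by (rule inj_onD[OF s_inj[OF TT0(2)[OF w]] _ c(1,2)])
        qed
        have s_all: "\<exists>c\<in>fibre v. s c (crit_poly f) = f" if f: "f \<in> topspace (Z_top n)" and w: "crit_poly f \<in> T" for f
        proof -
          have fZ: "f \<in> Z_set (Suc (card ?I))" using f unfolding topZ I(3) .
          define w where "w = crit_poly f"
          have wT: "w \<in> T" using that(2) by (simp add: w_def)
          have fin: "finite (critical_values f)"
          proof (rule card_ge_0_finite)
            show "0 < card (critical_values f)" using fZ n by (simp add: Z_set_def)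
          qed
          have "{t. poly w t = 0} = insert 0 (critical_values f)"
            using fin by (auto simp: w_def crit_poly_def poly_prod)
          moreover have "{t. poly w t = 0} = insert 0 (\<rho> w ` ?I)"
            using roots_of_roots_poly[OF J(1), of "\<rho> w"] rp[OF TT0(1)[OF wT]] r0[OF TT0(1)[OF wT]] unfolding JI by simp
          ultimately have "insert 0 (critical_values f) = insert 0 (\<rho> w ` ?I)" by simp
          then have "critical_values f = \<rho> w ` ?I"
            by (simp only: insert_ident[OF Z_set_crit_values_nonzero[OF fZ] nzI[OF TT0(1)[OF wT]]])
          then have bij: "bij_betw (\<rho> w) ?I (critical_values f)"
            using injI[OF TT0(1)[OF wT]] by (simp add: bij_betw_def)
          show ?thesis
          proof (rule Z_set_eq_crit_points_poly[OF I(1) fZ bij])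
            fix b assume b: "b \<in> ?I \<rightarrow>\<^sub>E UNIV" "?f b = f" "\<And>i. i \<in> ?I \<Longrightarrow> ?F b i = \<rho> w i"
            have "b \<in> fibre (\<rho> w)" unfolding fibre_def using b(1,3) by simp
            then obtain c where c: "c \<in> fibre v" "b = \<sigma> c (\<rho> w)" unfolding fib[OF TT0(2)[OF wT]] by (rule imageE)
            have "s c w = f" unfolding s_def c(2)[symmetric] by (rule b(2))
            then show ?thesis using c(1) unfolding w_def by (intro bexI)
          qed
        qed
        have card: "card (fibre v) = n ^ (n - 1)" using card_fibre[OF dv, unfolded I(3)] by (simp only: I(2))
        show ?thesis
          by (rule exI[of _ T], rule exI[of _ "fibre v"], rule exI[of _ s])
             (intro conjI T_open w0T card ballI impI s_cont s_sec s_inj' s_all)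
      qed
    qed
  qed
  show ?thesis by (rule covering_map_of_degreeI_sections[OF haus cont _ loc]) (use n in auto)
qed

lemma Z_tower_subset: "Z_tower n j \<subseteq> Z_set n"
  by (induction n j rule: Z_tower.induct) auto

text \<open>Each stage is the restriction of the covering of \<open>C0\<close> to the preimage of the stage below it.\<close>
lemma covering_Z_tower:
  assumes n: "n \<ge> 2" and j: "j \<ge> 1"
  shows "covering_map_of_degree (n ^ (n - 1)) (Z_tower_top n (j + 1)) (Z_tower_top n j) crit_poly"
proof -
  obtain k where k: "j = Suc k" using j by (cases j) auto
  have ZC0: "Z_set n \<subseteq> C0_set n" by (auto simp: Z_set_def C0_set_def)
  have sub: "Z_tower n j \<subseteq> C0_set n" using Z_tower_subset[of n j] ZC0 by blast
  have Y: "subtopology (C0_top n) (Z_tower n j) = Z_tower_top n j"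
    unfolding C0_top_def Z_tower_top_def subtopology_subtopology using sub by (simp add: Int_absorb1)
  have pre: "{f \<in> topspace (Z_top n). crit_poly f \<in> Z_tower n j} = Z_tower n (j + 1)"
    by (simp add: k Z_top_def)
  have X: "subtopology (Z_top n) (Z_tower n (j + 1)) = Z_tower_top n (j + 1)"
    unfolding Z_top_def Z_tower_top_def subtopology_subtopology
    using Z_tower_subset[of n "j + 1"] by (simp only: Int_absorb1)
  from covering_map_of_degree_restrict[OF covering_crit_poly[OF n], of "Z_tower n j"] sub
  show ?thesis unfolding pre X Y by simp
qed

text \<open>The map \<open>\<theta>\<^sub>n\<close> is the covering of \<open>C0\<close> followed by the homeomorphism from \<open>C0\<close> to \<open>V\<^sub>n\<close>.\<close>
lemma covering_theta:
  assumes n: "n \<ge> 2"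
  shows "covering_map_of_degree (n ^ (n - 1)) (Z_top n) (V_top n) (theta n)"
proof -
  let ?I = "{1..n-1}"
  have n1: "n \<ge> 1" using n by simp
  show ?thesis
  proof (rule V_top_homeomorphism[OF n1])
    fix \<kappa>
    assume \<kappa>: "homeomorphic_map (V_top n) (C0_top n) \<kappa>"
      and \<kappa>_eq: "\<And>v. v \<in> ordered_configs (n - 1) (- {0}) \<Longrightarrow> \<kappa> (perm_class ?I v) = roots_poly {0..n-1} (v(0 := 0))"
    show ?thesis
    proof (rule covering_map_of_degree_lift_homeomorphism[OF covering_crit_poly[OF n] \<kappa>])
      fix f assume "f \<in> topspace (Z_top n)"
      then have f: "f \<in> Z_set n" by (simp add: Z_top_def)
      have cf: "card (critical_values f) = n - 1" using f by (simp add: Z_set_def)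
      then have "finite (critical_values f)" using n by (intro card_ge_0_finite) simp
      then obtain v0 where v0: "bij_betw v0 ?I (critical_values f)"
        using finite_same_card_bij[of ?I "critical_values f"] cf by auto
      define v where "v = restrict v0 ?I"
      have v: "bij_betw v ?I (critical_values f)"
        using v0 by (rule bij_betw_cong[THEN iffD1, rotated]) (simp add: v_def)
      have "v \<in> theta n f" using v by (simp add: theta_def v_def)
      then have th: "theta n f = perm_class ?I v" by (rule theta_eq_perm_class)
      have vc: "v \<in> ordered_configs (n - 1) (- {0})"
        unfolding v_def
      proof (rule ordered_configsI)
        show "inj_on v0 ?I" using v0 by (simp add: bij_betw_def)
        show "v0 i \<in> - {0}" if "i \<in> ?I" for i
          using bij_betwE[OF v0] that Z_set_crit_values_nonzero[OF f] by force
      qed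
      have "crit_poly f = [:0, 1:] * roots_poly ?I v"
        unfolding crit_poly_def roots_poly_def using prod.reindex_bij_betw[OF v, of "\<lambda>a. [:- a, 1:]"] by simp
      also have "roots_poly ?I v = roots_poly ?I (v(0 := 0))" by (rule roots_poly_cong) simp
      also have "[:0, 1:] * roots_poly ?I (v(0 := 0)) = roots_poly (insert 0 ?I) (v(0 := 0))"
        by (rule X_times_roots_poly) simp_all
      also have "insert 0 ?I = {0..n-1}" by auto
      finally have "crit_poly f = roots_poly {0..n-1} (v(0 := 0))" .
      then have "\<kappa> (theta n f) = crit_poly f" unfolding th \<kappa>_eq[OF vc] by (rule sym)
      moreover have "theta n f \<in> topspace (V_top n)"
        unfolding th V_top_def topspace_quotient_topology topspace_ordered_configs_top by (rule imageI[OF vc])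
      ultimately show "theta n f \<in> topspace (V_top n) \<and> \<kappa> (theta n f) = crit_poly f" by blast
    qed
  qed
qed

theorem theorem1p2:
  fixes n :: nat
  assumes "n \<ge> 2"
  shows "(\<forall>j\<ge>1. covering_map_of_degree (n ^ (n - 1)) (Z_tower_top n (j + 1)) (Z_tower_top n j) crit_poly)
       \<and> Z_tower_top n 1 = Z_top n
       \<and> covering_map_of_degree (n ^ (n - 1)) (Z_top n) (V_top n) (theta n)
       \<and> V_top n homotopy_equivalent_space D_top n
       \<and> covering_map_of_degree n (D_top n) (C_top n) (D_to_C n)"
proof (intro conjI allI impI)
  have n1: "n \<ge> 1" using assms by simp
  show "covering_map_of_degree (n ^ (n - 1)) (Z_tower_top n (j + 1)) (Z_tower_top n j) crit_poly" if "j \<ge> 1" for j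
    by (rule covering_Z_tower[OF assms that])
  show "Z_tower_top n 1 = Z_top n" by (simp add: Z_tower_top_def Z_top_def)
  show "covering_map_of_degree (n ^ (n - 1)) (Z_top n) (V_top n) (theta n)" by (rule covering_theta[OF assms])
  show "V_top n homotopy_equivalent_space D_top n" by (rule V_top_homotopy_equivalent_D_top[OF n1])
  show "covering_map_of_degree n (D_top n) (C_top n) (D_to_C n)" by (rule covering_D_to_C[OF n1])
qed

end
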